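(* Let $U\subset\mathbb{R}^2$ be open and let $E,F,G,e,f,g:U\to\mathbb{R}$ be smooth functions with $E\ge 0$, $G\ge 0$, $EG-F^2\ge 0$. Assume that they decompose as $$\begin{pmatrix}E&F\\ F&G\end{pmatrix}=\Lambda\begin{pmatrix}E_\Omega&F_\Omega\\ F_\Omega&G_\Omega\end{pmatrix}\Lambda^T,\qquad \begin{pmatrix}e&f\\ f&g\end{pmatrix}=\Lambda\begin{pmatrix}e_\Omega&f_{1\Omega}\\ f_{2\Omega}&g_\Omega\end{pmatrix},\qquad \Lambda=\begin{pmatrix}\lambda_{11}&\lambda_{12}\\ \lambda_{21}&\lambda_{22}\end{pmatrix},$$ where all the entries $\lambda_{ij},E_\Omega,F_\Omega,G_\Omega,e_\Omega,f_{1\Omega},f_{2\Omega},g_\Omega$ are smooth real functions on $U$, $E_\Omega>0$, $G_\Omega>0$, $E_\Omega G_\Omega-F_\Omega^2>0$, the set $\lambda_\Omega^{-1}(0)$ has empty interior, where $\lambda_\Omega=\det\Lambda$, and $$\Lambda_{(1)u}\begin{pmatrix}E_\Omega&F_\Omega\\ F_\Omega&G_\Omega\end{pmatrix}\Lambda_{(2)}^T-\Lambda_{(1)}\begin{pmatrix}E_\Omega&F_\Omega\\ F_\Omega&G_\Omega\end{pmatrix}\Lambda_{(2)u}^T+E_v-F_u\in\mathfrak{T}_\Omega,$$ $$\Lambda_{(1)v}\begin{pmatrix}E_\Omega&F_\Omega\\ F_\Omega&G_\Omega\end{pmatrix}\Lambda_{(2)}^T-\Lambda_{(1)}\begin{pmatrix}E_\Omega&F_\Omega\\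 F_\Omega&G_\Omega\end{pmatrix}\Lambda_{(2)v}^T+F_v-G_u\in\mathfrak{T}_\Omega,$$ where $\mathfrak{T}_\Omega$ is the principal ideal generated by $\lambda_\Omega$ in the ring $C^\infty(U,\mathbb{R})$. Assume that $E,F,G,e,f,g$ formally satisfy the Gauss and Mainardi-Codazzi equations at all $(u,v)\in U\setminus\lambda_\Omega^{-1}(0)$. Then for each $(u_0,v_0)\in U$ there exist a neighborhood $V\subset U$ of $(u_0,v_0)$ and a frontal $\mathbf{x}:V\to\mathbf{x}(V)\subset\mathbb{R}^3$ with a tangent moving base $\Omega$ such that on $V$: $D\mathbf{x}=\Omega\Lambda^T$, $$\mathbf{I}_\Omega=\begin{pmatrix}E_\Omega&F_\Omega\\ F_\Omega&G_\Omega\end{pmatrix},\qquad \mathbf{II}_\Omega=\begin{pmatrix}e_\Omega&f_{1\Omega}\\ f_{2\Omega}&g_\Omega\end{pmatrix},$$ and $\mathbf{x}$ has $E,F,G$ and $e,f,g$ as coefficients of its first and second fundamental forms, respectively. Furthermore, if $U$ is connected and $\mathbf{x},\bar{\mathbf{x}}:U\to\mathbb{R}^3$ are two frontals defined on $U$, with tangent moving bases $\Omega,\bar\Omega:U\to\mathcal{M}_{3\times 2}(\mathbb{R})$ respectively, both satisfying all these conditions on $U$ (with the same given functions), then there exist a translation $\mathbf{T}$ of $\mathbb{R}^3$ and a proper linear orthogonal transformation $\rho$ of $\mathbb{R}^3$ (i.e. $\rho\in SO(3)$) such that $\bar\Omega=\rho\,\Omega$ and $\bar{\mathbf{x}}=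\mathbf{T}\circ\rho\circ\mathbf{x}$.
   Context: Smooth means $C^\infty$; subscripts $u,v$ denote (entrywise) partial derivatives with respect to the coordinates $(u,v)$; $\Lambda_{(i)}$ is the $i$-th row of $\Lambda$ and $\Lambda_{(i)u}=(\Lambda_{(i)})_u$, $\Lambda_{(i)v}=(\Lambda_{(i)})_v$. $D\mathbf{f}$ is the Jacobian matrix; vectors are columns; $\mathcal{M}_{m\times n}(\mathbb{R})$ is the space of real $m\times n$ matrices. A smooth map $\mathbf{x}:U\to\mathbb{R}^3$ is a frontal if for every $p\in U$ there are an open neighborhood $V_p\subset U$ of $p$ and a smooth $\nu:V_p\to\mathbb{R}^3$ with $|\nu|=1$ and $\nu\cdot\mathbf{x}_u=\nu\cdot\mathbf{x}_v=0$ on $V_p$. A tangent moving base of $\mathbf{x}$ is a smooth map $\Omega=(\mathbf{w}_1\ \mathbf{w}_2)$ into $\mathcal{M}_{3\times2}(\mathbb{R})$, defined on the domain of $\mathbf{x}$, whose columns are linearly independent at every point and such that $\mathbf{x}_u,\mathbf{x}_v\in\mathrm{span}(\mathbf{w}_1,\mathbf{w}_2)$ at every point. Given $\Omega$, put $\mathbf{n}=\frac{\mathbf{w}_1\times\mathbf{w}_2}{\|\mathbf{w}_1\times\mathbf{w}_2\|}$, $\mathbf{I}_\Omega=\Omega^T\Omega$, $\mathbf{II}_\Omega=-\Omega^TD\mathbf{n}$. The coefficients of the first fundamental form of $\mathbf{x}$ are $E=\mathbf{x}_u\cdot\mathbf{x}_u$, $F=\mathbf{x}_u\cdot\mathbf{x}_v$,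 $G=\mathbf{x}_v\cdot\mathbf{x}_v$; those of the second fundamental form, with respect to the unit normal $\mathbf{n}$ induced by $\Omega$, are $e=\mathbf{n}\cdot\mathbf{x}_{uu}$, $f=\mathbf{n}\cdot\mathbf{x}_{uv}$, $g=\mathbf{n}\cdot\mathbf{x}_{vv}$. Gauss and Mainardi-Codazzi equations: where $EG-F^2\ne0$ set $\mathbf{I}=\begin{pmatrix}E&F\\ F&G\end{pmatrix}$, $K=\frac{eg-f^2}{EG-F^2}$ and define the Christoffel symbols by $$\begin{pmatrix}\Gamma_{11}^1&\Gamma_{11}^2\\ \Gamma_{21}^1&\Gamma_{21}^2\end{pmatrix}=\begin{pmatrix}\frac12E_u&F_u-\frac12E_v\\ \frac12E_v&\frac12G_u\end{pmatrix}\mathbf{I}^{-1},\quad \begin{pmatrix}\Gamma_{12}^1&\Gamma_{12}^2\\ \Gamma_{22}^1&\Gamma_{22}^2\end{pmatrix}=\begin{pmatrix}\frac12E_v&\frac12G_u\\ F_v-\frac12G_u&\frac12G_v\end{pmatrix}\mathbf{I}^{-1}.$$ Gauss equation: $(\Gamma_{12}^2)_u-(\Gamma_{11}^2)_v+\Gamma_{12}^1\Gamma_{11}^2+\Gamma_{12}^2\Gamma_{12}^2-\Gamma_{11}^2\Gamma_{22}^2-\Gamma_{11}^1\Gamma_{12}^2=-EK$. Mainardi-Codazzi equations: $e_v-f_u=e\Gamma_{12}^1+f(\Gamma_{12}^2-\Gamma_{11}^1)-g\Gamma_{11}^2$ and $f_v-g_u=e\Gamma_{22}^1+f(\Gamma_{22}^2-\Gamma_{12}^1)-g\Gamma_{12}^2$.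 *)

theory Defs
  imports "HOL-Analysis.Analysis"
begin

text \<open>
  Coordinates: a point \<open>(u, v)\<close> of the plane is \<open>p :: real^2\<close> with \<open>u = p $ 1\<close>, \<open>v = p $ 2\<close>.
  A real matrix with m rows and n columns is a \<open>real^n^m\<close>.  Maps defined on an open set are total
  functions of which only the values on that set matter; all derivatives are taken at points
  interior to it.
\<close>

definition mat2 :: "real \<Rightarrow> real \<Rightarrow> real \<Rightarrow> real \<Rightarrow> real^2^2" where
  "mat2 a b c d = vector [vector [a, b], vector [c, d]]"


subsection \<open>Smooth maps and partial derivatives\<close>

text \<open>\<open>Ck_on k S f\<close>: on the open set \<open>S\<close> the map \<open>f\<close> is of class \<open>C\<^sup>k\<close>.  Quantifying over all
  directions \<open>h\<close> is the same as asking the derivative to be of class \<open>C\<^sup>k\<close>.\<close>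

primrec Ck_on ::
  "nat \<Rightarrow> 'a::euclidean_space set \<Rightarrow> ('a \<Rightarrow> 'b::real_normed_vector) \<Rightarrow> bool" where
  "Ck_on 0 S f \<longleftrightarrow> continuous_on S f"
| "Ck_on (Suc k) S f \<longleftrightarrow> (\<forall>p\<in>S. f differentiable (at p)) \<and>
     (\<forall>h. Ck_on k S (\<lambda>p. frechet_derivative f (at p) h))"

definition smooth_on :: "'a::euclidean_space set \<Rightarrow> ('a \<Rightarrow> 'b::real_normed_vector) \<Rightarrow> bool" where
  "smooth_on S f \<longleftrightarrow> (\<forall>k. Ck_on k S f)"

definition pd :: "2 \<Rightarrow> (real^2 \<Rightarrow> 'b::real_normed_vector) \<Rightarrow> real^2 \<Rightarrow> 'b" where
  "pd i f p = frechet_derivative f (at p) (axis i 1)"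

abbreviation du :: "(real^2 \<Rightarrow> 'b::real_normed_vector) \<Rightarrow> real^2 \<Rightarrow> 'b" where
  "du \<equiv> pd 1"

abbreviation dv :: "(real^2 \<Rightarrow> 'b::real_normed_vector) \<Rightarrow> real^2 \<Rightarrow> 'b" where
  "dv \<equiv> pd 2"

text \<open>The principal ideal generated by \<open>l\<close> in \<open>C\<^sup>\<infinity>(U, \<real>)\<close>.  Elements of that ring are functions on
  \<open>U\<close>, hence the equation is only required on \<open>U\<close>.\<close>

definition principal_ideal :: "(real^2) set \<Rightarrow> (real^2 \<Rightarrow> real) \<Rightarrow> (real^2 \<Rightarrow> real) set" where
  "principal_ideal U l = {h. \<exists>k. smooth_on U k \<and> (\<forall>p\<in>U. h p = k p * l p)}"


subsection \<open>Frontals and tangent moving bases\<close>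

definition frontal_on :: "(real^2) set \<Rightarrow> (real^2 \<Rightarrow> real^3) \<Rightarrow> bool" where
  "frontal_on V x \<longleftrightarrow> smooth_on V x \<and>
     (\<forall>p\<in>V. \<exists>W \<nu>. open W \<and> p \<in> W \<and> W \<subseteq> V \<and> smooth_on W \<nu> \<and>
        (\<forall>q\<in>W. norm (\<nu> q :: real^3) = 1 \<and> \<nu> q \<bullet> du x q = 0 \<and> \<nu> q \<bullet> dv x q = 0))"

text \<open>Linear independence of the two columns as a family: they are distinct and form an
  independent set.\<close>

definition tangent_moving_base_on ::
  "(real^2) set \<Rightarrow> (real^2 \<Rightarrow> real^3) \<Rightarrow> (real^2 \<Rightarrow> real^2^3) \<Rightarrow> bool" where
  "tangent_moving_base_on V x \<Omega> \<longleftrightarrow> smooth_on V \<Omega> \<and>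
     (\<forall>p\<in>V. column 1 (\<Omega> p) \<noteq> column 2 (\<Omega> p) \<and>
        independent {column 1 (\<Omega> p), column 2 (\<Omega> p)} \<and>
        du x p \<in> span {column 1 (\<Omega> p), column 2 (\<Omega> p)} \<and>
        dv x p \<in> span {column 1 (\<Omega> p), column 2 (\<Omega> p)})"

definition unit_normal :: "(real^2 \<Rightarrow> real^2^3) \<Rightarrow> real^2 \<Rightarrow> real^3" where
  "unit_normal \<Omega> p =
     (1 / norm (cross3 (column 1 (\<Omega> p)) (column 2 (\<Omega> p)))) *\<^sub>R
       cross3 (column 1 (\<Omega> p)) (column 2 (\<Omega> p))"

definition first_form :: "(real^2 \<Rightarrow> real^2^3) \<Rightarrow> real^2 \<Rightarrow> real^2^2" where
  "first_form \<Omega> p = transpose (\<Omega> p) ** \<Omega> p"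

definition second_form :: "(real^2 \<Rightarrow> real^2^3) \<Rightarrow> real^2 \<Rightarrow> real^2^2" where
  "second_form \<Omega> p = - (transpose (\<Omega> p) ** jacobian (unit_normal \<Omega>) (at p))"


subsection \<open>Gauss and Mainardi-Codazzi equations\<close>

text \<open>\<open>christoffel E F G i j k\<close> is \<open>\<Gamma>\<^sub>i\<^sub>j\<^sup>k\<close>, the entry in row \<open>i\<close> and column \<open>k\<close> of the matrix with
  index \<open>j\<close>; only meaningful where \<open>E G - F\<^sup>2 \<noteq> 0\<close>.\<close>

definition christoffel_matrix ::
  "(real^2 \<Rightarrow> real) \<Rightarrow> (real^2 \<Rightarrow> real) \<Rightarrow> (real^2 \<Rightarrow> real) \<Rightarrow> 2 \<Rightarrow> real^2 \<Rightarrow> real^2^2" where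
  "christoffel_matrix E F G j p =
     (if j = 1
      then mat2 (du E p / 2) (du F p - dv E p / 2)
                (dv E p / 2) (du G p / 2)
      else mat2 (dv E p / 2) (du G p / 2)
                (dv F p - du G p / 2) (dv G p / 2))
     ** matrix_inv (mat2 (E p) (F p) (F p) (G p))"

definition christoffel ::
  "(real^2 \<Rightarrow> real) \<Rightarrow> (real^2 \<Rightarrow> real) \<Rightarrow> (real^2 \<Rightarrow> real) \<Rightarrow> 2 \<Rightarrow> 2 \<Rightarrow> 2 \<Rightarrow> real^2 \<Rightarrow> real" where
  "christoffel E F G i j k p = christoffel_matrix E F G j p $ i $ k"

definition gauss_eq_at ::
  "(real^2 \<Rightarrow> real) \<Rightarrow> (real^2 \<Rightarrow> real) \<Rightarrow> (real^2 \<Rightarrow> real) \<Rightarrow>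
     (real^2 \<Rightarrow> real) \<Rightarrow> (real^2 \<Rightarrow> real) \<Rightarrow> (real^2 \<Rightarrow> real) \<Rightarrow> real^2 \<Rightarrow> bool" where
  "gauss_eq_at E F G e f g p \<longleftrightarrow>
     (let \<Gamma> = christoffel E F G; K = (e p * g p - (f p)\<^sup>2) / (E p * G p - (F p)\<^sup>2) in
      du (\<Gamma> 1 2 2) p - dv (\<Gamma> 1 1 2) p + \<Gamma> 1 2 1 p * \<Gamma> 1 1 2 p + \<Gamma> 1 2 2 p * \<Gamma> 1 2 2 p
        - \<Gamma> 1 1 2 p * \<Gamma> 2 2 2 p - \<Gamma> 1 1 1 p * \<Gamma> 1 2 2 p = - E p * K)"

definition mainardi_codazzi_eqs_at ::
  "(real^2 \<Rightarrow> real) \<Rightarrow> (real^2 \<Rightarrow> real) \<Rightarrow> (real^2 \<Rightarrow> real) \<Rightarrow>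
     (real^2 \<Rightarrow> real) \<Rightarrow> (real^2 \<Rightarrow> real) \<Rightarrow> (real^2 \<Rightarrow> real) \<Rightarrow> real^2 \<Rightarrow> bool" where
  "mainardi_codazzi_eqs_at E F G e f g p \<longleftrightarrow>
     (let \<Gamma> = christoffel E F G in
      dv e p - du f p = e p * \<Gamma> 1 2 1 p + f p * (\<Gamma> 1 2 2 p - \<Gamma> 1 1 1 p) - g p * \<Gamma> 1 1 2 p \<and>
      dv f p - du g p = e p * \<Gamma> 2 2 1 p + f p * (\<Gamma> 2 2 2 p - \<Gamma> 1 2 1 p) - g p * \<Gamma> 1 2 2 p)"


subsection \<open>Frontals realizing prescribed data\<close>

definition first_fundamental_coeffs_on ::
  "(real^2) set \<Rightarrow> (real^2 \<Rightarrow> real^3) \<Rightarrow>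
     (real^2 \<Rightarrow> real) \<Rightarrow> (real^2 \<Rightarrow> real) \<Rightarrow> (real^2 \<Rightarrow> real) \<Rightarrow> bool" where
  "first_fundamental_coeffs_on V x E F G \<longleftrightarrow>
     (\<forall>p\<in>V. E p = du x p \<bullet> du x p \<and> F p = du x p \<bullet> dv x p \<and> G p = dv x p \<bullet> dv x p)"

definition second_fundamental_coeffs_on ::
  "(real^2) set \<Rightarrow> (real^2 \<Rightarrow> real^3) \<Rightarrow> (real^2 \<Rightarrow> real^2^3) \<Rightarrow>
     (real^2 \<Rightarrow> real) \<Rightarrow> (real^2 \<Rightarrow> real) \<Rightarrow> (real^2 \<Rightarrow> real) \<Rightarrow> bool" where
  "second_fundamental_coeffs_on V x \<Omega> e f g \<longleftrightarrow>
     (\<forall>p\<in>V. e p = unit_normal \<Omega> p \<bullet> du (du x) p \<and> f p = unit_normal \<Omega> p \<bullet> dv (du x) p \<and>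
        g p = unit_normal \<Omega> p \<bullet> dv (dv x) p)"

definition realizes_on ::
  "(real^2) set \<Rightarrow> (real^2 \<Rightarrow> real) \<Rightarrow> (real^2 \<Rightarrow> real) \<Rightarrow> (real^2 \<Rightarrow> real) \<Rightarrow>
     (real^2 \<Rightarrow> real) \<Rightarrow> (real^2 \<Rightarrow> real) \<Rightarrow> (real^2 \<Rightarrow> real) \<Rightarrow>
     (real^2 \<Rightarrow> real^2^2) \<Rightarrow> (real^2 \<Rightarrow> real^2^2) \<Rightarrow> (real^2 \<Rightarrow> real^2^2) \<Rightarrow>
     (real^2 \<Rightarrow> real^3) \<Rightarrow> (real^2 \<Rightarrow> real^2^3) \<Rightarrow> bool" where
  "realizes_on V E F G e f g \<Lambda> I\<^sub>\<Omega> II\<^sub>\<Omega> x \<Omega> \<longleftrightarrow>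
     frontal_on V x \<and> tangent_moving_base_on V x \<Omega> \<and>
     (\<forall>p\<in>V. jacobian x (at p) = \<Omega> p ** transpose (\<Lambda> p)) \<and>
     (\<forall>p\<in>V. first_form \<Omega> p = I\<^sub>\<Omega> p) \<and>
     (\<forall>p\<in>V. second_form \<Omega> p = II\<^sub>\<Omega> p) \<and>
     first_fundamental_coeffs_on V x E F G \<and>
     second_fundamental_coeffs_on V x \<Omega> e f g"

end

theory Submission
  imports Defs
begin

text \<open>
  Write \<open>I\<^sub>\<Omega> = L L\<^sup>T\<close> with \<open>L\<close> smooth and lower triangular. Then \<open>\<Omega> = (e\<^sub>1 e\<^sub>2) L\<^sup>T\<close> with \<open>e\<^sub>1, e\<^sub>2\<close> orthonormal,
  and the problem becomes one for the orthonormal frame \<open>(e\<^sub>1, e\<^sub>2, e\<^sub>3)\<close>: the rows of \<open>\<Lambda> L\<close> give its dual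
  coframe and the columns of \<open>L\<^sup>-\<^sup>1 II\<^sub>\<Omega>\<close> the derivatives of \<open>e\<^sub>3\<close>. Vanishing torsion determines the connection
  form up to division by \<open>\<lambda>\<^sub>\<Omega>\<close>, and the two ideal conditions say exactly that this division is possible in
  the smooth functions. Where \<open>\<lambda>\<^sub>\<Omega> \<noteq> 0\<close>, the Gauss and Mainardi-Codazzi equations are equivalent to the
  structure equations of the frame, which extend to all of \<open>U\<close> by density. They are the compatibility
  conditions of a total linear system for the frame and the base point, whose local solutions are the
  frontals sought. Its coefficients on the frame are skew-symmetric, so orthonormality is preserved and
  two solutions differ by a constant rotation; the base points then differ by a translation.
\<close>

section \<open>Calculus of smooth maps\<close>

text \<open>The obstacle is the singular set. The Christoffel symbols involve the inverse of the
  first fundamental form, so the classical system for (x_u, x_v, n) is undefined exactly where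
  \<open>det \<Lambda>\<close> vanishes. In an orthonormal frame the tangential part of the system
  is one rotation rate per coordinate direction, all coefficients are smooth on \<open>U\<close>,
  and each structure equation says that a smooth function vanishes, which can be checked on a dense
  set. The ideal conditions are stated for \<open>\<Lambda>\<close> and not for the coframe matrix.
  Differentiating \<open>L\<close> produces a correction that is skew in the two rows of
  \<open>\<Lambda>\<close>, hence a multiple of \<open>det \<Lambda>\<close>, so membership in the
  ideal survives the change of frame. The diagonal of \<open>L\<close> is taken positive. This makes
  the passage between \<open>\<Omega>\<close> and its orthonormal frame unique in both directions
  and compatible with orientation: the third frame vector is the normal induced by
  \<open>\<Omega>\<close>, and the rotation relating two frames also relates the two bases.\<close>

lemma Ck_on_cong:
  assumes "open S" "\<And>p. p \<in> S \<Longrightarrow> f p = g p" "Ck_on k S f"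
  shows "Ck_on k S g"
  using assms(2,3)
proof (induction k arbitrary: f g)
  case 0
  then show ?case by (simp cong: continuous_on_cong)
next
  case (Suc k)
  have der: "(g has_derivative frechet_derivative f (at p)) (at p)" if "p \<in> S" for p
  proof (rule has_derivative_transform_within_open[OF _ assms(1) that])
    show "(f has_derivative frechet_derivative f (at p)) (at p)"
      using Suc.prems(2) that by (simp add: frechet_derivative_works[symmetric])
  qed (rule Suc.prems(1))
  have "Ck_on k S (\<lambda>p. frechet_derivative g (at p) h)" for h
  proof (rule Suc.IH)
    show "Ck_on k S (\<lambda>p. frechet_derivative f (at p) h)" using Suc.prems by simp
  qed (use frechet_derivative_at[OF der] in simp)
  with der show ?case by (auto simp: differentiable_def)
qed

text \<open>Derivatives are computed with the \<open>has_derivative\<close> rules, whereas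
  \<open>Ck_on\<close> speaks of the chosen \<open>frechet_derivative\<close>. The two agree on the
  open set, and this rule hides that transfer in the inductions below.\<close>

lemma Ck_on_SucI:
  assumes "open S" "\<And>p. p \<in> S \<Longrightarrow> (f has_derivative f' p) (at p)" "\<And>h. Ck_on k S (\<lambda>p. f' p h)"
  shows "Ck_on (Suc k) S f"
proof -
  have "Ck_on k S (\<lambda>p. frechet_derivative f (at p) h)" for h
    by (rule Ck_on_cong[OF assms(1) _ assms(3)[of h]]) (simp add: frechet_derivative_at[OF assms(2)])
  with assms(2) show ?thesis by (auto simp: differentiable_def)
qed

lemma Ck_on_SucD: "Ck_on (Suc k) S f \<Longrightarrow> Ck_on k S f"
proof (induction k arbitrary: f)
  case 0
  then show ?case
    by (auto simp: intro!: continuous_at_imp_continuous_on differentiable_imp_continuous_within)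
next
  case (Suc k)
  then have "Ck_on (Suc k) S (\<lambda>p. frechet_derivative f (at p) h)" for h
    by (metis Ck_on.simps(2))
  with Suc show ?case by auto
qed

lemma Ck_on_Suc_derivative:
  assumes "Ck_on (Suc k) S f" "p \<in> S"
  shows "(f has_derivative frechet_derivative f (at p)) (at p)"
  using assms by (simp add: frechet_derivative_works[symmetric])

lemma Ck_on_subset: "Ck_on k S f \<Longrightarrow> T \<subseteq> S \<Longrightarrow> Ck_on k T f"
  by (induction k arbitrary: f) (auto intro: continuous_on_subset)

lemma Ck_on_const: "Ck_on k S (\<lambda>p. c)"
  by (induction k arbitrary: c) auto

lemma Ck_on_add:
  assumes "open S" "Ck_on k S f" "Ck_on k S g"
  shows "Ck_on k S (\<lambda>p. f p + g p)"
  using assms(2,3)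
proof (induction k arbitrary: f g)
  case (Suc k)
  show ?case
    by (rule Ck_on_SucI[OF assms(1) has_derivative_add[OF Ck_on_Suc_derivative Ck_on_Suc_derivative]])
       (use Suc in auto)
qed (auto intro: continuous_intros)

lemma (in bounded_linear) Ck_on:
  assumes "open S" "Ck_on k S g"
  shows "Ck_on k S (\<lambda>p. f (g p))"
  using assms(2)
proof (induction k arbitrary: g)
  case 0
  then show ?case by (auto intro: continuous_on)
next
  case (Suc k)
  show ?case
    by (rule Ck_on_SucI[OF assms(1) has_derivative[OF Ck_on_Suc_derivative]])
       (use Suc in auto)
qed

text \<open>The product rule gives two terms, each bilinear in one factor and a derivative of the
  other, so the induction hypothesis applies once the undifferentiated factor is lowered by one
  order. Scalings, inner products, cross products and the action on frames are all
  instances.\<close>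

lemma (in bounded_bilinear) Ck_on:
  assumes "open S" "Ck_on k S f" "Ck_on k S g"
  shows "Ck_on k S (\<lambda>p. prod (f p) (g p))"
  using assms(2,3)
proof (induction k arbitrary: f g)
  case (Suc k)
  note SucD = Suc.prems[THEN Ck_on_SucD]
  show ?case
    by (rule Ck_on_SucI[OF assms(1) FDERIV[OF Ck_on_Suc_derivative Ck_on_Suc_derivative]])
       (use Suc SucD in \<open>auto intro!: Ck_on_add assms(1)\<close>)
qed (auto intro: continuous_on)

text \<open>The derivative of \<open>1 / f\<close> is a polynomial in \<open>1 / f\<close> and the
  derivative of \<open>f\<close>, so each order of regularity yields the next.\<close>

lemma Ck_on_inverse:
  fixes f :: "'a::euclidean_space \<Rightarrow> real"
  assumes "open S" "Ck_on k S f" "\<And>p. p \<in> S \<Longrightarrow> f p \<noteq> 0"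
  shows "Ck_on k S (\<lambda>p. inverse (f p))"
  using assms(2)
proof (induction k)
  case (Suc k)
  note IH = Suc.IH[OF Ck_on_SucD[OF Suc.prems]]
  show ?case
  proof (rule Ck_on_SucI[OF assms(1)])
    show "((\<lambda>x. inverse (f x)) has_derivative
             (\<lambda>h. - (inverse (f p) * frechet_derivative f (at p) h * inverse (f p)))) (at p)"
      if "p \<in> S" for p
      using Deriv.has_derivative_inverse[OF assms(3)[OF that] Ck_on_Suc_derivative[OF Suc.prems that]] .
    show "Ck_on k S (\<lambda>p. - (inverse (f p) * frechet_derivative f (at p) h * inverse (f p)))" for h
      using Suc.prems by (intro bounded_linear.Ck_on[OF bounded_linear_minus[OF bounded_linear_ident]]
          bounded_bilinear.Ck_on[OF bounded_bilinear_mult] assms(1) IH) auto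
  qed
qed (use assms in \<open>auto intro!: continuous_intros\<close>)

text \<open>The bootstrapping of the inverse again: the derivative of the root contains only the
  reciprocal of the root itself and the derivative of \<open>f\<close>.\<close>

lemma Ck_on_sqrt:
  fixes f :: "'a::euclidean_space \<Rightarrow> real"
  assumes "open S" "Ck_on k S f" "\<And>p. p \<in> S \<Longrightarrow> f p > 0"
  shows "Ck_on k S (\<lambda>p. sqrt (f p))"
  using assms(2)
proof (induction k)
  case (Suc k)
  note IH = Suc.IH[OF Ck_on_SucD[OF Suc.prems]]
  show ?case
  proof (rule Ck_on_SucI[OF assms(1)])
    show "((\<lambda>x. sqrt (f x)) has_derivative
             (\<lambda>h. inverse (sqrt (f p)) / 2 * frechet_derivative f (at p) h)) (at p)"
      if "p \<in> S" for p
      by (rule has_derivative_eq_rhs[OF has_derivative_real_sqrt])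
        (use assms(3)[OF that] in \<open>auto intro!: Ck_on_Suc_derivative[OF Suc.prems that] simp: field_simps fun_eq_iff\<close>)
    show "Ck_on k S (\<lambda>p. inverse (sqrt (f p)) / 2 * frechet_derivative f (at p) h)" for h
      using Suc.prems assms(3) by (intro bounded_linear.Ck_on[OF bounded_linear_divide]
          bounded_bilinear.Ck_on[OF bounded_bilinear_mult] assms(1) IH Ck_on_inverse) force+
  qed
qed (use assms in \<open>auto intro!: continuous_intros\<close>)

lemma smooth_on_subset: "smooth_on S f \<Longrightarrow> T \<subseteq> S \<Longrightarrow> smooth_on T f"
  unfolding smooth_on_def using Ck_on_subset by blast

lemma smooth_on_differentiable: "smooth_on S f \<Longrightarrow> p \<in> S \<Longrightarrow> f differentiable (at p)"
  unfolding smooth_on_def by (metis Ck_on.simps(2))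

lemma smooth_on_continuous_on: "smooth_on S f \<Longrightarrow> continuous_on S f"
  unfolding smooth_on_def by (metis Ck_on.simps(1))

lemma smooth_on_pd:
  "smooth_on S f \<Longrightarrow> smooth_on S (pd i f)"
  unfolding smooth_on_def pd_def[abs_def] by (metis Ck_on.simps(2))

named_theorems smooth

lemma smooth_on_const [smooth]: "smooth_on S (\<lambda>p. c)"
  by (simp add: smooth_on_def Ck_on_const)

lemma smooth_on_add [smooth]:
  "open S \<Longrightarrow> smooth_on S f \<Longrightarrow> smooth_on S g \<Longrightarrow> smooth_on S (\<lambda>p. f p + g p)"
  by (simp add: smooth_on_def Ck_on_add)

lemma smooth_on_bounded_linear:
  "bounded_linear T \<Longrightarrow> open S \<Longrightarrow> smooth_on S f \<Longrightarrow> smooth_on S (\<lambda>p. T (f p))"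
  by (simp add: smooth_on_def bounded_linear.Ck_on)

lemma smooth_on_bounded_bilinear:
  "bounded_bilinear T \<Longrightarrow> open S \<Longrightarrow> smooth_on S f \<Longrightarrow> smooth_on S g \<Longrightarrow> smooth_on S (\<lambda>p. T (f p) (g p))"
  by (simp add: smooth_on_def bounded_bilinear.Ck_on)

lemmas smooth_on_uminus [smooth] =
  smooth_on_bounded_linear[OF bounded_linear_minus[OF bounded_linear_ident]]

lemma smooth_on_diff [smooth]:
  "open S \<Longrightarrow> smooth_on S f \<Longrightarrow> smooth_on S g \<Longrightarrow> smooth_on S (\<lambda>p. f p - g p)"
  using smooth_on_add[OF _ _ smooth_on_uminus] by fastforce

lemmas smooth_on_mult [smooth] =
  smooth_on_bounded_bilinear[OF bounded_bilinear_mult[where 'a = real]]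

lemmas smooth_on_scaleR [smooth] = smooth_on_bounded_bilinear[OF bounded_bilinear_scaleR]

lemmas smooth_on_inner [smooth] = smooth_on_bounded_bilinear[OF bounded_bilinear_inner]

lemma bounded_bilinear_cross3: "bounded_bilinear cross3"
  using bilinear_cross bilinear_conv_bounded_bilinear by blast

lemmas smooth_on_cross3 [smooth] = smooth_on_bounded_bilinear[OF bounded_bilinear_cross3]

lemmas smooth_on_fst [smooth] = smooth_on_bounded_linear[OF bounded_linear_fst]

lemmas smooth_on_snd [smooth] = smooth_on_bounded_linear[OF bounded_linear_snd]

lemma smooth_on_Pair [smooth]:
  assumes "open S" "smooth_on S f" "smooth_on S g"
  shows "smooth_on S (\<lambda>p. (f p, g p))"
proof -
  have "smooth_on S (\<lambda>p. (f p, 0) + (0, g p))"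
    by (intro smooth_on_add smooth_on_bounded_linear[where T = "\<lambda>x. (x, 0)"]
        smooth_on_bounded_linear[where T = "\<lambda>x. (0, x)"] assms bounded_linear_Pair
        bounded_linear_ident bounded_linear_zero)
  then show ?thesis by simp
qed

lemma smooth_on_divide [smooth]:
  fixes f g :: "'a::euclidean_space \<Rightarrow> real"
  shows "open S \<Longrightarrow> smooth_on S f \<Longrightarrow> smooth_on S g \<Longrightarrow> (\<And>p. p \<in> S \<Longrightarrow> g p \<noteq> 0) \<Longrightarrow>
    smooth_on S (\<lambda>p. f p / g p)"
  unfolding divide_inverse by (intro smooth_on_mult) (auto simp: smooth_on_def Ck_on_inverse)

lemma smooth_on_sqrt [smooth]:
  fixes f :: "'a::euclidean_space \<Rightarrow> real"
  shows "open S \<Longrightarrow> smooth_on S f \<Longrightarrow> (\<And>p. p \<in> S \<Longrightarrow> f p > 0) \<Longrightarrow> smooth_on S (\<lambda>p. sqrt (f p))"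
  by (auto simp: smooth_on_def Ck_on_sqrt)

lemma smooth_on_power2 [smooth]:
  fixes f :: "'a::euclidean_space \<Rightarrow> real"
  shows "open S \<Longrightarrow> smooth_on S f \<Longrightarrow> smooth_on S (\<lambda>p. (f p)\<^sup>2)"
  unfolding power2_eq_square by (rule smooth_on_mult)


section \<open>Partial derivatives in the plane\<close>

lemma has_derivative_pd:
  fixes f :: "real^2 \<Rightarrow> 'b::real_normed_vector"
  assumes "f differentiable (at p)"
  shows "(f has_derivative (\<lambda>h. h$1 *\<^sub>R du f p + h$2 *\<^sub>R dv f p)) (at p)"
proof -
  have D: "(f has_derivative frechet_derivative f (at p)) (at p)"
    using assms frechet_derivative_works by blast
  then interpret bounded_linear "frechet_derivative f (at p)"
    by (rule has_derivative_bounded_linear)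
  have "frechet_derivative f (at p) h = h$1 *\<^sub>R du f p + h$2 *\<^sub>R dv f p" for h
  proof -
    have "h = h$1 *\<^sub>R axis 1 1 + h$2 *\<^sub>R axis 2 1"
      by (simp add: vec_eq_iff forall_2 axis_def)
    then show ?thesis unfolding pd_def by (metis add scaleR)
  qed
  then have "frechet_derivative f (at p) = (\<lambda>h. h$1 *\<^sub>R du f p + h$2 *\<^sub>R dv f p)" by blast
  with D show ?thesis by metis
qed

lemma pd_eq:
  assumes "(f has_derivative f') (at p)"
  shows "pd i f p = f' (axis i 1)"
  unfolding pd_def frechet_derivative_at[OF assms, symmetric] ..

lemma pd_cong:
  assumes "open S" "p \<in> S" "\<And>q. q \<in> S \<Longrightarrow> f q = g q" "f differentiable (at p)"
  shows "pd i f p = pd i g p"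
  unfolding pd_def using frechet_derivative_transform_within_open[OF assms(4,1,2)] assms(3) by simp

lemma pd_const [simp]: "pd i (\<lambda>q. c) p = 0"
  by (simp add: pd_def)

lemma pd_add:
  assumes "f differentiable (at p)" "g differentiable (at p)"
  shows "pd i (\<lambda>q. f q + g q) p = pd i f p + pd i g p"
  using assms by (auto simp: differentiable_def pd_eq pd_eq[OF has_derivative_add])

lemma pd_diff:
  assumes "f differentiable (at p)" "g differentiable (at p)"
  shows "pd i (\<lambda>q. f q - g q) p = pd i f p - pd i g p"
  using assms by (auto simp: differentiable_def pd_eq pd_eq[OF has_derivative_diff])

lemma pd_bounded_linear:
  assumes "bounded_linear T" "f differentiable (at p)"
  shows "pd i (\<lambda>q. T (f q)) p = T (pd i f p)"
  using assms by (auto simp: differentiable_def pd_eq dest: bounded_linear.has_derivative)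

lemma pd_bounded_bilinear:
  assumes "bounded_bilinear T" "f differentiable (at p)" "g differentiable (at p)"
  shows "pd i (\<lambda>q. T (f q) (g q)) p = T (f p) (pd i g p) + T (pd i f p) (g p)"
  using assms by (auto simp: differentiable_def pd_eq dest: bounded_bilinear.FDERIV)

lemmas pd_nth = pd_bounded_linear[OF bounded_linear_vec_nth]
lemmas pd_mult = pd_bounded_bilinear[OF bounded_bilinear_mult[where 'a = real]]
lemmas pd_scaleR = pd_bounded_bilinear[OF bounded_bilinear_scaleR]
lemmas pd_inner = pd_bounded_bilinear[OF bounded_bilinear_inner]
lemmas pd_cross3 = pd_bounded_bilinear[OF bounded_bilinear_cross3]

lemma pd_Pair:
  assumes "f differentiable (at p)" "g differentiable (at p)"
  shows "pd i (\<lambda>q. (f q, g q)) p = (pd i f p, pd i g p)"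
  using assms by (auto simp: differentiable_def pd_eq pd_eq[OF has_derivative_Pair])

lemma differentiable_cross3:
  "f differentiable (at p) \<Longrightarrow> g differentiable (at p) \<Longrightarrow> (\<lambda>q. cross3 (f q) (g q)) differentiable (at p)"
  unfolding differentiable_def using bounded_bilinear.FDERIV[OF bounded_bilinear_cross3] by blast

lemma differentiable_nth:
  "f differentiable (at p) \<Longrightarrow> (\<lambda>q. f q $ j) differentiable (at p)"
  unfolding differentiable_def using bounded_linear.has_derivative[OF bounded_linear_vec_nth] by blast

lemma constant_of_pd_eq_0:
  assumes "open S" "connected S" "\<And>p. p \<in> S \<Longrightarrow> f differentiable (at p)"
    "\<And>p. p \<in> S \<Longrightarrow> du f p = 0" "\<And>p. p \<in> S \<Longrightarrow> dv f p = 0" "p \<in> S" "q \<in> S"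
  shows "f p = f q"
proof -
  have "(f has_derivative (\<lambda>h. 0)) (at x)" if "x \<in> S" for x
    using has_derivative_pd[OF assms(3)[OF that]] assms(4,5)[OF that] by simp
  then show ?thesis using has_derivative_zero_unique_connected[OF assms(1,2)] assms(6,7) by metis
qed

section \<open>Integrals along segments\<close>

text \<open>The fixed domain \<open>{0..1}\<close> gives the oriented integral for either order of \<open>a\<close> and \<open>u\<close> and makes
  the library's theorems on parametric integrals applicable.\<close>

definition seg_integral :: "real \<Rightarrow> (real \<Rightarrow> 'b::banach) \<Rightarrow> real \<Rightarrow> 'b" where
  "seg_integral a \<phi> u = (u - a) *\<^sub>R integral {0..1} (\<lambda>t. \<phi> (a + t * (u - a)))"

lemma seg_mem:
  fixes I :: "real set"
  assumes "convex I" "a \<in> I" "u \<in> I" "t \<in> {0..1}"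
  shows "a + t * (u - a) \<in> I"
proof -
  have "(1 - t) *\<^sub>R a + t *\<^sub>R u \<in> I" using assms by (intro convexD) auto
  then show ?thesis by (simp add: algebra_simps)
qed

lemma seg_integrand_continuous:
  fixes I :: "real set"
  assumes "continuous_on I \<phi>" "convex I" "a \<in> I" "u \<in> I"
  shows "continuous_on {0..1} (\<lambda>t. \<phi> (a + t * (u - a)))"
  by (rule continuous_on_compose2[OF assms(1)])
     (use seg_mem[OF assms(2-4)] in \<open>auto intro!: continuous_intros\<close>)

lemma seg_integral_same [simp]: "seg_integral a \<phi> a = 0"
  by (simp add: seg_integral_def)

lemma norm_seg_integral_le:
  assumes "continuous_on I \<phi>" "convex I" "a \<in> I" "u \<in> I" "\<And>s. s \<in> I \<Longrightarrow> norm (\<phi> s) \<le> M"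
  shows "norm (seg_integral a \<phi> u) \<le> \<bar>u - a\<bar> * M"
proof -
  have "norm (integral {0..1} (\<lambda>t. \<phi> (a + t * (u - a)))) \<le> M * (1 - 0)"
    using seg_integrand_continuous[OF assms(1-4)] seg_mem[OF assms(2-4)] assms(5)
    by (intro integral_bound) auto
  then show ?thesis by (simp add: seg_integral_def mult_left_mono)
qed

lemma seg_integral_diff:
  assumes "continuous_on I \<phi>" "continuous_on I \<psi>" "convex I" "a \<in> I" "u \<in> I"
  shows "seg_integral a (\<lambda>s. \<phi> s - \<psi> s) u = seg_integral a \<phi> u - seg_integral a \<psi> u"
  unfolding seg_integral_def scaleR_diff_right[symmetric]
  by (subst integral_diff)
     (auto intro!: integrable_continuous_real seg_integrand_continuous assms)

text \<open>The affine substitution absorbs the factor \<open>u - a\<close>, so \<open>u < a\<close>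
  is no separate case. Derivatives are taken within \<open>I\<close>, which admits the endpoints of
  closed intervals.\<close>

lemma seg_integral_derivative:
  assumes "\<And>s. s \<in> I \<Longrightarrow> (\<phi> has_vector_derivative \<phi>' s) (at s within I)" "convex I" "a \<in> I" "u \<in> I"
  shows "seg_integral a \<phi>' u = \<phi> u - \<phi> a"
proof -
  have "((\<lambda>t. (u - a) *\<^sub>R \<phi>' (a + t * (u - a))) has_integral
          \<phi> (a + 1 * (u - a)) - \<phi> (a + 0 * (u - a))) {0..1}"
  proof (rule fundamental_theorem_of_calculus)
    fix t :: real assume t: "t \<in> {0..1}"
    have "((\<lambda>t. a + t * (u - a)) has_vector_derivative (u - a)) (at t within {0..1})"
      by (auto intro!: derivative_eq_intros)
    moreover have "(\<phi> has_vector_derivative \<phi>' (a + t * (u - a)))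
        (at (a + t * (u - a)) within (\<lambda>t. a + t * (u - a)) ` {0..1})"
      using assms(1)[OF seg_mem[OF assms(2-4) t]] seg_mem[OF assms(2-4)]
      by (auto elim: has_vector_derivative_within_subset)
    ultimately show "((\<lambda>t. \<phi> (a + t * (u - a))) has_vector_derivative
        (u - a) *\<^sub>R \<phi>' (a + t * (u - a))) (at t within {0..1})"
      by (drule_tac vector_diff_chain_within) (auto simp: o_def)
  qed simp
  from integral_unique[OF this] show ?thesis
    by (simp add: seg_integral_def)
qed

text \<open>The integral from \<open>c\<close> is a primitive, and the segment integral differs from
  it by a constant on either side of \<open>a\<close>.\<close>

lemma has_vector_derivative_seg_integral:
  assumes "continuous_on {c..d} \<phi>" "a \<in> {c..d}" "u \<in> {c..d}"
  shows "(seg_integral a \<phi> has_vector_derivative \<phi> u) (at u within {c..d})"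
proof -
  have D: "((\<lambda>u. integral {c..u} \<phi>) has_vector_derivative \<phi> s) (at s within {c..d})"
    if "s \<in> {c..d}" for s
    by (rule integral_has_vector_derivative[OF assms(1) that])
  have "seg_integral a \<phi> s = integral {c..s} \<phi> - integral {c..a} \<phi>" if "s \<in> {c..d}" for s
    by (rule seg_integral_derivative[OF D _ assms(2) that]) auto
  moreover have "((\<lambda>s. integral {c..s} \<phi> - integral {c..a} \<phi>) has_vector_derivative \<phi> u) (at u within {c..d})"
    using D[OF assms(3)] by (auto intro!: derivative_eq_intros)
  ultimately show ?thesis
    using has_vector_derivative_transform[OF assms(3)] by (metis (no_types, lifting))
qed

lemma continuous_on_seg_integral:
  fixes \<phi> :: "'a::topological_space \<Rightarrow> real \<Rightarrow> 'b::banach"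
  assumes "continuous_on (X \<times> I) (\<lambda>(x, s). \<phi> x s)" "convex I" "a \<in> I"
    "continuous_on X h" "\<And>x. x \<in> X \<Longrightarrow> h x \<in> I"
  shows "continuous_on X (\<lambda>x. seg_integral a (\<phi> x) (h x))"
proof -
  have "continuous_on (X \<times> cbox 0 1) (\<lambda>y. (\<lambda>(x, s). \<phi> x s) (fst y, a + snd y * (h (fst y) - a)))"
    by (rule continuous_on_compose2[OF assms(1)])
       (use seg_mem[OF assms(2,3,5)] in
        \<open>auto intro!: continuous_intros continuous_on_compose2[OF assms(4)]\<close>)
  then have "continuous_on X (\<lambda>x. integral (cbox 0 1) (\<lambda>t. \<phi> x (a + t * (h x - a))))"
    by (intro integral_continuous_on_param) (simp add: split_beta)
  then show ?thesis
    unfolding seg_integral_def by (auto intro!: continuous_intros assms(4))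
qed

lemma seg_integral_leibniz:
  fixes \<phi> :: "real \<Rightarrow> real \<Rightarrow> 'b::banach"
  assumes "\<And>v s. v \<in> J \<Longrightarrow> s \<in> I \<Longrightarrow> ((\<lambda>v. \<phi> v s) has_vector_derivative \<phi>' v s) (at v within J)"
    "\<And>v. v \<in> J \<Longrightarrow> continuous_on I (\<phi> v)"
    "continuous_on (J \<times> I) (\<lambda>(v, s). \<phi>' v s)" "convex I" "convex J" "a \<in> I" "u \<in> I" "v \<in> J"
  shows "((\<lambda>v. seg_integral a (\<phi> v) u) has_vector_derivative seg_integral a (\<phi>' v) u) (at v within J)"
proof -
  have "continuous_on (J \<times> cbox 0 1) (\<lambda>y. (\<lambda>(v, s). \<phi>' v s) (fst y, a + snd y * (u - a)))"
    by (rule continuous_on_compose2[OF assms(3)])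
       (use seg_mem[OF assms(4,6,7)] in \<open>auto intro!: continuous_intros\<close>)
  then have "((\<lambda>v. integral (cbox 0 1) (\<lambda>t. \<phi> v (a + t * (u - a)))) has_vector_derivative
      integral (cbox 0 1) (\<lambda>t. \<phi>' v (a + t * (u - a)))) (at v within J)"
    by (intro leibniz_rule_vector_derivative)
       (use assms seg_mem[OF assms(4,6,7)] seg_integrand_continuous[OF assms(2) assms(4,6,7)] in
        \<open>auto simp: split_beta intro!: integrable_continuous_real\<close>)
  then show ?thesis
    unfolding seg_integral_def by (auto intro!: derivative_eq_intros)
qed


section \<open>Total linear systems in the plane\<close>

text \<open>Picard iteration from the zero map. Working with an arbitrary pointwise bound
  \<open>M\<close> instead of a sup norm lets total functions be used as they are, with values
  outside \<open>S\<close> ignored. Successive differences are halved, so the M-test gives a uniform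
  limit.\<close>

lemma contraction_on_compact_fixed_point:
  fixes T :: "('a::topological_space \<Rightarrow> 'b::banach) \<Rightarrow> 'a \<Rightarrow> 'b"
  assumes "compact S"
    and cont: "\<And>f. continuous_on S f \<Longrightarrow> continuous_on S (T f)"
    and contr: "\<And>f g M x. continuous_on S f \<Longrightarrow> continuous_on S g \<Longrightarrow>
      (\<And>y. y \<in> S \<Longrightarrow> norm (f y - g y) \<le> M) \<Longrightarrow> x \<in> S \<Longrightarrow> norm (T f x - T g x) \<le> M / 2"
  obtains f where "continuous_on S f" "\<And>x. x \<in> S \<Longrightarrow> T f x = f x"
proof -
  define F where "F n = (T ^^ n) (\<lambda>x. 0)" for n
  have F0: "F 0 = (\<lambda>x. 0)" and FS: "F (Suc n) = T (F n)" for n by (auto simp: F_def)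
  have Fc: "continuous_on S (F n)" for n
    by (induction n) (auto simp: F0 FS intro: cont)
  have "bounded (F 1 ` S)"
    by (intro compact_imp_bounded compact_continuous_image Fc assms(1))
  then obtain M where M: "norm (F 1 x) \<le> M" if "x \<in> S" for x
    by (auto simp: bounded_iff)
  have step: "norm (F (Suc n) x - F n x) \<le> M * (1/2) ^ n" if "x \<in> S" for x n
    using that
  proof (induction n arbitrary: x)
    case 0
    then show ?case using M by (simp add: F0)
  next
    case (Suc n)
    have "norm (T (F (Suc n)) x - T (F n) x) \<le> (M * (1/2) ^ n) / 2"
      using Suc by (intro contr Fc) auto
    then show ?case by (simp add: FS)
  qed
  have sumM: "summable (\<lambda>n. M * (1/2::real) ^ n)"
    by (intro summable_mult summable_geometric) auto
  define f where "f x = (\<Sum>n. F (Suc n) x - F n x)" for x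
  have "uniform_limit S (\<lambda>n x. \<Sum>i<n. F (Suc i) x - F i x) f sequentially"
    unfolding f_def by (rule Weierstrass_m_test[OF _ sumM]) (use step in auto)
  \<comment> \<open>The iteration starts at zero, so the telescoping sums are the iterates
    themselves.\<close>
  moreover have "(\<lambda>n x. \<Sum>i<n. F (Suc i) x - F i x) = F"
    using sum_lessThan_telescope[of "\<lambda>i. F i x" n for x n] by (intro ext) (simp add: F0)
  ultimately have lim: "uniform_limit S F f sequentially" by simp
  have fc: "continuous_on S f"
    by (rule uniform_limit_theorem[OF _ lim]) (auto simp: Fc)
  have "T f x = f x" if x: "x \<in> S" for x
  proof -
    have "norm (T f x - f x) \<le> 0 + e" if "e > 0" for e
    proof -
      have "\<forall>\<^sub>F n in sequentially. \<forall>x\<in>S. dist (F n x) (f x) < e / 2"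
        using uniform_limitD[OF lim, of "e / 2"] that by simp
      then obtain N where N: "dist (F n x) (f x) < e / 2" if "n \<ge> N" "x \<in> S" for n x
        by (auto simp: eventually_sequentially)
      have "norm (T f x - T (F N) x) \<le> (e / 2) / 2"
        by (intro contr fc Fc x) (use N[of N] in \<open>auto simp: dist_norm norm_minus_commute less_imp_le\<close>)
      moreover have "norm (T (F N) x - f x) \<le> e / 2"
        using N[of "Suc N" x] x by (auto simp: dist_norm FS)
      ultimately show ?thesis
        using norm_triangle_ineq[of "T f x - T (F N) x" "T (F N) x - f x"] that by simp
    qed
    then have "norm (T f x - f x) \<le> 0" by (rule field_le_epsilon)
    then show ?thesis by simp
  qed
  with fc that show ?thesis by blast
qed

text \<open>The system is solved along \<open>v = v0\<close> and then along the vertical lines by a single contraction;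
  compatibility implies that the defect \<open>D\<close> of the equation in \<open>u\<close> satisfies a homogeneous linear
  integral equation, hence vanishes.\<close>

lemma total_linear_system_box:
  fixes prod :: "'a::real_normed_vector \<Rightarrow> 'b::banach \<Rightarrow> 'b" and u0 v0 r c :: real and w0 :: 'b
    and A B A' B' :: "real \<Rightarrow> real \<Rightarrow> 'a"
  defines "S \<equiv> {u0 - r..u0 + r}" and "T \<equiv> {v0 - r..v0 + r}"
  assumes prod: "bounded_bilinear prod"
    and r: "0 < r" "r \<le> 1" "r * c \<le> 1/8" "0 \<le> c"
    and cont: "continuous_on (S \<times> T) (\<lambda>(u, v). A u v)" "continuous_on (S \<times> T) (\<lambda>(u, v). B u v)"
      "continuous_on (S \<times> T) (\<lambda>(u, v). A' u v)" "continuous_on (S \<times> T) (\<lambda>(u, v). B' u v)"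
    and A': "\<And>u v. u \<in> S \<Longrightarrow> v \<in> T \<Longrightarrow> (A u has_vector_derivative A' u v) (at v within T)"
    and B': "\<And>u v. u \<in> S \<Longrightarrow> v \<in> T \<Longrightarrow> ((\<lambda>u. B u v) has_vector_derivative B' u v) (at u within S)"
    and compat: "\<And>u v w. u \<in> S \<Longrightarrow> v \<in> T \<Longrightarrow>
      prod (A' u v) w + prod (A u v) (prod (B u v) w) = prod (B' u v) w + prod (B u v) (prod (A u v) w)"
    and bound: "\<And>u v w. u \<in> S \<Longrightarrow> v \<in> T \<Longrightarrow> norm (prod (A u v) w) \<le> c * norm w"
      "\<And>u v w. u \<in> S \<Longrightarrow> v \<in> T \<Longrightarrow> norm (prod (B u v) w) \<le> c * norm w"
      "\<And>u v w. u \<in> S \<Longrightarrow> v \<in> T \<Longrightarrow> norm (prod (B' u v) w) \<le> c * norm w"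
  obtains W where "continuous_on (S \<times> T) W" "W (u0, v0) = w0"
    "\<And>u v. u \<in> S \<Longrightarrow> v \<in> T \<Longrightarrow>
       ((\<lambda>u. W (u, v)) has_vector_derivative prod (A u v) (W (u, v))) (at u within S)"
    "\<And>u v. u \<in> S \<Longrightarrow> v \<in> T \<Longrightarrow>
       ((\<lambda>v. W (u, v)) has_vector_derivative prod (B u v) (W (u, v))) (at v within T)"
proof -
  interpret bounded_bilinear prod by fact
  have u0: "u0 \<in> S" and v0: "v0 \<in> T" using r by (auto simp: S_def T_def)
  have cvx: "convex S" "convex T" by (auto simp: S_def T_def)
  have len: "\<bar>u - u0\<bar> \<le> r" "\<bar>v - v0\<bar> \<le> r" if "u \<in> S" "v \<in> T" for u v
    using that by (auto simp: S_def T_def)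
  have cont': "continuous_on X (\<lambda>x. C (h x) (k x))"
    if "continuous_on (S \<times> T) (\<lambda>(u, v). C u v)" "continuous_on X h" "continuous_on X k"
      "\<And>x. x \<in> X \<Longrightarrow> h x \<in> S" "\<And>x. x \<in> X \<Longrightarrow> k x \<in> T"
    for C :: "real \<Rightarrow> real \<Rightarrow> 'a" and X :: "'d::topological_space set" and h k
    using continuous_on_compose2[OF that(1) continuous_on_Pair[OF that(2,3)]] that(4,5) by auto
  have cW: "continuous_on X (\<lambda>x. W (h x, k x))"
    if "continuous_on (S \<times> T) W" "continuous_on X h" "continuous_on X k"
      "\<And>x. x \<in> X \<Longrightarrow> h x \<in> S" "\<And>x. x \<in> X \<Longrightarrow> k x \<in> T"
    for W :: "real \<times> real \<Rightarrow> 'b" and X :: "'d::topological_space set" and h k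
    using continuous_on_compose2[OF that(1) continuous_on_Pair[OF that(2,3)]] that(4,5) by auto
  define Op where "Op W y = w0 + seg_integral u0 (\<lambda>s. prod (A s v0) (W (s, v0))) (fst y)
      + seg_integral v0 (\<lambda>t. prod (B (fst y) t) (W (fst y, t))) (snd y)" for W and y :: "real \<times> real"
  have cA: "continuous_on S (\<lambda>s. prod (A s v) (W (s, v)))" if "continuous_on (S \<times> T) W" "v \<in> T" for v W
    by (intro continuous_on cont'[OF cont(1)] cW[OF that(1)]) (auto intro!: continuous_intros that)
  have cB: "continuous_on T (\<lambda>s. prod (B u s) (W (u, s)))" if "continuous_on (S \<times> T) W" "u \<in> S" for u W
    by (intro continuous_on cont'[OF cont(2)] cW[OF that(1)]) (auto intro!: continuous_intros that)
  obtain W where W: "continuous_on (S \<times> T) W" and Weq: "\<And>y. y \<in> S \<times> T \<Longrightarrow> Op W y = W y"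
  proof (rule contraction_on_compact_fixed_point)
    show "compact (S \<times> T)" by (auto simp: S_def T_def intro: compact_Times)
    show "continuous_on (S \<times> T) (Op W)" if "continuous_on (S \<times> T) W" for W
      unfolding Op_def
      by (intro continuous_intros continuous_on_seg_integral[OF _ cvx(1) u0]
          continuous_on_seg_integral[OF _ cvx(2) v0])
        (auto simp: split_beta u0 v0 intro!: continuous_intros continuous_on cont'[OF cont(1)]
          cont'[OF cont(2)] cW[OF that])
    show "norm (Op f y - Op g y) \<le> M / 2"
      if f: "continuous_on (S \<times> T) f" and g: "continuous_on (S \<times> T) g"
        and M: "\<And>y. y \<in> S \<times> T \<Longrightarrow> norm (f y - g y) \<le> M" and y: "y \<in> S \<times> T" for f g M y
    proof -
      obtain u v where y_eq: "y = (u, v)" and u: "u \<in> S" and v: "v \<in> T" using y by auto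
      have M0: "0 \<le> M" using M[OF y] by (meson norm_ge_zero order_trans)
      have "Op f y - Op g y = seg_integral u0 (\<lambda>s. prod (A s v0) (f (s, v0) - g (s, v0))) u
          + seg_integral v0 (\<lambda>t. prod (B u t) (f (u, t) - g (u, t))) v"
        unfolding Op_def y_eq diff_right
        by (simp add: seg_integral_diff[OF cA[OF f v0] cA[OF g v0] cvx(1) u0 u]
            seg_integral_diff[OF cB[OF f u] cB[OF g u] cvx(2) v0 v])
      also have "norm \<dots> \<le> \<bar>u - u0\<bar> * (c * M) + \<bar>v - v0\<bar> * (c * M)"
      proof (rule norm_triangle_le[OF add_mono])
        have fg: "continuous_on (S \<times> T) (\<lambda>y. f y - g y)" by (intro continuous_intros f g)
        show "norm (seg_integral u0 (\<lambda>s. prod (A s v0) (f (s, v0) - g (s, v0))) u) \<le> \<bar>u - u0\<bar> * (c * M)"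
          by (rule norm_seg_integral_le[OF cA[OF fg v0] cvx(1) u0 u])
            (use v0 r M in \<open>auto intro!: order_trans[OF bound(1)] mult_left_mono\<close>)
        show "norm (seg_integral v0 (\<lambda>t. prod (B u t) (f (u, t) - g (u, t))) v) \<le> \<bar>v - v0\<bar> * (c * M)"
          by (rule norm_seg_integral_le[OF cB[OF fg u] cvx(2) v0 v])
            (use u r M in \<open>auto intro!: order_trans[OF bound(2)] mult_left_mono\<close>)
      qed
      \<comment> \<open>Both segments have length at most \<open>r\<close>; with
        \<open>r * c \<le> 1/8\<close> the total factor is at most 1/4, within the 1/2 that the
        contraction principle allows.\<close>
      also have "\<dots> \<le> r * (c * M) + r * (c * M)"
        using len[OF u v] r M0 by (intro add_mono mult_right_mono) auto
      also have "\<dots> = 2 * (r * c) * M" by simp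
      also have "\<dots> \<le> 2 * (1/8) * M" using r M0 by (intro mult_right_mono) auto
      also have "\<dots> \<le> M / 2" using M0 by simp
      finally show ?thesis .
    qed
  qed blast
  have Wuv: "W (u, v) = w0 + seg_integral u0 (\<lambda>s. prod (A s v0) (W (s, v0))) u
      + seg_integral v0 (\<lambda>t. prod (B u t) (W (u, t))) v" if "u \<in> S" "v \<in> T" for u v
    using Weq[of "(u, v)"] that by (simp add: Op_def)
  have Wv: "((\<lambda>v. W (u, v)) has_vector_derivative prod (B u v) (W (u, v))) (at v within T)"
    if u: "u \<in> S" and v: "v \<in> T" for u v
  proof (rule has_vector_derivative_transform[OF v Wuv[OF u]])
    show "((\<lambda>v. w0 + seg_integral u0 (\<lambda>s. prod (A s v0) (W (s, v0))) u
      + seg_integral v0 (\<lambda>t. prod (B u t) (W (u, t))) v) has_vector_derivative prod (B u v) (W (u, v))) (at v within T)"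
      using has_vector_derivative_seg_integral[OF cB[OF W u, unfolded T_def] v0[unfolded T_def] v[unfolded T_def]]
      by (auto intro!: derivative_eq_intros simp: T_def)
  qed
  \<comment> \<open>\<open>Y\<close> takes the other route: up the line \<open>u = u0\<close>, then
    horizontally. Its derivative in \<open>u\<close> is already the required right-hand side formed
    with \<open>W\<close>, so the equation in \<open>u\<close> holds once
    \<open>W = Y\<close>.\<close>
  define Y where "Y y = W (u0, snd y) + seg_integral u0 (\<lambda>s. prod (A s (snd y)) (W (s, snd y))) (fst y)"
    for y :: "real \<times> real"
  define D where "D y = W y - Y y" for y
  have Yc: "continuous_on (S \<times> T) Y"
    unfolding Y_def
    by (intro continuous_intros continuous_on_seg_integral[OF _ cvx(1) u0] cW[OF W])
       (auto simp: split_beta u0 v0 intro!: continuous_intros continuous_on cont'[OF cont(1)] cW[OF W])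
  have Dc: "continuous_on (S \<times> T) D"
    unfolding D_def by (intro continuous_intros W Yc)
  have Yu: "((\<lambda>u. Y (u, v)) has_vector_derivative prod (A u v) (W (u, v))) (at u within S)"
    if u: "u \<in> S" and v: "v \<in> T" for u v
    using has_vector_derivative_seg_integral[OF cA[OF W v, unfolded S_def] u0[unfolded S_def] u[unfolded S_def]]
    by (auto intro!: derivative_eq_intros simp: Y_def S_def)
  have D0: "D (u0, v) = 0" for v by (simp add: D_def Y_def)
  have D0': "D (u, v0) = 0" if "u \<in> S" for u
    using Wuv[OF that v0] Wuv[OF u0 v0] by (simp add: D_def Y_def)
  \<comment> \<open>This will be the derivative of \<open>D\<close> in \<open>v\<close>.
    Differentiating \<open>Y\<close> under the integral gives the integrand
    \<open>A' W + A (B W)\<close>, which compatibility turns into \<open>B' W + B (A W)\<close>. The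
    derivative of \<open>B Y\<close> in \<open>u\<close> is \<open>B' Y + B (A W)\<close>, so only
    \<open>B' D\<close> stays under the integral.\<close>
  define H where "H u v = prod (B u v) (D (u, v)) - seg_integral u0 (\<lambda>s. prod (B' s v) (D (s, v))) u" for u v
  have Dv: "((\<lambda>v. D (u, v)) has_vector_derivative H u v) (at v within T)"
    if u: "u \<in> S" and v: "v \<in> T" for u v
  proof -
    let ?X = "\<lambda>v s. prod (A s v) (prod (B s v) (W (s, v))) + prod (A' s v) (W (s, v))"
    have "((\<lambda>v. seg_integral u0 (\<lambda>s. prod (A s v) (W (s, v))) u) has_vector_derivative
        seg_integral u0 (?X v) u) (at v within T)"
    proof (rule seg_integral_leibniz[OF _ _ _ cvx u0 u v])
      show "((\<lambda>v. prod (A s v) (W (s, v))) has_vector_derivative ?X v s) (at v within T)"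
        if "v \<in> T" "s \<in> S" for v s
        by (rule has_vector_derivative[OF A'[OF that(2,1)] Wv[OF that(2,1)]])
      show "continuous_on (T \<times> S) (\<lambda>(v, s). ?X v s)"
        by (auto simp: split_beta intro!: continuous_intros continuous_on cont'[OF cont(1)]
            cont'[OF cont(2)] cont'[OF cont(3)] cW[OF W])
    qed (rule cA[OF W])
    then have 1: "((\<lambda>v. D (u, v)) has_vector_derivative
        prod (B u v) (W (u, v)) - (prod (B u0 v) (W (u0, v)) + seg_integral u0 (?X v) u)) (at v within T)"
      unfolding D_def Y_def fst_conv snd_conv
      by (intro has_vector_derivative_diff has_vector_derivative_add Wv u u0 v)
    have e1: "seg_integral u0 (\<lambda>s. prod (B s v) (prod (A s v) (W (s, v))) + prod (B' s v) (Y (s, v))) u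
        = prod (B u v) (Y (u, v)) - prod (B u0 v) (Y (u0, v))"
      by (rule seg_integral_derivative[OF _ cvx(1) u0 u]) (rule has_vector_derivative[OF B' Yu]; use v in simp)
    have e2: "seg_integral u0 (\<lambda>s. ?X v s - (prod (B s v) (prod (A s v) (W (s, v))) + prod (B' s v) (Y (s, v)))) u
        = seg_integral u0 (\<lambda>s. prod (B' s v) (D (s, v))) u"
      unfolding seg_integral_def
      by (intro arg_cong2[of _ _ _ _ scaleR] integral_cong refl)
        (use compat[OF seg_mem[OF cvx(1) u0 u] v] in \<open>simp add: D_def diff_right algebra_simps\<close>)
    have e3: "seg_integral u0 (\<lambda>s. ?X v s - (prod (B s v) (prod (A s v) (W (s, v))) + prod (B' s v) (Y (s, v)))) u
        = seg_integral u0 (?X v) u - seg_integral u0 (\<lambda>s. prod (B s v) (prod (A s v) (W (s, v))) + prod (B' s v) (Y (s, v))) u"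
      by (rule seg_integral_diff[OF _ _ cvx(1) u0 u])
        (auto simp: v intro!: continuous_intros continuous_on cont'[OF cont(1)]
            cont'[OF cont(2)] cont'[OF cont(3)] cont'[OF cont(4)] cW[OF W] cW[OF Yc])
    have "seg_integral u0 (\<lambda>s. prod (B' s v) (D (s, v))) u
        = seg_integral u0 (?X v) u - (prod (B u v) (Y (u, v)) - prod (B u0 v) (Y (u0, v)))"
      unfolding e2[symmetric] e3 e1 ..
    then have "H u v = prod (B u v) (W (u, v)) - (prod (B u0 v) (W (u0, v)) + seg_integral u0 (?X v) u)"
      by (simp only: H_def) (simp add: D_def diff_right Y_def[of "(u0, v)"])
    with 1 show ?thesis by simp
  qed
  \<comment> \<open>In place of Gronwall: if \<open>M\<close> is the largest norm of
    \<open>D\<close>, then the derivative of \<open>D\<close> in \<open>v\<close> is at most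
    \<open>2 * c * M\<close> (here \<open>r \<le> 1\<close> enters), and \<open>D\<close> vanishes
    on \<open>v = v0\<close>. Hence \<open>M \<le> 2 * r * c * M \<le> M / 4\<close>.\<close>
  have "\<exists>y\<in>S \<times> T. \<forall>z\<in>S \<times> T. norm (D z) \<le> norm (D y)"
    using u0 v0 by (intro continuous_attains_sup continuous_intros Dc)
       (auto simp: S_def T_def intro!: compact_Times)
  then obtain u1 v1 where uv1: "u1 \<in> S" "v1 \<in> T" and sup: "\<And>u v. u \<in> S \<Longrightarrow> v \<in> T \<Longrightarrow> norm (D (u, v)) \<le> norm (D (u1, v1))"
    by auto
  define M where "M = norm (D (u1, v1))"
  have H_le: "norm (H u v) \<le> 2 * c * M" if u: "u \<in> S" and v: "v \<in> T" for u v
  proof -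
    have "norm (seg_integral u0 (\<lambda>s. prod (B' s v) (D (s, v))) u) \<le> \<bar>u - u0\<bar> * (c * M)"
      by (rule norm_seg_integral_le[OF _ cvx(1) u0 u])
         (use sup v r in \<open>auto simp: M_def intro!: order_trans[OF bound(3)] mult_left_mono
            continuous_intros continuous_on cont'[OF cont(4)] cW[OF Dc]\<close>)
    also have "\<dots> \<le> 1 * (c * M)"
      using len(1)[OF u v] r by (intro mult_right_mono) (auto simp: M_def)
    finally have "norm (seg_integral u0 (\<lambda>s. prod (B' s v) (D (s, v))) u) \<le> c * M" by simp
    moreover have "norm (prod (B u v) (D (u, v))) \<le> c * M"
      using order_trans[OF bound(2)[OF u v] mult_left_mono[OF sup[OF u v] r(4)]] by (simp add: M_def)
    ultimately show ?thesis
      unfolding H_def by (intro order_trans[OF norm_triangle_ineq4]) simp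
  qed
  have "norm (D (u1, v1) - D (u1, v0)) \<le> (2 * c * M) * norm (v1 - v0)"
  proof (rule differentiable_bound[OF cvx(2) _ _ uv1(2) v0])
    show "((\<lambda>v. D (u1, v)) has_derivative (\<lambda>h. h *\<^sub>R H u1 v)) (at v within T)" if "v \<in> T" for v
      using Dv[OF uv1(1) that] by (simp add: has_vector_derivative_def)
    show "onorm (\<lambda>h. h *\<^sub>R H u1 v) \<le> 2 * c * M" if "v \<in> T" for v
      using mult_right_mono[OF H_le[OF uv1(1) that]] by (intro onorm_bound) (auto simp: M_def r mult.commute)
  qed
  also have "\<dots> \<le> (2 * c * M) * r"
    using len(2)[OF uv1] r by (intro mult_left_mono) (auto simp: M_def)
  also have "\<dots> = 2 * (r * c) * M" by simp
  also have "\<dots> \<le> 2 * (1/8) * M" using r by (intro mult_right_mono) (auto simp: M_def)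
  finally have "M \<le> 0" by (simp add: D0'[OF uv1(1)] M_def)
  then have "D (u, v) = 0" if "u \<in> S" "v \<in> T" for u v
    using sup[OF that] by (simp add: M_def)
  then have WY: "W (u, v) = Y (u, v)" if "u \<in> S" "v \<in> T" for u v
    using that by (simp add: D_def)
  have Wu: "((\<lambda>u. W (u, v)) has_vector_derivative prod (A u v) (W (u, v))) (at u within S)"
    if u: "u \<in> S" and v: "v \<in> T" for u v
    by (rule has_vector_derivative_transform[OF u WY Yu[OF u v]]) (use v in auto)
  have "W (u0, v0) = w0" using Wuv[OF u0 v0] by simp
  with W Wu Wv that show thesis by blast
qed

section \<open>Second derivatives and linear systems at points of the plane\<close>

definition plane_point :: "real \<Rightarrow> real \<Rightarrow> real^2" where
  "plane_point u v = u *\<^sub>R axis 1 1 + v *\<^sub>R axis 2 1"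

lemma plane_point_nth [simp]: "plane_point u v $ 1 = u" "plane_point u v $ 2 = v"
  by (simp_all add: plane_point_def axis_def)

lemma plane_point_nths [simp]: "plane_point (p$1) (p$2) = p"
  by (simp add: vec_eq_iff forall_2)

lemma continuous_on_plane_point [continuous_intros]:
  "continuous_on S f \<Longrightarrow> continuous_on S g \<Longrightarrow> continuous_on S (\<lambda>x. plane_point (f x) (g x))"
  unfolding plane_point_def by (intro continuous_intros)

lemma has_vector_derivative_plane_point:
  assumes "f differentiable (at (plane_point u v))"
  shows "((\<lambda>u. f (plane_point u v)) has_vector_derivative du f (plane_point u v)) (at u within S)"
    and "((\<lambda>v. f (plane_point u v)) has_vector_derivative dv f (plane_point u v)) (at v within T)"
proof -
  note D = has_derivative_pd[OF assms]
  have "((\<lambda>u. plane_point u v) has_derivative (\<lambda>h. h *\<^sub>R axis 1 1)) (at u within S)"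
    unfolding plane_point_def by (auto intro!: derivative_eq_intros)
  from has_derivative_compose[OF this D]
  show "((\<lambda>u. f (plane_point u v)) has_vector_derivative du f (plane_point u v)) (at u within S)"
    by (simp add: has_vector_derivative_def axis_def)
  have "((\<lambda>v. plane_point u v) has_derivative (\<lambda>h. h *\<^sub>R axis 2 1)) (at v within T)"
    unfolding plane_point_def by (auto intro!: derivative_eq_intros)
  from has_derivative_compose[OF this D]
  show "((\<lambda>v. f (plane_point u v)) has_vector_derivative dv f (plane_point u v)) (at v within T)"
    by (simp add: has_vector_derivative_def axis_def)
qed

lemma plane_box:
  assumes "open U" "p0 \<in> U"
  obtains r where "0 < r" "r \<le> 1"
    "\<And>u v. u \<in> {p0$1 - r..p0$1 + r} \<Longrightarrow> v \<in> {p0$2 - r..p0$2 + r} \<Longrightarrow> plane_point u v \<in> U"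
proof -
  obtain e where e: "0 < e" "ball p0 e \<subseteq> U" using assms openE by blast
  define r where "r = min 1 (e / 4)"
  have "plane_point u v \<in> U"
    if uv: "u \<in> {p0$1 - r..p0$1 + r}" "v \<in> {p0$2 - r..p0$2 + r}" for u v
  proof -
    have "plane_point u v - p0 = plane_point (u - p0$1) (v - p0$2)"
      by (simp add: vec_eq_iff forall_2)
    also have "norm \<dots> \<le> \<bar>u - p0$1\<bar> + \<bar>v - p0$2\<bar>"
      unfolding plane_point_def by (rule norm_triangle_le) simp
    also have "\<dots> < e" using uv e by (auto simp: r_def min_def split: if_splits)
    finally show ?thesis using e(2) by (auto simp: dist_norm norm_minus_commute)
  qed
  then show thesis using e by (intro that[of r]) (auto simp: r_def)
qed

text \<open>Near the point, \<open>f\<close> is its restriction to the line \<open>u = u0\<close>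
  plus the integral of \<open>du f\<close> along a horizontal segment. Differentiate this in
  \<open>v\<close> under the integral sign, and then in \<open>u\<close> at the end of the
  segment.\<close>

lemma pd_commute:
  fixes f :: "real^2 \<Rightarrow> 'b::banach"
  assumes U: "open U" "smooth_on U f" "p0 \<in> U"
  shows "dv (du f) p0 = du (dv f) p0"
proof -
  obtain r where r: "0 < r" "r \<le> 1"
    and box: "\<And>u v. u \<in> {p0$1 - r..p0$1 + r} \<Longrightarrow> v \<in> {p0$2 - r..p0$2 + r} \<Longrightarrow> plane_point u v \<in> U"
    using plane_box[OF U(1,3)] by blast
  define u0 v0 where "u0 = p0$1" and "v0 = p0$2"
  let ?S = "{u0 - r..u0 + r}" and ?T = "{v0 - r..v0 + r}"
  note sm = U(2) smooth_on_pd[OF U(2)] smooth_on_pd[OF smooth_on_pd[OF U(2)]]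
  note diff = sm[THEN smooth_on_differentiable] and cont = sm[THEN smooth_on_continuous_on]
  have box': "plane_point u v \<in> U" if "u \<in> ?S" "v \<in> ?T" for u v
    using box that by (simp add: u0_def v0_def)
  have 0: "u0 \<in> ?S" "v0 \<in> ?T" using r by auto
  have seg: "seg_integral u0 (\<lambda>s. du f (plane_point s v)) u = f (plane_point u v) - f (plane_point u0 v)"
    if "u \<in> ?S" "v \<in> ?T" for u v
    by (rule seg_integral_derivative[where I = ?S, OF has_vector_derivative_plane_point(1)[OF diff(1)]])
       (use that 0 box' in auto)
  have dv_eq: "dv f (plane_point u v0) = dv f (plane_point u0 v0) + seg_integral u0 (\<lambda>s. dv (du f) (plane_point s v0)) u"
    if u: "u \<in> ?S" for u
  proof -
    have "((\<lambda>v. f (plane_point u0 v) + seg_integral u0 (\<lambda>s. du f (plane_point s v)) u) has_vector_derivative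
        dv f (plane_point u0 v0) + seg_integral u0 (\<lambda>s. dv (du f) (plane_point s v0)) u) (at v0 within ?T)"
      by (intro has_vector_derivative_add has_vector_derivative_plane_point(2) diff box' seg_integral_leibniz[where I = ?S])
         (use u 0 box' in \<open>auto simp: split_beta intro!: continuous_intros has_vector_derivative_plane_point(2) diff
            continuous_on_compose2[OF cont(2)] continuous_on_compose2[OF cont(3)]\<close>)
    then have "((\<lambda>v. f (plane_point u v)) has_vector_derivative
        dv f (plane_point u0 v0) + seg_integral u0 (\<lambda>s. dv (du f) (plane_point s v0)) u) (at v0 within ?T)"
      by (rule has_vector_derivative_transform[OF 0(2), rotated]) (use seg[OF u] in auto)
    moreover have "at v0 within ?T = at v0"
      using r by (intro at_within_interior) auto
    moreover have "((\<lambda>v. f (plane_point u v)) has_vector_derivative dv f (plane_point u v0)) (at v0)"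
      by (intro has_vector_derivative_plane_point(2) diff box' u 0)
    ultimately show ?thesis using vector_derivative_unique_at by metis
  qed
  have "((\<lambda>u. dv f (plane_point u0 v0) + seg_integral u0 (\<lambda>s. dv (du f) (plane_point s v0)) u) has_vector_derivative
      0 + dv (du f) (plane_point u0 v0)) (at u0 within ?S)"
    by (intro has_vector_derivative_add has_vector_derivative_const has_vector_derivative_seg_integral)
       (use 0 box' in \<open>auto intro!: continuous_intros continuous_on_compose2[OF cont(3)]\<close>)
  then have "((\<lambda>u. dv f (plane_point u v0)) has_vector_derivative dv (du f) (plane_point u0 v0)) (at u0 within ?S)"
    by (intro has_vector_derivative_transform[OF 0(1) dv_eq]) auto
  moreover have "at u0 within ?S = at u0"
    using r by (intro at_within_interior) auto
  moreover have "((\<lambda>u. dv f (plane_point u v0)) has_vector_derivative du (dv f) (plane_point u0 v0)) (at u0)"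
    by (intro has_vector_derivative_plane_point(1) diff box' 0)
  ultimately have "dv (du f) (plane_point u0 v0) = du (dv f) (plane_point u0 v0)"
    using vector_derivative_unique_at by metis
  then show ?thesis by (simp add: u0_def v0_def)
qed

text \<open>The box statement is moved to an arbitrary point by shrinking: compactness bounds the
  coefficients on a first box, and the final radius is chosen against that bound. Connectedness of
  \<open>V\<close> is exported because orthonormality of frames will be propagated by functions with
  zero derivative.\<close>

lemma total_linear_system:
  fixes prod :: "'a::real_normed_vector \<Rightarrow> 'b::banach \<Rightarrow> 'b"
  assumes prod: "bounded_bilinear prod" and U: "open U" "p0 \<in> U"
    and sm: "smooth_on U A" "smooth_on U B"
    and compat: "\<And>p w. p \<in> U \<Longrightarrow>
      prod (dv A p) w + prod (A p) (prod (B p) w) = prod (du B p) w + prod (B p) (prod (A p) w)"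
  obtains V W where "open V" "connected V" "p0 \<in> V" "V \<subseteq> U" "smooth_on V W" "W p0 = w0"
    "\<And>p. p \<in> V \<Longrightarrow> du W p = prod (A p) (W p)" "\<And>p. p \<in> V \<Longrightarrow> dv W p = prod (B p) (W p)"
proof -
  interpret bounded_bilinear prod by fact
  define u0 v0 where "u0 = p0$1" and "v0 = p0$2"
  obtain R where R: "0 < R" "R \<le> 1"
    and box: "\<And>u v. u \<in> {u0 - R..u0 + R} \<Longrightarrow> v \<in> {v0 - R..v0 + R} \<Longrightarrow> plane_point u v \<in> U"
    unfolding u0_def v0_def using plane_box[OF U] by blast
  note cont = sm[THEN smooth_on_continuous_on] sm[THEN smooth_on_pd, THEN smooth_on_continuous_on]
  note diff = sm[THEN smooth_on_differentiable]
  have bd: "\<exists>b. \<forall>u\<in>{u0 - R..u0 + R}. \<forall>v\<in>{v0 - R..v0 + R}. norm (C (plane_point u v)) \<le> b"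
    if "continuous_on U C" for C :: "real^2 \<Rightarrow> 'a"
  proof -
    have "bounded ((\<lambda>y. C (plane_point (fst y) (snd y))) ` ({u0 - R..u0 + R} \<times> {v0 - R..v0 + R}))"
      by (intro compact_imp_bounded compact_continuous_image compact_Times continuous_on_compose2[OF that])
         (use box in \<open>auto intro!: continuous_intros\<close>)
    then show ?thesis by (force simp: bounded_iff)
  qed
  obtain b1 where b1: "\<forall>u\<in>{u0 - R..u0 + R}. \<forall>v\<in>{v0 - R..v0 + R}. norm (A (plane_point u v)) \<le> b1"
    using bd[OF cont(1)] ..
  obtain b2 where b2: "\<forall>u\<in>{u0 - R..u0 + R}. \<forall>v\<in>{v0 - R..v0 + R}. norm (B (plane_point u v)) \<le> b2"
    using bd[OF cont(2)] ..
  obtain b3 where b3: "\<forall>u\<in>{u0 - R..u0 + R}. \<forall>v\<in>{v0 - R..v0 + R}. norm (du B (plane_point u v)) \<le> b3"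
    using bd[OF cont(4)] ..
  obtain K where K: "0 \<le> K" "\<And>a w. norm (prod a w) \<le> norm a * norm w * K"
    using nonneg_bounded by blast
  define c where "c = max 0 (max b1 (max b2 b3)) * K"
  have c: "0 \<le> c" using K by (simp add: c_def)
  \<comment> \<open>The summand 8 keeps the denominator positive when \<open>c = 0\<close>; the
    quotient makes \<open>r * c\<close> at most 1/8.\<close>
  define r where "r = min R (1 / (8 * c + 8))"
  have "r * c \<le> 1 / (8 * c + 8) * c" using c by (intro mult_right_mono) (auto simp: r_def)
  also have "\<dots> \<le> 1/8" using c by (simp add: field_simps)
  finally have r: "0 < r" "r \<le> 1" "r * c \<le> 1/8" "r \<le> R" using c R by (auto simp: r_def)
  have bR: "norm (A (plane_point u v)) \<le> max b1 (max b2 b3)" "norm (B (plane_point u v)) \<le> max b1 (max b2 b3)"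
    "norm (du B (plane_point u v)) \<le> max b1 (max b2 b3)"
    if "u \<in> {u0 - R..u0 + R}" "v \<in> {v0 - R..v0 + R}" for u v
    using b1[rule_format, OF that] b2[rule_format, OF that] b3[rule_format, OF that] by linarith+
  let ?S = "{u0 - r..u0 + r}" and ?T = "{v0 - r..v0 + r}"
  have box': "plane_point u v \<in> U" if "u \<in> ?S" "v \<in> ?T" for u v
    using box that r by auto
  have bound: "norm (prod a w) \<le> c * norm w" if "norm a \<le> max b1 (max b2 b3)" for a w
  proof -
    have "norm a * norm w * K \<le> max 0 (max b1 (max b2 b3)) * norm w * K"
      using that K by (intro mult_right_mono) auto
    also have "\<dots> = c * norm w" by (simp add: c_def)
    finally show ?thesis using K(2)[of a w] by linarith
  qed
  have comp_cont: "continuous_on (?S \<times> ?T) (\<lambda>(u, v). C (plane_point u v))" if "continuous_on U C"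
    for C :: "real^2 \<Rightarrow> 'a"
    unfolding split_beta
    by (rule continuous_on_compose2[OF that]) (use box' in \<open>auto intro!: continuous_intros\<close>)
  obtain W where W: "continuous_on (?S \<times> ?T) W" "W (u0, v0) = w0"
    and Wu: "\<And>u v. u \<in> ?S \<Longrightarrow> v \<in> ?T \<Longrightarrow>
       ((\<lambda>u. W (u, v)) has_vector_derivative prod (A (plane_point u v)) (W (u, v))) (at u within ?S)"
    and Wv: "\<And>u v. u \<in> ?S \<Longrightarrow> v \<in> ?T \<Longrightarrow>
       ((\<lambda>v. W (u, v)) has_vector_derivative prod (B (plane_point u v)) (W (u, v))) (at v within ?T)"
  proof (rule total_linear_system_box[OF prod r(1-3) c,
        where ?w0.0 = w0 and A = "\<lambda>u v. A (plane_point u v)" and B = "\<lambda>u v. B (plane_point u v)"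
          and A' = "\<lambda>u v. dv A (plane_point u v)" and B' = "\<lambda>u v. du B (plane_point u v)"])
    show "((\<lambda>v. A (plane_point u v)) has_vector_derivative dv A (plane_point u v)) (at v within ?T)"
      "((\<lambda>u. B (plane_point u v)) has_vector_derivative du B (plane_point u v)) (at u within ?S)"
      if "u \<in> ?S" "v \<in> ?T" for u v
      by (rule has_vector_derivative_plane_point diff box' that)+
    show "norm (prod (A (plane_point u v)) w) \<le> c * norm w" "norm (prod (B (plane_point u v)) w) \<le> c * norm w"
      "norm (prod (du B (plane_point u v)) w) \<le> c * norm w" if "u \<in> ?S" "v \<in> ?T" for u v w
      using bR[of u v] that r by (auto intro!: bound)
    show "prod (dv A (plane_point u v)) w + prod (A (plane_point u v)) (prod (B (plane_point u v)) w)
        = prod (du B (plane_point u v)) w + prod (B (plane_point u v)) (prod (A (plane_point u v)) w)"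
      if "u \<in> ?S" "v \<in> ?T" for u v w
      by (rule compat[OF box'[OF that]])
  qed (rule comp_cont cont | blast)+
  \<comment> \<open>On the boundary of the closed box the derivatives are only one-sided; the open
    box is where full derivatives exist.\<close>
  define X Y where "X = {u0 - r<..<u0 + r}" and "Y = {v0 - r<..<v0 + r}"
  have sub: "X \<subseteq> ?S" "Y \<subseteq> ?T" and op: "open X" "open Y" by (auto simp: X_def Y_def)
  have boxXY: "plane_point u v \<in> U" if "u \<in> X" "v \<in> Y" for u v
    using box'[of u v] that sub by blast
  define V where "V = {p::real^2. p$1 \<in> X \<and> p$2 \<in> Y}"
  have V_alt: "V = (\<lambda>p::real^2. p$1) -` X \<inter> (\<lambda>p. p$2) -` Y" by (auto simp: V_def)
  have "open V" unfolding V_alt using op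
    by (intro open_Int open_vimage continuous_intros)
  moreover have "connected V"
    unfolding V_alt X_def Y_def
    by (intro convex_connected convex_Int convex_linear_vimage) (auto intro: bounded_linear.linear bounded_linear_vec_nth)
  moreover have "p0 \<in> V" using r by (auto simp: V_def X_def Y_def u0_def v0_def)
  moreover have "V \<subseteq> U" 
  proof
    fix p assume "p \<in> V"
    then show "p \<in> U" using box'[of "p$1" "p$2"] sub unfolding V_def plane_point_nths by blast
  qed
  moreover define Z where "Z p = W (p$1, p$2)" for p :: "real^2"
  have Zd: "(Z has_derivative (\<lambda>h. h$1 *\<^sub>R prod (A p) (Z p) + h$2 *\<^sub>R prod (B p) (Z p))) (at p)"
    if p: "p \<in> V" for p
  proof -
    have pXY: "p$1 \<in> X" "p$2 \<in> Y" using p by (auto simp: V_def)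
    then have pXYS: "p$1 \<in> ?S" "p$2 \<in> ?T" using sub by auto
    \<comment> \<open>The partial derivative in \<open>v\<close> as a bounded linear map. Its joint
      continuity is what upgrades the two separate derivatives to a joint one.\<close>
    let ?fy = "\<lambda>u v. blinfun_scaleR_left (prod (B (plane_point u v)) (W (u, v)))"
    have "((\<lambda>(u, v). W (u, v)) has_derivative
       (\<lambda>(s, t). s *\<^sub>R prod (A p) (Z p) + ?fy (p$1) (p$2) t)) (at (p$1, p$2) within X \<times> Y)"
    proof (rule has_derivative_partialsI)
      show "((\<lambda>u. W (u, p$2)) has_derivative (\<lambda>s. s *\<^sub>R prod (A p) (Z p))) (at (p$1) within X)"
        using has_derivative_subset[OF Wu[of "p$1" "p$2", unfolded has_vector_derivative_def] sub(1)] pXYS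
        unfolding Z_def plane_point_nths by blast
      show "((\<lambda>v. W (u, v)) has_derivative ?fy u v) (at v within Y)" if "u \<in> X" "v \<in> Y" for u v
      proof -
        have "u \<in> ?S" "v \<in> ?T" using that sub by auto
        from has_derivative_subset[OF Wv[OF this, unfolded has_vector_derivative_def] sub(2)]
        show ?thesis by simp
      qed
      have "continuous_on (X \<times> Y) (\<lambda>(u, v). ?fy u v)"
        unfolding split_beta
        by (intro bounded_linear.continuous_on[OF bounded_linear_blinfun_scaleR_left] continuous_on
            continuous_on_compose2[OF cont(2)] continuous_on_compose2[OF W(1)] continuous_intros)
          (use sub boxXY in auto)
      then show "continuous (at (p$1, p$2) within X \<times> Y) (\<lambda>(u, v). ?fy u v)"
        using pXY by (simp add: continuous_on_eq_continuous_within)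
    qed (use pXY in \<open>auto simp: Y_def\<close>)
    moreover have "at (p$1, p$2) within X \<times> Y = at (p$1, p$2)"
      using pXY op by (intro at_within_open) (auto intro: open_Times)
    ultimately have "(W has_derivative (\<lambda>(s, t). s *\<^sub>R prod (A p) (Z p) + t *\<^sub>R prod (B p) (Z p))) (at (p$1, p$2))"
      by (simp add: Z_def case_prod_unfold)
    moreover have "((\<lambda>p::real^2. (p$1, p$2)) has_derivative (\<lambda>h. (h$1, h$2))) (at p)"
      by (intro bounded_linear_imp_has_derivative bounded_linear_Pair bounded_linear_vec_nth)
    ultimately show ?thesis
      unfolding Z_def by (drule_tac has_derivative_compose[rotated]) (auto simp: case_prod_unfold)
  qed
  \<comment> \<open>Bootstrapping: the derivative of \<open>Z\<close> is bilinear in smooth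
    coefficients and \<open>Z\<close>, so each order of regularity yields the next.\<close>
  have smZ: "smooth_on V Z"
    unfolding smooth_on_def
  proof
    fix k show "Ck_on k V Z"
    proof (induction k)
      case 0
      show ?case unfolding Ck_on.simps
        by (rule has_derivative_continuous_on[OF has_derivative_at_withinI[OF Zd]])
    next
      case (Suc k)
      have "Ck_on k V A" "Ck_on k V B"
        using sm \<open>V \<subseteq> U\<close> Ck_on_subset unfolding smooth_on_def by blast+
      with Suc show ?case
        by (intro Ck_on_SucI[OF \<open>open V\<close> Zd] Ck_on_add Ck_on \<open>open V\<close>
            bounded_bilinear.Ck_on[OF bounded_bilinear_scaleR] Ck_on_const) auto
    qed
  qed
  moreover have "Z p0 = w0" using W(2) by (simp add: Z_def u0_def v0_def)
  moreover have "du Z p = prod (A p) (Z p)" "dv Z p = prod (B p) (Z p)" if "p \<in> V" for p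
    using pd_eq[OF Zd[OF that]] by (simp_all add: axis_def)
  ultimately show thesis using that by blast
qed

section \<open>The structure equations in an orthonormal coframe\<close>

lemma mat2_nth [simp]:
  "mat2 a b c d $ 1 $ 1 = a" "mat2 a b c d $ 1 $ 2 = b"
  "mat2 a b c d $ 2 $ 1 = c" "mat2 a b c d $ 2 $ 2 = d"
  by (simp_all add: mat2_def)

lemma mat2_eq_iff: "mat2 a b c d = mat2 a' b' c' d' \<longleftrightarrow> a = a' \<and> b = b' \<and> c = c' \<and> d = d'"
  by (auto simp: vec_eq_iff forall_2)

lemma matrix_inv_unique:
  fixes A B :: "'a::comm_semiring_1^'n^'n"
  assumes "A ** B = mat 1" "B ** A = mat 1"
  shows "matrix_inv A = B"
proof -
  have "A ** matrix_inv A = mat 1 \<and> matrix_inv A ** A = mat 1"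
    unfolding matrix_inv_def by (rule someI[where x = B]) (simp add: assms)
  then show ?thesis
    by (metis assms(2) matrix_mul_assoc matrix_mul_lid matrix_mul_rid)
qed

lemma matrix_inv_mat2:
  assumes "a * d - b * c \<noteq> 0"
  shows "matrix_inv (mat2 a b c d) =
    mat2 (d / (a * d - b * c)) (- b / (a * d - b * c)) (- c / (a * d - b * c)) (a / (a * d - b * c))"
proof (rule matrix_inv_unique)
  define D where "D = a * d - b * c"
  have "D \<noteq> 0" using assms by (simp add: D_def)
  then show "mat2 a b c d ** mat2 (d / (a * d - b * c)) (- b / (a * d - b * c)) (- c / (a * d - b * c)) (a / (a * d - b * c)) = mat 1"
    "mat2 (d / (a * d - b * c)) (- b / (a * d - b * c)) (- c / (a * d - b * c)) (a / (a * d - b * c)) ** mat2 a b c d = mat 1"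
    unfolding D_def[symmetric]
    by (simp_all add: vec_eq_iff forall_2 matrix_matrix_mult_def sum_2 mat_def)
       (simp_all add: field_simps, simp_all add: D_def algebra_simps)
qed

text \<open>Multiplying the defining formula by the first fundamental form removes its inverse: each
  row of symbols is the unique solution of a linear system, so a guess only has to be
  substituted.\<close>

lemma christoffel_eqI:
  assumes "E p * G p - (F p)\<^sup>2 \<noteq> 0"
  shows "du E p / 2 = x * E p + y * F p \<Longrightarrow> du F p - dv E p / 2 = x * F p + y * G p \<Longrightarrow>
      christoffel E F G 1 1 1 p = x \<and> christoffel E F G 1 1 2 p = y"
    and "dv E p / 2 = x * E p + y * F p \<Longrightarrow> du G p / 2 = x * F p + y * G p \<Longrightarrow>
      christoffel E F G 1 2 1 p = x \<and> christoffel E F G 1 2 2 p = y"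
    and "dv F p - du G p / 2 = x * E p + y * F p \<Longrightarrow> dv G p / 2 = x * F p + y * G p \<Longrightarrow>
      christoffel E F G 2 2 1 p = x \<and> christoffel E F G 2 2 2 p = y"
proof -
  define D where "D = E p * G p - F p * F p"
  have D: "D \<noteq> 0" using assms by (simp add: D_def power2_eq_square)
  have inv: "matrix_inv (mat2 (E p) (F p) (F p) (G p)) = mat2 (G p / D) (- F p / D) (- F p / D) (E p / D)"
    using matrix_inv_mat2[of "E p" "G p" "F p" "F p"] D by (simp add: D_def)
  have solve: "(x * E p + y * F p) * (G p / D) + (x * F p + y * G p) * (- F p / D) = x"
    "(x * E p + y * F p) * (- F p / D) + (x * F p + y * G p) * (E p / D) = y"
    using D by (simp_all add: field_simps) (simp_all add: D_def algebra_simps)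
  have unfold: "christoffel E F G i j k p = (\<Sum>l\<in>UNIV. (if j = 1
      then mat2 (du E p / 2) (du F p - dv E p / 2)
                (dv E p / 2) (du G p / 2)
      else mat2 (dv E p / 2) (du G p / 2)
                (dv F p - du G p / 2) (dv G p / 2)) $ i $ l
       * mat2 (G p / D) (- F p / D) (- F p / D) (E p / D) $ l $ k)" for i j k
    unfolding christoffel_def christoffel_matrix_def inv by (simp add: matrix_matrix_mult_def)
  show "du E p / 2 = x * E p + y * F p \<Longrightarrow> du F p - dv E p / 2 = x * F p + y * G p \<Longrightarrow>
      christoffel E F G 1 1 1 p = x \<and> christoffel E F G 1 1 2 p = y"
    "dv E p / 2 = x * E p + y * F p \<Longrightarrow> du G p / 2 = x * F p + y * G p \<Longrightarrow>
      christoffel E F G 1 2 1 p = x \<and> christoffel E F G 1 2 2 p = y"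
    "dv F p - du G p / 2 = x * E p + y * F p \<Longrightarrow> dv G p / 2 = x * F p + y * G p \<Longrightarrow>
      christoffel E F G 2 2 1 p = x \<and> christoffel E F G 2 2 2 p = y"
    using solve by (simp_all only: unfold sum_2 mat2_nth if_True if_False simp_thms one_neq_zero
        zero_neq_one num1_eq_iff) simp_all
qed

text \<open>The points of \<open>U\<close> where \<open>h\<close> is nonzero form an open set inside
  the zeros of \<open>l\<close>, hence an empty one. This carries identities across the singular
  set.\<close>

lemma zero_on_of_dense:
  fixes h l :: "'a::topological_space \<Rightarrow> real"
  assumes "open U" "continuous_on U h" "interior {p \<in> U. l p = 0} = {}"
    "\<And>p. p \<in> U \<Longrightarrow> l p \<noteq> 0 \<Longrightarrow> h p = 0" "p \<in> U"
  shows "h p = 0"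
proof (rule ccontr)
  assume "h p \<noteq> 0"
  have "open (U \<inter> h -` (- {0}))"
    by (rule continuous_open_preimage[OF assms(2,1)]) (simp add: open_Compl)
  then have "U \<inter> h -` (- {0}) \<subseteq> interior {p \<in> U. l p = 0}"
    using assms(4) by (intro interior_maximal) auto
  with \<open>h p \<noteq> 0\<close> assms(3,5) show False by auto
qed

text \<open>In the notation of the statement, the matrix \<open>a\<close> is \<open>\<Lambda> L\<close> and the matrix \<open>k\<close> is the transpose of
  \<open>L\<^sup>-\<^sup>1 II\<^sub>\<Omega>\<close>, where \<open>I\<^sub>\<Omega> = L L\<^sup>T\<close>; \<open>om1 du + om2 dv\<close> is the connection form of the orthonormal frame.\<close>

locale coframe =
  fixes U :: "(real^2) set"
    and a11 a12 a21 a22 k11 k12 k21 k22 :: "real^2 \<Rightarrow> real"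
    and E F G :: "real^2 \<Rightarrow> real"
  assumes open_U: "open U"
    and sm_a: "smooth_on U a11" "smooth_on U a12" "smooth_on U a21" "smooth_on U a22"
    and sm_k: "smooth_on U k11" "smooth_on U k12" "smooth_on U k21" "smooth_on U k22"
    and E_eq: "\<And>p. p \<in> U \<Longrightarrow> E p = a11 p * a11 p + a12 p * a12 p"
    and F_eq: "\<And>p. p \<in> U \<Longrightarrow> F p = a11 p * a21 p + a12 p * a22 p"
    and G_eq: "\<And>p. p \<in> U \<Longrightarrow> G p = a21 p * a21 p + a22 p * a22 p"
    and dense: "interior {p \<in> U. a11 p * a22 p - a12 p * a21 p = 0} = {}"
begin

abbreviation "la p \<equiv> a11 p * a22 p - a12 p * a21 p"

lemmas diff_a = sm_a[THEN smooth_on_differentiable]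
lemmas diff_k = sm_k[THEN smooth_on_differentiable]

lemma pd_EFG:
  assumes "p \<in> U"
  shows "pd i E p = 2 * (a11 p * pd i a11 p + a12 p * pd i a12 p)"
    "pd i F p = a11 p * pd i a21 p + pd i a11 p * a21 p + (a12 p * pd i a22 p + pd i a12 p * a22 p)"
    "pd i G p = 2 * (a21 p * pd i a21 p + a22 p * pd i a22 p)"
proof -
  note [derivative_intros] = diff_a[OF assms]
  have "pd i E p = pd i (\<lambda>q. a11 q * a11 q + a12 q * a12 q) p"
    by (rule pd_cong[OF open_U assms, symmetric]) (auto simp: E_eq intro!: derivative_intros)
  then show "pd i E p = 2 * (a11 p * pd i a11 p + a12 p * pd i a12 p)"
    by (simp add: pd_add pd_mult diff_a[OF assms])
  have "pd i F p = pd i (\<lambda>q. a11 q * a21 q + a12 q * a22 q) p"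
    by (rule pd_cong[OF open_U assms, symmetric]) (auto simp: F_eq intro!: derivative_intros)
  then show "pd i F p = a11 p * pd i a21 p + pd i a11 p * a21 p + (a12 p * pd i a22 p + pd i a12 p * a22 p)"
    by (simp add: pd_add pd_mult diff_a[OF assms])
  have "pd i G p = pd i (\<lambda>q. a21 q * a21 q + a22 q * a22 q) p"
    by (rule pd_cong[OF open_U assms, symmetric]) (auto simp: G_eq intro!: derivative_intros)
  then show "pd i G p = 2 * (a21 p * pd i a21 p + a22 p * pd i a22 p)"
    by (simp add: pd_add pd_mult diff_a[OF assms])
qed

lemma zero_on_dense:
  fixes h :: "real^2 \<Rightarrow> real"
  assumes "smooth_on U h" "\<And>p. p \<in> U \<Longrightarrow> la p \<noteq> 0 \<Longrightarrow> h p = 0" "p \<in> U"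
  shows "h p = 0"
  using zero_on_of_dense[OF open_U smooth_on_continuous_on[OF assms(1)] dense] assms(2,3) by blast

text \<open>The two equations are the \<open>e1\<close> and \<open>e2\<close> components of x_uv =
  x_vu when x_u and x_v have the rows of \<open>a\<close> as components and the frame turns in its
  tangent plane at the rates \<open>om1\<close>, \<open>om2\<close>: torsion is zero.\<close>

definition connection_form :: "(real^2 \<Rightarrow> real) \<Rightarrow> (real^2 \<Rightarrow> real) \<Rightarrow> bool" where
  "connection_form om1 om2 \<longleftrightarrow> smooth_on U om1 \<and> smooth_on U om2 \<and>
     (\<forall>p\<in>U. dv a11 p - om2 p * a12 p = du a21 p - om1 p * a22 p \<and>
            dv a12 p + om2 p * a11 p = du a22 p + om1 p * a21 p)"

text \<open>Pairing the torsion with the first row of \<open>a\<close> eliminates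
  \<open>om2\<close>, since the remaining \<open>dv\<close> terms add up to half of
  \<open>dv E\<close>; pairing with the second row eliminates \<open>om1\<close> in the same way.
  Off the zeros of \<open>la\<close> the rows form a basis, so both pairings vanish only if the
  torsion does; density does the rest.\<close>

lemma connection_formI:
  assumes "smooth_on U om1" "smooth_on U om2"
    and om1: "\<And>p. p \<in> U \<Longrightarrow> om1 p * la p = a11 p * du a21 p + a12 p * du a22 p - dv E p / 2"
    and om2: "\<And>p. p \<in> U \<Longrightarrow> om2 p * la p = du G p / 2 - (a21 p * dv a11 p + a22 p * dv a12 p)"
  shows "connection_form om1 om2"
proof -
  define x where "x p = dv a11 p - om2 p * a12 p - (du a21 p - om1 p * a22 p)" for p
  define y where "y p = dv a12 p + om2 p * a11 p - (du a22 p + om1 p * a21 p)" for p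
  have sm: "smooth_on U x" "smooth_on U y"
    unfolding x_def y_def by (intro smooth open_U sm_a assms smooth_on_pd)+
  have xy: "x p = 0 \<and> y p = 0" if p: "p \<in> U" "la p \<noteq> 0" for p
  proof -
    have 1: "a11 p * x p + a12 p * y p = 0"
      using om1[OF p(1)] by (simp add: pd_EFG[OF p(1)] x_def y_def field_simps)
    have 2: "a21 p * x p + a22 p * y p = 0"
      using om2[OF p(1)] by (simp add: pd_EFG[OF p(1)] x_def y_def field_simps)
    have "la p * x p = a22 p * (a11 p * x p + a12 p * y p) - a12 p * (a21 p * x p + a22 p * y p)"
      "la p * y p = a11 p * (a21 p * x p + a22 p * y p) - a21 p * (a11 p * x p + a12 p * y p)"
      by (simp_all add: algebra_simps)
    with p(2) show ?thesis unfolding 1 2 by simp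
  qed
  have "x p = 0" "y p = 0" if "p \<in> U" for p
    using zero_on_dense[OF sm(1) _ that] zero_on_dense[OF sm(2) _ that] xy by blast+
  then show ?thesis using assms(1,2) by (simp add: connection_form_def x_def y_def)
qed

text \<open>The difference of two solutions satisfies a homogeneous linear system whose determinant
  is \<open>la\<close> up to sign. Thus two frontals with the same data have frames that turn at the
  same rates, also at singular points.\<close>

lemma connection_form_unique:
  assumes "connection_form om1 om2" "connection_form om1' om2'" "p \<in> U"
  shows "om1 p = om1' p \<and> om2 p = om2' p"
proof -
  have sm: "smooth_on U (\<lambda>p. om1 p - om1' p)" "smooth_on U (\<lambda>p. om2 p - om2' p)"
    using assms by (auto simp: connection_form_def intro!: smooth open_U)
  have eq: "om1 q - om1' q = 0 \<and> om2 q - om2' q = 0" if q: "q \<in> U" "la q \<noteq> 0" for q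
  proof -
    define x y where "x = om1 q - om1' q" and "y = om2 q - om2' q"
    have 1: "x * a22 q = y * a12 q" and 2: "y * a11 q = x * a21 q"
      using assms(1,2)[unfolded connection_form_def, THEN conjunct2, THEN conjunct2, rule_format, OF q(1)]
      by (auto simp: x_def y_def algebra_simps)
    have "la q * x = a11 q * (x * a22 q) - a12 q * (x * a21 q)"
      by (simp add: algebra_simps)
    moreover have "\<dots> = 0" unfolding 1 2[symmetric] by simp
    moreover have "la q * y = a22 q * (y * a11 q) - a21 q * (y * a12 q)"
      by (simp add: algebra_simps)
    moreover have "\<dots> = 0" unfolding 2 1[symmetric] by simp
    ultimately have "la q * x = 0" "la q * y = 0" by simp_all
    with q(2) show ?thesis by (simp add: x_def y_def)
  qed
  have "om1 p - om1' p = 0" "om2 p - om2' p = 0"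
    using zero_on_dense[OF sm(1) _ assms(3)] zero_on_dense[OF sm(2) _ assms(3)] eq by blast+
  then show ?thesis by simp
qed

text \<open>Off the zeros of \<open>la\<close> the rows of \<open>a\<close> are a basis in which the
  Christoffel symbols are the coefficients of covariant derivatives. There the Codazzi equations say
  that the rows of \<open>a\<close> annihilate the Codazzi defect of \<open>k\<close>, and the Gauss
  equation is one component of the curvature of the connection form. The resulting identities
  involve only functions smooth on \<open>U\<close>, so they extend.\<close>

lemma structure_equations:
  assumes conn: "connection_form om1 om2"
    and e_eq: "\<And>p. p \<in> U \<Longrightarrow> e p = a11 p * k11 p + a12 p * k12 p"
    and f_eq: "\<And>p. p \<in> U \<Longrightarrow> f p = a11 p * k21 p + a12 p * k22 p"
    and f_eq': "\<And>p. p \<in> U \<Longrightarrow> f p = a21 p * k11 p + a22 p * k12 p"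
    and g_eq: "\<And>p. p \<in> U \<Longrightarrow> g p = a21 p * k21 p + a22 p * k22 p"
    and gauss: "\<And>p. p \<in> U \<Longrightarrow> la p \<noteq> 0 \<Longrightarrow> gauss_eq_at E F G e f g p"
    and codazzi: "\<And>p. p \<in> U \<Longrightarrow> la p \<noteq> 0 \<Longrightarrow> mainardi_codazzi_eqs_at E F G e f g p"
    and p: "p \<in> U"
  shows "dv om1 p - du om2 p = k11 p * k22 p - k12 p * k21 p"
    and "dv k11 p - om2 p * k12 p = du k21 p - om1 p * k22 p"
    and "dv k12 p + om2 p * k11 p = du k22 p + om1 p * k21 p"
proof -
  have sm_om: "smooth_on U om1" "smooth_on U om2"
    and tors: "\<And>q. q \<in> U \<Longrightarrow> dv a11 q - om2 q * a12 q = du a21 q - om1 q * a22 q"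
      "\<And>q. q \<in> U \<Longrightarrow> dv a12 q + om2 q * a11 q = du a22 q + om1 q * a21 q"
    using conn by (auto simp: connection_form_def)
  define U0 where "U0 = {q \<in> U. la q \<noteq> 0}"
  have "continuous_on U la"
    by (intro continuous_intros smooth_on_continuous_on sm_a)
  then have "open (U \<inter> la -` (- {0}))"
    by (rule continuous_open_preimage[OF _ open_U]) (simp add: open_Compl)
  moreover have "U \<inter> la -` (- {0}) = U0" by (auto simp: U0_def)
  ultimately have U0: "open U0" by simp
  have sub: "U0 \<subseteq> U" by (auto simp: U0_def)
  note sm0 = sm_a[THEN smooth_on_subset, OF sub] sm_om[THEN smooth_on_subset, OF sub]
  \<comment> \<open>The components of a vector \<open>(x, y)\<close> in the basis of the rows of \<open>a\<close>, by Cramer's rule.\<close>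
  define c1 where "c1 x y q = (x q * a22 q - y q * a21 q) / la q" for x y :: "real^2 \<Rightarrow> real" and q
  define c2 where "c2 x y q = (a11 q * y q - a12 q * x q) / la q" for x y :: "real^2 \<Rightarrow> real" and q
  have cramer: "x q = c1 x y q * a11 q + c2 x y q * a21 q" "y q = c1 x y q * a12 q + c2 x y q * a22 q"
    if "q \<in> U0" for x y q
    using that by (simp_all add: U0_def c1_def c2_def add_divide_distrib[symmetric])
       (simp_all add: field_simps)
  have sm_c: "smooth_on U0 (c1 x y)" "smooth_on U0 (c2 x y)" if "smooth_on U0 x" "smooth_on U0 y" for x y
    unfolding c1_def c2_def by ((intro smooth U0 that sm0)+; simp add: U0_def)+
  \<comment> \<open>The pairs \<open>x\<close>, \<open>y\<close>, \<open>z\<close> are the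
    tangential components of x_uu, x_uv and x_vv in the frame; zero torsion gives \<open>y\<close>
    its second expression.\<close>
  define x1 where "x1 q = du a11 q - om1 q * a12 q" for q
  define x2 where "x2 q = du a12 q + om1 q * a11 q" for q
  define y1 where "y1 q = dv a11 q - om2 q * a12 q" for q
  define y2 where "y2 q = dv a12 q + om2 q * a11 q" for q
  define z1 where "z1 q = dv a21 q - om2 q * a22 q" for q
  define z2 where "z2 q = dv a22 q + om2 q * a21 q" for q
  have sm_x: "smooth_on U0 x1" "smooth_on U0 x2" "smooth_on U0 y1" "smooth_on U0 y2"
    unfolding x1_def x2_def y1_def y2_def by (intro smooth U0 sm0 smooth_on_pd)+
  have y_eq: "y1 q = du a21 q - om1 q * a22 q" "y2 q = du a22 q + om1 q * a21 q" if "q \<in> U" for q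
    using tors[OF that] by (simp_all add: y1_def y2_def)
  \<comment> \<open>Pairing a vector with the rows of \<open>a\<close> multiplies its coefficients
    in the row basis by the first fundamental form, which is the linear system of
    \<open>christoffel_eqI\<close>.\<close>
  have proj: "x q * a11 q + y q * a12 q = c1 x y q * E q + c2 x y q * F q"
    "x q * a21 q + y q * a22 q = c1 x y q * F q + c2 x y q * G q" if "q \<in> U0" for x y q
    using that sub
    by (subst cramer(1)[OF that, of x y], subst cramer(2)[OF that, of y x];
        auto simp: E_eq F_eq G_eq algebra_simps subset_iff)+
  have chr: "christoffel E F G 1 1 1 q = c1 x1 x2 q \<and> christoffel E F G 1 1 2 q = c2 x1 x2 q"
    "christoffel E F G 1 2 1 q = c1 y1 y2 q \<and> christoffel E F G 1 2 2 q = c2 y1 y2 q"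
    "christoffel E F G 2 2 1 q = c1 z1 z2 q \<and> christoffel E F G 2 2 2 q = c2 z1 z2 q"
    if q: "q \<in> U0" for q
  proof -
    have qU: "q \<in> U" using q sub by auto
    have d: "E q * G q - (F q)\<^sup>2 \<noteq> 0"
    proof -
      have "E q * G q - (F q)\<^sup>2 = (la q)\<^sup>2"
        by (simp add: E_eq[OF qU] F_eq[OF qU] G_eq[OF qU] power2_eq_square algebra_simps)
      then show ?thesis using q by (simp add: U0_def)
    qed
    note P = pd_EFG[OF qU]
    have z12: "dv a11 q = y1 q + om2 q * a12 q" "dv a12 q = y2 q - om2 q * a11 q"
      "du a21 q = y1 q + om1 q * a22 q" "du a22 q = y2 q - om1 q * a21 q"
      "du a11 q = x1 q + om1 q * a12 q" "du a12 q = x2 q - om1 q * a11 q"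
      "dv a21 q = z1 q + om2 q * a22 q" "dv a22 q = z2 q - om2 q * a21 q"
      using y_eq[OF qU] by (simp_all add: y1_def y2_def x1_def x2_def z1_def z2_def)
    show "christoffel E F G 1 1 1 q = c1 x1 x2 q \<and> christoffel E F G 1 1 2 q = c2 x1 x2 q"
      by (rule christoffel_eqI(1)[where E = E and F = F and G = G, OF d]; unfold proj[OF q, symmetric] P z12; simp add: field_simps)
    show "christoffel E F G 1 2 1 q = c1 y1 y2 q \<and> christoffel E F G 1 2 2 q = c2 y1 y2 q"
      by (rule christoffel_eqI(2)[where E = E and F = F and G = G, OF d]; unfold proj[OF q, symmetric] P z12; simp add: field_simps)
    show "christoffel E F G 2 2 1 q = c1 z1 z2 q \<and> christoffel E F G 2 2 2 q = c2 z1 z2 q"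
      by (rule christoffel_eqI(3)[where E = E and F = F and G = G, OF d]; unfold proj[OF q, symmetric] P z12; simp add: field_simps)
  qed
  have main: "dv om1 q - du om2 q - (k11 q * k22 q - k12 q * k21 q) = 0 \<and>
      dv k11 q - om2 q * k12 q - (du k21 q - om1 q * k22 q) = 0 \<and>
      dv k12 q + om2 q * k11 q - (du k22 q + om1 q * k21 q) = 0" if q: "q \<in> U0" for q
  proof -
    have qU: "q \<in> U" and l: "la q \<noteq> 0" using q by (auto simp: U0_def)
    note da = diff_a[OF qU] and dk = diff_k[OF qU] and dom = sm_om[THEN smooth_on_differentiable, OF qU]
    note dda = sm_a[THEN smooth_on_pd, THEN smooth_on_differentiable, OF qU]
    define W where "W = dv om1 q - du om2 q"
    define m1 where "m1 = dv k11 q - om2 q * k12 q - (du k21 q - om1 q * k22 q)"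
    define m2 where "m2 = dv k12 q + om2 q * k11 q - (du k22 q + om1 q * k21 q)"
    have z12: "dv a11 q = y1 q + om2 q * a12 q" "dv a12 q = y2 q - om2 q * a11 q"
      "du a21 q = y1 q + om1 q * a22 q" "du a22 q = y2 q - om1 q * a21 q"
      "du a11 q = x1 q + om1 q * a12 q" "du a12 q = x2 q - om1 q * a11 q"
      "dv a21 q = z1 q + om2 q * a22 q" "dv a22 q = z2 q - om2 q * a21 q"
      using y_eq[OF qU] by (simp_all add: y1_def y2_def x1_def x2_def z1_def z2_def)
    have z34: "dv k11 q = m1 + om2 q * k12 q + (du k21 q - om1 q * k22 q)"
       "dv k12 q = m2 - om2 q * k11 q + (du k22 q + om1 q * k21 q)"
      by (simp_all add: m1_def m2_def)
    define al where "al = c1 x1 x2"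
    define be where "be = c2 x1 x2"
    define ga where "ga = c1 y1 y2"
    define de where "de = c2 y1 y2"
    define ep where "ep = c1 z1 z2"
    define ze where "ze = c2 z1 z2"
    note defs = al_def be_def ga_def de_def ep_def ze_def
    have cr: "x1 q = al q * a11 q + be q * a21 q" "x2 q = al q * a12 q + be q * a22 q"
      "y1 q = ga q * a11 q + de q * a21 q" "y2 q = ga q * a12 q + de q * a22 q"
      "z1 q = ep q * a11 q + ze q * a21 q" "z2 q = ep q * a12 q + ze q * a22 q"
      unfolding defs by (rule cramer[OF q])+
    have d_eq: "pd i h q = pd i h' q" if "\<And>r. r \<in> U \<Longrightarrow> h r = h' r" "h' differentiable (at q)"
      for h h' :: "real^2 \<Rightarrow> real" and i
      using pd_cong[OF open_U qU _ that(2), of h] that(1) by simp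
    have de: "dv e q = a11 q * dv k11 q + dv a11 q * k11 q + (a12 q * dv k12 q + dv a12 q * k12 q)"
      by (subst d_eq[OF e_eq]) (auto simp: pd_add pd_mult da dk intro!: derivative_intros)
    have df: "du f q = a11 q * du k21 q + du a11 q * k21 q + (a12 q * du k22 q + du a12 q * k22 q)"
      by (subst d_eq[OF f_eq]) (auto simp: pd_add pd_mult da dk intro!: derivative_intros)
    have df': "dv f q = a21 q * dv k11 q + dv a21 q * k11 q + (a22 q * dv k12 q + dv a22 q * k12 q)"
      by (subst d_eq[OF f_eq']) (auto simp: pd_add pd_mult da dk intro!: derivative_intros)
    have dg: "du g q = a21 q * du k21 q + du a21 q * k21 q + (a22 q * du k22 q + du a22 q * k22 q)"
      by (subst d_eq[OF g_eq]) (auto simp: pd_add pd_mult da dk intro!: derivative_intros)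
    note MC = codazzi[OF qU l, unfolded mainardi_codazzi_eqs_at_def Let_def chr(1)[OF q, THEN conjunct1]
      chr(1)[OF q, THEN conjunct2] chr(2)[OF q, THEN conjunct1] chr(2)[OF q, THEN conjunct2]
      chr(3)[OF q, THEN conjunct1] chr(3)[OF q, THEN conjunct2], folded defs]
    \<comment> \<open>After the product rule the terms with \<open>om1\<close> and
      \<open>om2\<close> cancel. What is left is the Christoffel side of the equation plus the first
      row of \<open>a\<close> paired with the defect \<open>(m1, m2)\<close>.\<close>
    have "dv e q - du f q = ga q * e q + de q * f q - al q * f q - be q * g q + (a11 q * m1 + a12 q * m2)"
      unfolding de df z12 z34 cr e_eq[OF qU] f_eq[OF qU] g_eq[OF qU]
      using f_eq[OF qU] f_eq'[OF qU] by algebra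
    then have 1: "a11 q * m1 + a12 q * m2 = 0" using MC[THEN conjunct1] by (simp add: algebra_simps)
    have "dv f q - du g q = ep q * e q + ze q * f q - ga q * f q - de q * g q + (a21 q * m1 + a22 q * m2)"
      unfolding df' dg z12 z34 cr e_eq[OF qU] f_eq[OF qU] g_eq[OF qU]
      using f_eq[OF qU] f_eq'[OF qU] by algebra
    then have 2: "a21 q * m1 + a22 q * m2 = 0" using MC[THEN conjunct2] by (simp add: algebra_simps)
    have "la q * m1 = a22 q * (a11 q * m1 + a12 q * m2) - a12 q * (a21 q * m1 + a22 q * m2)"
      "la q * m2 = a11 q * (a21 q * m1 + a22 q * m2) - a21 q * (a11 q * m1 + a12 q * m2)"
      by (simp_all add: algebra_simps)
    with l have m: "m1 = 0" "m2 = 0" unfolding 1 2 by simp_all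
    note dc = sm_c[OF sm_x(1,2), THEN smooth_on_differentiable, OF q, folded defs]
      sm_c[OF sm_x(3,4), THEN smooth_on_differentiable, OF q, folded defs]
    have d_eq0: "pd i h q = pd i h' q" if "\<And>r. r \<in> U0 \<Longrightarrow> h r = h' r" "h' differentiable (at q)"
      for h h' :: "real^2 \<Rightarrow> real" and i
      using pd_cong[OF U0 q _ that(2), of h] that(1) by simp
    have dx1: "dv x1 q = al q * dv a11 q + dv al q * a11 q + (be q * dv a21 q + dv be q * a21 q)"
      by (subst d_eq0[OF cramer(1)[of _ x1 x2], folded defs]) (auto simp: pd_add pd_mult da dc intro!: derivative_intros)
    have dx2: "dv x2 q = al q * dv a12 q + dv al q * a12 q + (be q * dv a22 q + dv be q * a22 q)"
      by (subst d_eq0[OF cramer(2)[of _ x2 x1], folded defs]) (auto simp: pd_add pd_mult da dc intro!: derivative_intros)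
    have dy1: "du y1 q = ga q * du a11 q + du ga q * a11 q + (de q * du a21 q + du de q * a21 q)"
      by (subst d_eq0[OF cramer(1)[of _ y1 y2], folded defs]) (auto simp: pd_add pd_mult da dc intro!: derivative_intros)
    have dy2: "du y2 q = ga q * du a12 q + du ga q * a12 q + (de q * du a22 q + du de q * a22 q)"
      by (subst d_eq0[OF cramer(2)[of _ y2 y1], folded defs]) (auto simp: pd_add pd_mult da dc intro!: derivative_intros)
    have dx1': "dv x1 q = dv (du a11) q - (om1 q * dv a12 q + dv om1 q * a12 q)"
      and dx2': "dv x2 q = dv (du a12) q + (om1 q * dv a11 q + dv om1 q * a11 q)"
      and dy1': "du y1 q = dv (du a11) q - (om2 q * du a12 q + du om2 q * a12 q)"
      and dy2': "du y2 q = dv (du a12) q + (om2 q * du a11 q + du om2 q * a11 q)"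
      unfolding x1_def[abs_def] x2_def[abs_def] y1_def[abs_def] y2_def[abs_def]
      by (simp_all add: pd_commute[OF open_U sm_a(1) qU] pd_commute[OF open_U sm_a(2) qU] pd_add pd_diff pd_mult da dda dom differentiable_mult)
    \<comment> \<open>\<open>P\<close> and \<open>Q\<close> are the coefficients, in the row basis,
      of the commutator of covariant derivatives applied to the first row of \<open>a\<close>. The
      curvature \<open>W\<close> acts on that row as a quarter turn scaled by \<open>W\<close>,
      which is what the next two identities express.\<close>
    define P where "P = al q * ga q + be q * ep q - ga q * al q - de q * ga q + (dv al q - du ga q)"
    define Q where "Q = al q * de q + be q * ze q - ga q * be q - de q * de q + (dv be q - du de q)"
    have 3: "- W * a12 q = P * a11 q + Q * a21 q"
    proof -
      have "- W * a12 q = dv x1 q - du y1 q + om1 q * y2 q - om2 q * x2 q"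
        unfolding dx1' dy1' z12 W_def by (simp add: algebra_simps)
      also have "\<dots> = P * a11 q + Q * a21 q"
        unfolding dx1 dy1 z12 cr P_def Q_def by (simp add: algebra_simps)
      finally show ?thesis .
    qed
    have 4: "W * a11 q = P * a12 q + Q * a22 q"
    proof -
      have "W * a11 q = dv x2 q - du y2 q - om1 q * y1 q + om2 q * x1 q"
        unfolding dx2' dy2' z12 W_def by (simp add: algebra_simps)
      also have "\<dots> = P * a12 q + Q * a22 q"
        unfolding dx2 dy2 z12 cr P_def Q_def by (simp add: algebra_simps)
      finally show ?thesis .
    qed
    \<comment> \<open>Pairing with the quarter turn of the first row eliminates
      \<open>P\<close>.\<close>
    have 5: "W * E q = Q * la q"
    proof -
      have "W * E q = a11 q * (W * a11 q) - a12 q * (- W * a12 q)"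
        by (simp add: E_eq[OF qU] algebra_simps)
      then show ?thesis unfolding 3 4 by (simp add: algebra_simps)
    qed
    have dch: "du (christoffel E F G 1 2 2) q = du de q" "dv (christoffel E F G 1 1 2) q = dv be q"
      by (rule d_eq0; use chr dc in \<open>simp add: defs\<close>)+
    \<comment> \<open>The left side of the Gauss equation is exactly \<open>- Q\<close>.\<close>
    have Q: "Q = E q * ((e q * g q - (f q)\<^sup>2) / (E q * G q - (F q)\<^sup>2))"
      using gauss[OF qU l, unfolded gauss_eq_at_def Let_def dch chr(1)[OF q, THEN conjunct1]
      chr(1)[OF q, THEN conjunct2] chr(2)[OF q, THEN conjunct1] chr(2)[OF q, THEN conjunct2]
      chr(3)[OF q, THEN conjunct1] chr(3)[OF q, THEN conjunct2], folded defs]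
      unfolding Q_def by linarith
    have d: "E q * G q - (F q)\<^sup>2 = la q * la q"
      by (simp add: E_eq[OF qU] F_eq[OF qU] G_eq[OF qU] power2_eq_square algebra_simps)
    \<comment> \<open>Using each of the two expressions for \<open>f\<close> once turns
      \<open>e g - f^2\<close> into the determinant of \<open>a\<close> times that of
      \<open>k\<close>.\<close>
    have n: "e q * g q - (f q)\<^sup>2 = la q * (k11 q * k22 q - k12 q * k21 q)"
    proof -
      have "e q * g q - (f q)\<^sup>2 = e q * g q - (a11 q * k21 q + a12 q * k22 q) * (a21 q * k11 q + a22 q * k12 q)"
        using f_eq[OF qU] f_eq'[OF qU] by (simp add: power2_eq_square)
      then show ?thesis by (simp add: e_eq[OF qU] g_eq[OF qU] algebra_simps)
    qed
    have "E q \<noteq> 0"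
    proof
      assume "E q = 0"
      then have "a11 q = 0 \<and> a12 q = 0" using E_eq[OF qU] by (simp add: sum_squares_eq_zero_iff)
      with l show False by simp
    qed
    moreover have "W * E q = E q * (k11 q * k22 q - k12 q * k21 q)"
    proof -
      have "x * (l * y / (l * l)) * l = x * y" if "l \<noteq> 0" for x y l :: real
        using that by simp
      from this[OF l] show ?thesis unfolding 5 Q d n .
    qed
    ultimately have "W = k11 q * k22 q - k12 q * k21 q" by simp
    with m show ?thesis by (simp add: W_def m1_def m2_def)
  qed
  have sm: "smooth_on U (\<lambda>q. dv om1 q - du om2 q - (k11 q * k22 q - k12 q * k21 q))"
    "smooth_on U (\<lambda>q. dv k11 q - om2 q * k12 q - (du k21 q - om1 q * k22 q))"
    "smooth_on U (\<lambda>q. dv k12 q + om2 q * k11 q - (du k22 q + om1 q * k21 q))"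
    by (intro smooth open_U sm_om sm_k smooth_on_pd)+
  show "dv om1 p - du om2 p = k11 p * k22 p - k12 p * k21 p"
    using zero_on_dense[OF sm(1) _ p] main by (simp add: U0_def)
  show "dv k11 p - om2 p * k12 p = du k21 p - om1 p * k22 p"
    using zero_on_dense[OF sm(2) _ p] main by (simp add: U0_def)
  show "dv k12 p + om2 p * k11 p = du k22 p + om1 p * k21 p"
    using zero_on_dense[OF sm(3) _ p] main by (simp add: U0_def)
qed

end

section \<open>Oriented orthonormal frames\<close>

definition oriented_frame :: "real^3 \<Rightarrow> real^3 \<Rightarrow> real^3 \<Rightarrow> bool" where
  "oriented_frame x y z \<longleftrightarrow> x \<bullet> x = 1 \<and> y \<bullet> y = 1 \<and> x \<bullet> y = 0 \<and> z = cross3 x y"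

lemma oriented_frame_inner:
  assumes "oriented_frame x y z"
  shows "x \<bullet> x = 1" "y \<bullet> y = 1" "z \<bullet> z = 1" "x \<bullet> y = 0" "y \<bullet> x = 0" "x \<bullet> z = 0" "z \<bullet> x = 0"
    "y \<bullet> z = 0" "z \<bullet> y = 0"
  using assms by (auto simp: oriented_frame_def dot_cross dot_cross_self inner_commute)

lemma mult_transpose_nth: "(A ** transpose B) $ i $ j = A $ i \<bullet> B $ j"
  for A B :: "real^'n^'m"
  by (simp add: matrix_matrix_mult_def transpose_def inner_vec_def)

lemma transpose_mult_nth: "(transpose A ** B) $ i $ j = column i A \<bullet> column j B"
  for A B :: "real^'n^'m"
  by (simp add: matrix_matrix_mult_def transpose_def inner_vec_def column_def)

lemma rotation_matrix_oriented_frame: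
  assumes "oriented_frame x y z"
  shows "rotation_matrix (vector [x, y, z] :: real^3^3)"
proof -
  have "vector [x, y, z] ** transpose (vector [x, y, z]) = (mat 1 :: real^3^3)"
    by (simp add: vec_eq_iff mult_transpose_nth forall_3 mat_def oriented_frame_inner[OF assms])
  then have "orthogonal_matrix (vector [x, y, z] :: real^3^3)"
    unfolding orthogonal_matrix_def by (metis matrix_left_right_inverse)
  moreover have "x \<bullet> cross3 y z = z \<bullet> cross3 x y"
    by (metis cross_triple inner_commute)
  then have "det (vector [x, y, z] :: real^3^3) = 1"
    unfolding dot_cross_det[symmetric] using assms oriented_frame_inner(3)[OF assms]
    by (simp add: oriented_frame_def)
  ultimately show ?thesis by (simp add: rotation_matrix_def)
qed

lemma oriented_frame_expand:
  assumes "oriented_frame x y z"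
  shows "w = (w \<bullet> x) *\<^sub>R x + (w \<bullet> y) *\<^sub>R y + (w \<bullet> z) *\<^sub>R z"
proof -
  let ?A = "vector [x, y, z] :: real^3^3"
  have "transpose ?A ** ?A = mat 1"
    using rotation_matrix_oriented_frame[OF assms] by (simp add: rotation_matrix_def orthogonal_matrix_def)
  then have "w = transpose ?A *v (?A *v w)"
    by (simp add: matrix_vector_mul_assoc)
  also have "\<dots> = (w \<bullet> x) *\<^sub>R x + (w \<bullet> y) *\<^sub>R y + (w \<bullet> z) *\<^sub>R z"
    by (simp add: vec_eq_iff matrix_vector_mult_def transpose_def sum_3 inner_vec_def mult.commute)
  finally show ?thesis .
qed

text \<open>The frame system conserves sums of coordinate products over the three vectors, that is,
  inner products of columns. For a square matrix, orthonormal columns give orthonormal rows, and the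
  triple product 1 excludes the left-handed case, since then \<open>z - cross3 x y\<close> has
  length zero.\<close>

lemma oriented_frame_of_columns:
  assumes "\<And>j k. x$j * x$k + y$j * y$k + z$j * z$k = (if j = k then 1 else 0)" "x \<bullet> cross3 y z = 1"
  shows "oriented_frame x y z"
proof -
  let ?A = "vector [x, y, z] :: real^3^3"
  have "transpose ?A ** ?A = mat 1"
    by (simp add: vec_eq_iff matrix_matrix_mult_def transpose_def sum_3 assms(1) mat_def)
  then have "?A ** transpose ?A = mat 1" by (simp add: matrix_left_right_inverse)
  then have *: "?A $ i \<bullet> ?A $ j = (if i = j then 1 else 0)" for i j
    by (simp add: mult_transpose_nth[symmetric] mat_def)
  have n: "x \<bullet> x = 1" "y \<bullet> y = 1" "z \<bullet> z = 1" "x \<bullet> y = 0"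
    using *[of 1 1] *[of 2 2] *[of 3 3] *[of 1 2] by simp_all
  have "z \<bullet> cross3 x y = 1" using assms(2) by (metis cross_triple inner_commute)
  moreover have "cross3 x y \<bullet> cross3 x y = 1" by (simp add: dot_cross n inner_commute)
  ultimately have "(z - cross3 x y) \<bullet> (z - cross3 x y) = 0"
    by (simp add: inner_diff_left inner_diff_right n inner_commute)
  then show ?thesis by (simp add: oriented_frame_def n)
qed

text \<open>Coefficients \<open>(\<omega>, k, k', l, l')\<close> act on a moving frame \<open>(e\<^sub>1, e\<^sub>2, e\<^sub>3)\<close> together with its base point.\<close>

definition frame_prod ::
  "real \<times> real \<times> real \<times> real \<times> real \<Rightarrow> (real^3) \<times> (real^3) \<times> (real^3) \<times> (real^3) \<Rightarrow>
   (real^3) \<times> (real^3) \<times> (real^3) \<times> (real^3)" where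
  "frame_prod = (\<lambda>(w, k, k', l, l') (x, y, z, b).
     (w *\<^sub>R y + k *\<^sub>R z, k' *\<^sub>R z - w *\<^sub>R x, - (k *\<^sub>R x) - k' *\<^sub>R y, l *\<^sub>R x + l' *\<^sub>R y))"

lemma bounded_bilinear_frame_prod: "bounded_bilinear frame_prod"
  unfolding bilinear_conv_bounded_bilinear[symmetric] bilinear_def frame_prod_def
  by (auto simp: linear_iff algebra_simps)

section \<open>Existence and rigidity of the moving frame\<close>

context coframe
begin

text \<open>The Gauss-Weingarten equations of the frame alone. The base point is kept apart because
  rigidity finds the rotation from the frames before the translation.\<close>

definition frame_eqs ::
  "(real^2) set \<Rightarrow> (real^2 \<Rightarrow> real) \<Rightarrow> (real^2 \<Rightarrow> real) \<Rightarrow>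
    (real^2 \<Rightarrow> real^3) \<Rightarrow> (real^2 \<Rightarrow> real^3) \<Rightarrow> (real^2 \<Rightarrow> real^3) \<Rightarrow> bool" where
  "frame_eqs V om1 om2 e1 e2 e3 \<longleftrightarrow> (\<forall>p\<in>V.
     e1 differentiable (at p) \<and> e2 differentiable (at p) \<and> e3 differentiable (at p) \<and>
     du e1 p = om1 p *\<^sub>R e2 p + k11 p *\<^sub>R e3 p \<and> dv e1 p = om2 p *\<^sub>R e2 p + k21 p *\<^sub>R e3 p \<and>
     du e2 p = k12 p *\<^sub>R e3 p - om1 p *\<^sub>R e1 p \<and> dv e2 p = k22 p *\<^sub>R e3 p - om2 p *\<^sub>R e1 p \<and>
     du e3 p = - (k11 p *\<^sub>R e1 p) - k12 p *\<^sub>R e2 p \<and> dv e3 p = - (k21 p *\<^sub>R e1 p) - k22 p *\<^sub>R e2 p)"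

text \<open>Both frames satisfy the same linear system, and its coefficients are skew-symmetric.\<close>

lemma frame_eqs_constant:
  assumes "open V" "connected V" and fr: "frame_eqs V om1 om2 e1 e2 e3" "frame_eqs V om1 om2 e1' e2' e3'"
    and pq: "p \<in> V" "q \<in> V"
  shows "e1' p $ j * e1 p $ k + e2' p $ j * e2 p $ k + e3' p $ j * e3 p $ k
       = e1' q $ j * e1 q $ k + e2' q $ j * e2 q $ k + e3' q $ j * e3 q $ k"
proof -
  note fr' = fr[unfolded frame_eqs_def, rule_format]
  \<comment> \<open>An entry of the transposed second frame matrix times the first one. For
    orthonormal frames this product is the rotation from the first frame to the second.\<close>
  define h where "h = (\<lambda>p. e1' p $ j * e1 p $ k + e2' p $ j * e2 p $ k + e3' p $ j * e3 p $ k)"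
  have "h p = h q"
  proof (rule constant_of_pd_eq_0[OF assms(1,2) _ _ _ pq])
    show "h differentiable (at r)" if "r \<in> V" for r
      using fr'[OF that] unfolding h_def
      by (intro differentiable_add differentiable_mult differentiable_nth) auto
    show "du h r = 0" "dv h r = 0" if "r \<in> V" for r
      using fr'[OF that] unfolding h_def
      by (simp_all add: pd_add pd_mult pd_nth differentiable_add differentiable_mult differentiable_nth)
        (simp_all add: algebra_simps)
  qed
  then show ?thesis by (simp add: h_def)
qed

text \<open>Comparing the frame with itself in \<open>frame_eqs_constant\<close> preserves
  orthonormality. The orientation is preserved because the coefficient matrices have trace zero, so
  the triple product is constant.\<close>

lemma frame_eqs_oriented:
  assumes V: "open V" "connected V" and fr: "frame_eqs V om1 om2 e1 e2 e3"
    and p: "p \<in> V" "q \<in> V" and init: "oriented_frame (e1 p) (e2 p) (e3 p)"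
  shows "oriented_frame (e1 q) (e2 q) (e3 q)"
proof -
  note fr' = fr[unfolded frame_eqs_def, rule_format]
  let ?A = "vector [e1 p, e2 p, e3 p] :: real^3^3"
  have "transpose ?A ** ?A = mat 1"
    using rotation_matrix_oriented_frame[OF init] by (simp add: rotation_matrix_def orthogonal_matrix_def)
  then have "(transpose ?A ** ?A) $ j $ k = (if j = k then 1 else 0)" for j k
    by (simp add: mat_def)
  then have 1: "e1 p $ j * e1 p $ k + e2 p $ j * e2 p $ k + e3 p $ j * e3 p $ k = (if j = k then 1 else 0)" for j k
    by (simp add: matrix_matrix_mult_def transpose_def sum_3)
  define h where "h r = e1 r \<bullet> cross3 (e2 r) (e3 r)" for r
  have "h p = h q"
  proof (rule constant_of_pd_eq_0[OF V _ _ _ p])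
    show "h differentiable (at r)" if "r \<in> V" for r
      using fr'[OF that] unfolding h_def
      by (intro differentiable_inner differentiable_cross3) auto
    show "du h r = 0" "dv h r = 0" if "r \<in> V" for r
      using fr'[OF that] unfolding h_def
      by (simp_all add: pd_inner pd_cross3 differentiable_cross3 inner_add_left inner_diff_left
          inner_add_right inner_diff_right cross_add_left cross_add_right Cross3.left_diff_distrib
          Cross3.right_diff_distrib cross_mult_left cross_mult_right dot_cross_self)
  qed
  moreover have "h p = det ?A" by (simp add: h_def dot_cross_det)
  ultimately have 2: "e1 q \<bullet> cross3 (e2 q) (e3 q) = 1"
    using rotation_matrix_oriented_frame[OF init] by (simp add: h_def rotation_matrix_def)
  show ?thesis
    by (rule oriented_frame_of_columns[OF _ 2])
       (simp only: frame_eqs_constant[OF V fr fr p(2) p(1)] 1)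
qed

text \<open>Compatibility of the total system splits by components: \<open>curv\<close> and
  \<open>cod\<close> for the frame, zero torsion for the tangential part of the base point,
  \<open>sym\<close> for its normal part.\<close>

lemma frame_exists:
  assumes conn: "connection_form om1 om2"
    and sym: "\<And>p. p \<in> U \<Longrightarrow> a11 p * k21 p + a12 p * k22 p = a21 p * k11 p + a22 p * k12 p"
    and curv: "\<And>p. p \<in> U \<Longrightarrow> dv om1 p - du om2 p = k11 p * k22 p - k12 p * k21 p"
    and cod: "\<And>p. p \<in> U \<Longrightarrow> dv k11 p - om2 p * k12 p = du k21 p - om1 p * k22 p"
      "\<And>p. p \<in> U \<Longrightarrow> dv k12 p + om2 p * k11 p = du k22 p + om1 p * k21 p"
    and p0: "p0 \<in> U"
  obtains V x e1 e2 e3 where "open V" "p0 \<in> V" "V \<subseteq> U"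
    "smooth_on V x" "smooth_on V e1" "smooth_on V e2" "smooth_on V e3"
    "\<And>p. p \<in> V \<Longrightarrow> oriented_frame (e1 p) (e2 p) (e3 p)" "frame_eqs V om1 om2 e1 e2 e3"
    "\<And>p. p \<in> V \<Longrightarrow> du x p = a11 p *\<^sub>R e1 p + a12 p *\<^sub>R e2 p"
    "\<And>p. p \<in> V \<Longrightarrow> dv x p = a21 p *\<^sub>R e1 p + a22 p *\<^sub>R e2 p"
proof -
  define A where "A p = (om1 p, k11 p, k12 p, a11 p, a12 p)" for p
  define B where "B p = (om2 p, k21 p, k22 p, a21 p, a22 p)" for p
  have sm_om: "smooth_on U om1" "smooth_on U om2"
    and tors: "\<And>q. q \<in> U \<Longrightarrow> dv a11 q - om2 q * a12 q = du a21 q - om1 q * a22 q"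
      "\<And>q. q \<in> U \<Longrightarrow> dv a12 q + om2 q * a11 q = du a22 q + om1 q * a21 q"
    using conn by (auto simp: connection_form_def)
  note d = sm_om[THEN smooth_on_differentiable] diff_a diff_k
  have sm: "smooth_on U A" "smooth_on U B"
    unfolding A_def B_def by (intro smooth open_U sm_om sm_a sm_k)+
  have pdA: "pd i A p = (pd i om1 p, pd i k11 p, pd i k12 p, pd i a11 p, pd i a12 p)"
    and pdB: "pd i B p = (pd i om2 p, pd i k21 p, pd i k22 p, pd i a21 p, pd i a22 p)" if "p \<in> U" for i p
    unfolding A_def B_def by (simp_all add: pd_Pair d[OF that] differentiable_Pair)
  obtain V W where V: "open V" "connected V" "p0 \<in> V" "V \<subseteq> U" and W: "smooth_on V W"
    and W0: "W p0 = (axis 1 1, axis 2 1, axis 3 1, 0)"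
    and Wd: "\<And>p. p \<in> V \<Longrightarrow> du W p = frame_prod (A p) (W p)" "\<And>p. p \<in> V \<Longrightarrow> dv W p = frame_prod (B p) (W p)"
  proof (rule total_linear_system[OF bounded_bilinear_frame_prod open_U p0 sm])
    fix p and w :: "(real^3) \<times> (real^3) \<times> (real^3) \<times> (real^3)"
    assume p: "p \<in> U"
    obtain x y z b where w: "w = (x, y, z, b)" by (cases w) auto
    have eqs: "dv om1 p = du om2 p + (k11 p * k22 p - k12 p * k21 p)"
      "dv k11 p = om2 p * k12 p + (du k21 p - om1 p * k22 p)"
      "dv k12 p = (du k22 p + om1 p * k21 p) - om2 p * k11 p"
      "dv a11 p = om2 p * a12 p + (du a21 p - om1 p * a22 p)"
      "dv a12 p = (du a22 p + om1 p * a21 p) - om2 p * a11 p"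
      using curv[OF p] cod[OF p] tors[OF p] by (simp_all add: algebra_simps)
    \<comment> \<open>The \<open>e3\<close> component of equal mixed derivatives of the base
      point.\<close>
    have s: "(a11 p * k21 p + a12 p * k22 p) *\<^sub>R z = (a21 p * k11 p + a22 p * k12 p) *\<^sub>R z"
      using sym[OF p] by simp
    show "frame_prod (dv A p) w + frame_prod (A p) (frame_prod (B p) w)
        = frame_prod (du B p) w + frame_prod (B p) (frame_prod (A p) w)"
      using s unfolding pdA[OF p] pdB[OF p] w frame_prod_def A_def B_def eqs
      by (simp add: algebra_simps)
  qed blast
  define e1 where "e1 p = fst (W p)" for p
  define e2 where "e2 p = fst (snd (W p))" for p
  define e3 where "e3 p = fst (snd (snd (W p)))" for p
  define x where "x p = snd (snd (snd (W p)))" for p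
  have Weq: "W p = (e1 p, e2 p, e3 p, x p)" for p by (simp add: e1_def e2_def e3_def x_def)
  have sm_e: "smooth_on V e1" "smooth_on V e2" "smooth_on V e3" "smooth_on V x"
    unfolding e1_def e2_def e3_def x_def by (intro smooth V W)+
  note de = sm_e[THEN smooth_on_differentiable]
  have pdW: "pd i W p = (pd i e1 p, pd i e2 p, pd i e3 p, pd i x p)" if "p \<in> V" for i p
    unfolding Weq[abs_def] by (simp add: pd_Pair de[OF that] differentiable_Pair)
  have dW: "du e1 p = om1 p *\<^sub>R e2 p + k11 p *\<^sub>R e3 p \<and> du e2 p = k12 p *\<^sub>R e3 p - om1 p *\<^sub>R e1 p \<and>
     du e3 p = - (k11 p *\<^sub>R e1 p) - k12 p *\<^sub>R e2 p \<and> du x p = a11 p *\<^sub>R e1 p + a12 p *\<^sub>R e2 p"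
    "dv e1 p = om2 p *\<^sub>R e2 p + k21 p *\<^sub>R e3 p \<and> dv e2 p = k22 p *\<^sub>R e3 p - om2 p *\<^sub>R e1 p \<and>
     dv e3 p = - (k21 p *\<^sub>R e1 p) - k22 p *\<^sub>R e2 p \<and> dv x p = a21 p *\<^sub>R e1 p + a22 p *\<^sub>R e2 p"
    if "p \<in> V" for p
    using Wd[OF that] unfolding pdW[OF that] by (simp_all add: Weq A_def B_def frame_prod_def)
  have fr: "frame_eqs V om1 om2 e1 e2 e3"
    using dW de by (simp add: frame_eqs_def)
  have init: "oriented_frame (e1 p0) (e2 p0) (e3 p0)"
    using W0 by (simp add: Weq oriented_frame_def inner_axis_axis cross_basis)
  show thesis
    using that[OF V(1,3,4) sm_e(4,1,2,3) _ fr] frame_eqs_oriented[OF V(1,2) fr V(3) _ init] dW by blast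
qed

end

section \<open>Tangent moving bases and orthonormal frames\<close>

lemma column_jacobian: "column i (jacobian f (at p)) = pd i f p"
  by (simp add: jacobian_def pd_def column_def matrix_def vec_eq_iff)

lemma matrix_eq_columns2: "A = B \<longleftrightarrow> column 1 A = column 1 B \<and> column 2 A = column 2 B"
  for A B :: "real^2^'n"
  by (auto simp: vec_eq_iff column_def forall_2)

lemma column_mult_transpose:
  "column i (A ** transpose B) = (B$i$1) *\<^sub>R column 1 A + (B$i$2) *\<^sub>R column 2 A"
  for A :: "real^2^'n" and B :: "real^2^'m"
  by (simp add: vec_eq_iff column_def matrix_matrix_mult_def transpose_def sum_2 mult.commute)

lemma column_matrix_mult: "column i (R ** A) = R *v column i A"
  by (simp add: vec_eq_iff column_def matrix_matrix_mult_def matrix_vector_mult_def)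

definition of_columns2 :: "real^'n \<Rightarrow> real^'n \<Rightarrow> real^2^'n" where
  "of_columns2 x y = (\<chi> i. vector [x$i, y$i])"

lemma column_of_columns2 [simp]:
  "column 1 (of_columns2 x y) = x" "column 2 (of_columns2 x y) = y"
  by (simp_all add: of_columns2_def column_def vec_eq_iff)

lemma bounded_linear_column: "bounded_linear (\<lambda>A::real^'m^'n. column i A)"
  unfolding linear_conv_bounded_linear[symmetric] by (simp add: linear_iff column_def vec_eq_iff)

lemma smooth_on_of_columns2:
  assumes "open S" "smooth_on S x" "smooth_on S y"
  shows "smooth_on S (\<lambda>p. of_columns2 (x p) (y p))"
proof -
  have "bounded_linear (\<lambda>z. of_columns2 (fst z) (snd z) :: real^2^'n)"
    unfolding linear_conv_bounded_linear[symmetric]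
    by (simp add: linear_iff of_columns2_def vec_eq_iff forall_2)
  from smooth_on_bounded_linear[OF this assms(1) smooth_on_Pair[OF assms]] show ?thesis by simp
qed

lemma unit_normal_eq:
  assumes "oriented_frame x y z" "s > 0" "t > 0"
    "column 1 (\<Omega> p) = s *\<^sub>R x" "column 2 (\<Omega> p) = m *\<^sub>R x + t *\<^sub>R y"
  shows "unit_normal \<Omega> p = z"
proof -
  have "cross3 (column 1 (\<Omega> p)) (column 2 (\<Omega> p)) = (s * t) *\<^sub>R z"
    using assms(1) by (simp add: assms(4,5) cross_add_right cross_mult_left cross_mult_right oriented_frame_def)
  moreover have "norm z = 1" using oriented_frame_inner(3)[OF assms(1)] by (simp add: norm_eq_1)
  ultimately show ?thesis using assms(2,3) by (simp add: unit_normal_def)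
qed

text \<open>Here \<open>L\<close> has first row \<open>(s, 0)\<close> and second row
  \<open>(m, t)\<close>. The equations read: \<open>a\<close> is \<open>\<Lambda> L\<close>,
  \<open>I\<close> is \<open>L\<close> times its transpose, \<open>II\<close> is \<open>L\<close>
  times the transpose of \<open>k\<close>. Hence \<open>\<Lambda> II\<close> is \<open>a\<close>
  times the transpose of \<open>k\<close>, whose two off-diagonal entries are \<open>f_eq\<close>
  and \<open>f_eq'\<close>.\<close>

locale frontal_data = coframe U a11 a12 a21 a22 k11 k12 k21 k22 E F G
  for U :: "(real^2) set" and a11 a12 a21 a22 k11 k12 k21 k22 E F G :: "real^2 \<Rightarrow> real" +
  fixes s m t l11 l12 l21 l22 e f g :: "real^2 \<Rightarrow> real" and \<Lambda> I II :: "real^2 \<Rightarrow> real^2^2"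
  assumes sm_s: "smooth_on U s" "smooth_on U m" "smooth_on U t"
    and pos: "\<And>p. p \<in> U \<Longrightarrow> s p > 0" "\<And>p. p \<in> U \<Longrightarrow> t p > 0"
    and \<Lambda>_eq: "\<And>p. p \<in> U \<Longrightarrow> \<Lambda> p = mat2 (l11 p) (l12 p) (l21 p) (l22 p)"
    and a_eq: "\<And>p. p \<in> U \<Longrightarrow> a11 p = l11 p * s p + l12 p * m p" "\<And>p. p \<in> U \<Longrightarrow> a12 p = l12 p * t p"
      "\<And>p. p \<in> U \<Longrightarrow> a21 p = l21 p * s p + l22 p * m p" "\<And>p. p \<in> U \<Longrightarrow> a22 p = l22 p * t p"
    and I_eq: "\<And>p. p \<in> U \<Longrightarrow> I p = mat2 (s p * s p) (s p * m p) (s p * m p) (m p * m p + t p * t p)"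
    and II_eq: "\<And>p. p \<in> U \<Longrightarrow> II p = mat2 (s p * k11 p) (s p * k21 p)
      (m p * k11 p + t p * k12 p) (m p * k21 p + t p * k22 p)"
    and e_eq: "\<And>p. p \<in> U \<Longrightarrow> e p = a11 p * k11 p + a12 p * k12 p"
    and f_eq: "\<And>p. p \<in> U \<Longrightarrow> f p = a11 p * k21 p + a12 p * k22 p"
    and f_eq': "\<And>p. p \<in> U \<Longrightarrow> f p = a21 p * k11 p + a22 p * k12 p"
    and g_eq: "\<And>p. p \<in> U \<Longrightarrow> g p = a21 p * k21 p + a22 p * k22 p"
begin

text \<open>With \<open>\<Omega>\<close> equal to \<open>(e1 e2)\<close> times the transpose of
  \<open>L\<close>, every condition is read off from components in the orthonormal frame; the second
  form comes from the derivatives of \<open>e3\<close>, which is the unit normal as \<open>s\<close>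
  and \<open>t\<close> are positive.\<close>

lemma realizes_onI:
  assumes V: "open V" "V \<subseteq> U"
    and sm: "smooth_on V x" "smooth_on V e1" "smooth_on V e2" "smooth_on V e3"
    and ori: "\<And>p. p \<in> V \<Longrightarrow> oriented_frame (e1 p) (e2 p) (e3 p)"
    and fr: "frame_eqs V om1 om2 e1 e2 e3"
    and dx: "\<And>p. p \<in> V \<Longrightarrow> du x p = a11 p *\<^sub>R e1 p + a12 p *\<^sub>R e2 p"
      "\<And>p. p \<in> V \<Longrightarrow> dv x p = a21 p *\<^sub>R e1 p + a22 p *\<^sub>R e2 p"
  shows "realizes_on V E F G e f g \<Lambda> I II x
    (\<lambda>p. of_columns2 (s p *\<^sub>R e1 p) (m p *\<^sub>R e1 p + t p *\<^sub>R e2 p))"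
proof -
  define \<Omega> where "\<Omega> p = of_columns2 (s p *\<^sub>R e1 p) (m p *\<^sub>R e1 p + t p *\<^sub>R e2 p)" for p
  have col: "column 1 (\<Omega> p) = s p *\<^sub>R e1 p" "column 2 (\<Omega> p) = m p *\<^sub>R e1 p + t p *\<^sub>R e2 p" for p
    by (simp_all add: \<Omega>_def)
  have VU: "p \<in> U" if "p \<in> V" for p using that V by auto
  note fr' = fr[unfolded frame_eqs_def, rule_format]
  note sm_V = sm_a[THEN smooth_on_subset, OF V(2)] sm_s[THEN smooth_on_subset, OF V(2)]
  note orth = oriented_frame_inner[OF ori]
  have normal: "unit_normal \<Omega> p = e3 p" if "p \<in> V" for p
    by (rule unit_normal_eq[where \<Omega> = \<Omega> and p = p, OF ori[OF that] pos[OF VU[OF that]] col])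
  have smO: "smooth_on V \<Omega>"
    unfolding \<Omega>_def by (intro smooth_on_of_columns2 smooth V sm sm_V)
  have "frontal_on V x"
    unfolding frontal_on_def
  proof (intro conjI ballI sm(1))
    fix p assume "p \<in> V"
    moreover have "\<forall>q\<in>V. norm (e3 q) = 1 \<and> e3 q \<bullet> du x q = 0 \<and> e3 q \<bullet> dv x q = 0"
      by (simp add: dx orth norm_eq_1 inner_add_right)
    ultimately show "\<exists>W \<nu>. open W \<and> p \<in> W \<and> W \<subseteq> V \<and> smooth_on W \<nu> \<and>
        (\<forall>q\<in>W. norm (\<nu> q :: real^3) = 1 \<and> \<nu> q \<bullet> du x q = 0 \<and> \<nu> q \<bullet> dv x q = 0)"
      using V(1) sm(4) by blast
  qed
  moreover have "tangent_moving_base_on V x \<Omega>"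
    unfolding tangent_moving_base_on_def col
  proof (intro conjI ballI smO)
    fix p assume p: "p \<in> V"
    have st: "s p > 0" "t p > 0" using pos VU[OF p] by auto
    let ?w1 = "s p *\<^sub>R e1 p" and ?w2 = "m p *\<^sub>R e1 p + t p *\<^sub>R e2 p"
    have i2: "?w2 \<bullet> e2 p = t p" using orth[OF p] by (simp add: inner_add_left)
    have "y \<bullet> e2 p = 0" if "y \<in> span {?w1}" for y
      using that orth[OF p] by (auto simp: span_singleton)
    with i2 st have nin: "?w2 \<notin> span {?w1}" by force
    then show "?w1 \<noteq> ?w2" using span_base by force
    have "?w1 \<noteq> 0" using st orth(1)[OF p] by auto
    then have "independent {?w2, ?w1}" using nin by (intro independent_insertI independent_empty) auto
    then show "independent {?w1, ?w2}" by (simp add: insert_commute)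
    have b: "?w1 \<in> span {?w1, ?w2}" "?w2 \<in> span {?w1, ?w2}" by (auto intro: span_base)
    have e1: "e1 p \<in> span {?w1, ?w2}"
      using span_scale[OF b(1), of "1 / s p"] st by simp
    have "e2 p = (1 / t p) *\<^sub>R (?w2 - m p *\<^sub>R e1 p)" using st by simp
    then have e2: "e2 p \<in> span {?w1, ?w2}"
      using b e1 by (metis span_scale span_diff)
    show "du x p \<in> span {?w1, ?w2}" "dv x p \<in> span {?w1, ?w2}"
      unfolding dx[OF p] by (intro span_add span_scale e1 e2)+
  qed
  moreover have "jacobian x (at p) = \<Omega> p ** transpose (\<Lambda> p)" if p: "p \<in> V" for p
    unfolding matrix_eq_columns2 column_jacobian column_mult_transpose col
      \<Lambda>_eq[OF VU[OF p]] mat2_nth dx[OF p] a_eq[OF VU[OF p]]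
    by (simp add: algebra_simps)
  moreover have "first_form \<Omega> p = I p" if p: "p \<in> V" for p
    using orth[OF p]
    by (simp add: vec_eq_iff forall_2 first_form_def transpose_mult_nth col I_eq[OF VU[OF p]]
        inner_add_left inner_add_right)
  moreover have "second_form \<Omega> p = II p" if p: "p \<in> V" for p
  proof -
    have "pd i (unit_normal \<Omega>) p = pd i e3 p" for i
      by (rule pd_cong[OF V(1) p normal[symmetric], symmetric]) (use fr'[OF p] in auto)
    then have "second_form \<Omega> p $ i $ j = - (column i (\<Omega> p) \<bullet> pd j e3 p)" for i j
      by (simp add: second_form_def transpose_mult_nth column_jacobian)
    then show ?thesis
      using orth[OF p] fr'[OF p] unfolding vec_eq_iff[of "second_form \<Omega> p"] vec_eq_iff[of "second_form \<Omega> p $ i" for i]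
        forall_2 II_eq[OF VU[OF p]] mat2_nth
      by (simp add: col inner_add_left inner_diff_right)
  qed
  moreover have "first_fundamental_coeffs_on V x E F G"
    unfolding first_fundamental_coeffs_on_def
    using orth by (auto simp: dx E_eq[OF VU] F_eq[OF VU] G_eq[OF VU] inner_add_left inner_add_right)
  moreover have "second_fundamental_coeffs_on V x \<Omega> e f g"
    unfolding second_fundamental_coeffs_on_def
  proof (intro ballI)
    fix p assume p: "p \<in> V"
    note d = sm_V[THEN smooth_on_differentiable, OF p] sm(2,3)[THEN smooth_on_differentiable, OF p]
    have 1: "pd i (du x) p = pd i (\<lambda>q. a11 q *\<^sub>R e1 q + a12 q *\<^sub>R e2 q) p"
      and 2: "pd i (dv x) p = pd i (\<lambda>q. a21 q *\<^sub>R e1 q + a22 q *\<^sub>R e2 q) p" for i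
      by (rule pd_cong[OF V(1) p]; use dx p in
          \<open>auto intro: smooth_on_differentiable[OF smooth_on_pd[OF sm(1)]]\<close>)+
    show "e p = unit_normal \<Omega> p \<bullet> du (du x) p \<and> f p = unit_normal \<Omega> p \<bullet> dv (du x) p \<and>
        g p = unit_normal \<Omega> p \<bullet> dv (dv x) p"
      unfolding normal[OF p] 1 2
      using fr'[OF p] orth[OF p]
      by (simp add: pd_add pd_scaleR d differentiable_scaleR inner_add_right inner_diff_right
          e_eq[OF VU[OF p]] f_eq[OF VU[OF p]] g_eq[OF VU[OF p]])
  qed
  ultimately show ?thesis
    by (simp add: realizes_on_def \<Omega>_def[abs_def])
qed

text \<open>Gram-Schmidt with prescribed coefficients: the columns of \<open>\<Omega>\<close> are
  solved for \<open>e1\<close> and \<open>e2\<close>, and the prescribed first form makes these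
  orthonormal. The second form fixes the derivatives of \<open>e3\<close>, and equality of mixed
  derivatives of \<open>x\<close> shows that the rotation rates form a connection form.\<close>

lemma realizes_on_frame:
  assumes real: "realizes_on U E F G e f g \<Lambda> I II x \<Omega>"
  obtains om1 om2 e1 e2 e3 where "connection_form om1 om2" "frame_eqs U om1 om2 e1 e2 e3"
    "\<And>p. p \<in> U \<Longrightarrow> oriented_frame (e1 p) (e2 p) (e3 p)"
    "\<And>p. p \<in> U \<Longrightarrow> column 1 (\<Omega> p) = s p *\<^sub>R e1 p"
    "\<And>p. p \<in> U \<Longrightarrow> column 2 (\<Omega> p) = m p *\<^sub>R e1 p + t p *\<^sub>R e2 p"
    "smooth_on U x"
    "\<And>p. p \<in> U \<Longrightarrow> du x p = a11 p *\<^sub>R e1 p + a12 p *\<^sub>R e2 p"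
    "\<And>p. p \<in> U \<Longrightarrow> dv x p = a21 p *\<^sub>R e1 p + a22 p *\<^sub>R e2 p"
proof -
  have smx: "smooth_on U x" and smO: "smooth_on U \<Omega>"
    and jac: "\<And>p. p \<in> U \<Longrightarrow> jacobian x (at p) = \<Omega> p ** transpose (\<Lambda> p)"
    and I1: "\<And>p. p \<in> U \<Longrightarrow> first_form \<Omega> p = I p" and II1: "\<And>p. p \<in> U \<Longrightarrow> second_form \<Omega> p = II p"
    using real by (auto simp: realizes_on_def frontal_on_def tangent_moving_base_on_def)
  define e1 where "e1 p = (1 / s p) *\<^sub>R column 1 (\<Omega> p)" for p
  define e2 where "e2 p = (1 / t p) *\<^sub>R (column 2 (\<Omega> p) - m p *\<^sub>R e1 p)" for p
  define e3 where "e3 p = cross3 (e1 p) (e2 p)" for p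
  have smcol: "smooth_on U (\<lambda>p. column i (\<Omega> p))" for i
    by (rule smooth_on_bounded_linear[OF bounded_linear_column open_U smO])
  have sm1: "smooth_on U e1"
    unfolding e1_def by (intro smooth open_U sm_s smcol) (use pos in force)
  have sm2: "smooth_on U e2"
    unfolding e2_def by (intro smooth open_U sm_s smcol sm1) (use pos in force)
  have sm3: "smooth_on U e3"
    unfolding e3_def by (intro smooth open_U sm1 sm2)
  have col: "column 1 (\<Omega> p) = s p *\<^sub>R e1 p" "column 2 (\<Omega> p) = m p *\<^sub>R e1 p + t p *\<^sub>R e2 p" if "p \<in> U" for p
    using pos[OF that] by (simp_all add: e1_def e2_def)
  have ori: "oriented_frame (e1 p) (e2 p) (e3 p)" if p: "p \<in> U" for p
  proof -
    have "first_form \<Omega> p $ i $ j = I p $ i $ j" for i j using I1[OF p] by simp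
    note * = this[unfolded first_form_def transpose_mult_nth I_eq[OF p]]
    have 1: "column 1 (\<Omega> p) \<bullet> column 1 (\<Omega> p) = s p * s p" "column 1 (\<Omega> p) \<bullet> column 2 (\<Omega> p) = s p * m p"
      "column 2 (\<Omega> p) \<bullet> column 2 (\<Omega> p) = m p * m p + t p * t p"
      using *[of 1 1] *[of 1 2] *[of 2 2] by simp_all
    have e11: "e1 p \<bullet> e1 p = 1" using 1(1) pos[OF p] by (simp add: col[OF p])
    have e12: "e1 p \<bullet> e2 p = 0" using 1(2) pos[OF p] by (simp add: col[OF p] e11 inner_add_right algebra_simps)
    have "e2 p \<bullet> e2 p = 1"
      using 1(3) pos[OF p] by (simp add: col[OF p] e11 e12 inner_add_right inner_add_left inner_commute[of "e2 p" "e1 p"] algebra_simps)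
    with e11 e12 show ?thesis by (simp add: oriented_frame_def e3_def)
  qed
  note orth = oriented_frame_inner[OF ori]
  have dx: "du x p = a11 p *\<^sub>R e1 p + a12 p *\<^sub>R e2 p" "dv x p = a21 p *\<^sub>R e1 p + a22 p *\<^sub>R e2 p" if p: "p \<in> U" for p
    using jac[OF p] unfolding matrix_eq_columns2 column_jacobian column_mult_transpose col[OF p]
      \<Lambda>_eq[OF p] mat2_nth a_eq[OF p]
    by (simp_all add: algebra_simps)
  define om1 where "om1 p = du e1 p \<bullet> e2 p" for p
  define om2 where "om2 p = dv e1 p \<bullet> e2 p" for p
  have sm_om: "smooth_on U om1" "smooth_on U om2"
    unfolding om1_def om2_def by (intro smooth open_U smooth_on_pd sm1 sm2)+
  have fr: "frame_eqs U om1 om2 e1 e2 e3"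
    unfolding frame_eqs_def
  proof
    fix p assume p: "p \<in> U"
    note d = sm1[THEN smooth_on_differentiable, OF p] sm2[THEN smooth_on_differentiable, OF p]
      sm3[THEN smooth_on_differentiable, OF p]
    \<comment> \<open>Differentiating the constant inner products gives six skew relations, which
      leave three rates per direction: the rotation rate and two entries of
      \<open>k\<close>.\<close>
    have const: "x p \<bullet> pd i y p + pd i x p \<bullet> y p = 0"
      if "\<And>q. q \<in> U \<Longrightarrow> x q \<bullet> y q = c" "x differentiable (at p)" "y differentiable (at p)"
      for x y :: "real^2 \<Rightarrow> real^3" and i c
      using pd_cong[OF open_U p that(1) differentiable_inner[OF that(2,3)], of i] pd_inner[OF that(2,3), of i] by simp
    have o: "e1 p \<bullet> pd i e1 p = 0" "e2 p \<bullet> pd i e2 p = 0" "e3 p \<bullet> pd i e3 p = 0"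
      "e1 p \<bullet> pd i e2 p = - (pd i e1 p \<bullet> e2 p)" "e1 p \<bullet> pd i e3 p = - (pd i e1 p \<bullet> e3 p)"
      "e2 p \<bullet> pd i e3 p = - (pd i e2 p \<bullet> e3 p)" for i
      using const[OF orth(1) d(1) d(1), of i] const[OF orth(2) d(2) d(2), of i]
        const[OF orth(3) d(3) d(3), of i] const[OF orth(4) d(1) d(2), of i]
        const[OF orth(6) d(1) d(3), of i] const[OF orth(8) d(2) d(3), of i]
      by (simp_all add: inner_commute)
    have "unit_normal \<Omega> q = e3 q" if "q \<in> U" for q
      by (rule unit_normal_eq[where \<Omega> = \<Omega> and p = q, OF ori[OF that] pos[OF that] col[OF that]])
    then have normal: "pd i (unit_normal \<Omega>) p = pd i e3 p" for i
      using pd_cong[OF open_U p _ d(3), of "unit_normal \<Omega>" i] by simp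
    have "- (column i (\<Omega> p) \<bullet> pd j e3 p) = II p $ i $ j" for i j
      using II1[OF p, symmetric] by (simp add: second_form_def transpose_mult_nth column_jacobian normal)
    note * = this[unfolded II_eq[OF p]]
    have cancel: "y = - z" if "c > 0" "- (c * y) = c * z" for c y z :: real
    proof -
      have "c * (y + z) = 0" using that(2) by (simp add: distrib_left)
      then show ?thesis using that(1) by simp
    qed
    have k1: "e1 p \<bullet> du e3 p = - k11 p" "e1 p \<bullet> dv e3 p = - k21 p"
      using *[of 1 1] *[of 1 2] pos(1)[OF p] unfolding col[OF p] mat2_nth inner_scaleR_left
      by (blast intro: cancel)+
    have k2: "e2 p \<bullet> du e3 p = - k12 p" "e2 p \<bullet> dv e3 p = - k22 p"
    proof -
      have "- (t p * (e2 p \<bullet> du e3 p)) = t p * k12 p" "- (t p * (e2 p \<bullet> dv e3 p)) = t p * k22 p"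
        using *[of 2 1] *[of 2 2] unfolding col[OF p] mat2_nth inner_scaleR_left inner_add_left k1 by simp_all
      then show "e2 p \<bullet> du e3 p = - k12 p" "e2 p \<bullet> dv e3 p = - k22 p"
        using cancel[OF pos(2)[OF p]] by blast+
    qed
    note ex = oriented_frame_expand[OF ori[OF p]]
    show "e1 differentiable (at p) \<and> e2 differentiable (at p) \<and> e3 differentiable (at p) \<and>
     du e1 p = om1 p *\<^sub>R e2 p + k11 p *\<^sub>R e3 p \<and> dv e1 p = om2 p *\<^sub>R e2 p + k21 p *\<^sub>R e3 p \<and>
     du e2 p = k12 p *\<^sub>R e3 p - om1 p *\<^sub>R e1 p \<and> dv e2 p = k22 p *\<^sub>R e3 p - om2 p *\<^sub>R e1 p \<and>
     du e3 p = - (k11 p *\<^sub>R e1 p) - k12 p *\<^sub>R e2 p \<and> dv e3 p = - (k21 p *\<^sub>R e1 p) - k22 p *\<^sub>R e2 p"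
    proof (intro conjI d)
      show "du e1 p = om1 p *\<^sub>R e2 p + k11 p *\<^sub>R e3 p"
        using ex[of "du e1 p"] o[of 1] k1 by (simp add: om1_def inner_commute)
      show "dv e1 p = om2 p *\<^sub>R e2 p + k21 p *\<^sub>R e3 p"
        using ex[of "dv e1 p"] o[of 2] k1 by (simp add: om2_def inner_commute)
      show "du e2 p = k12 p *\<^sub>R e3 p - om1 p *\<^sub>R e1 p"
        using ex[of "du e2 p"] o[of 1] k2 by (simp add: om1_def inner_commute)
      show "dv e2 p = k22 p *\<^sub>R e3 p - om2 p *\<^sub>R e1 p"
        using ex[of "dv e2 p"] o[of 2] k2 by (simp add: om2_def inner_commute)
      show "du e3 p = - (k11 p *\<^sub>R e1 p) - k12 p *\<^sub>R e2 p"
        using ex[of "du e3 p"] o(3)[of 1] k1 k2 by (simp add: inner_commute)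
      show "dv e3 p = - (k21 p *\<^sub>R e1 p) - k22 p *\<^sub>R e2 p"
        using ex[of "dv e3 p"] o(3)[of 2] k1 k2 by (simp add: inner_commute)
    qed
  qed
  note fr' = fr[unfolded frame_eqs_def, rule_format]
  have "connection_form om1 om2"
    unfolding connection_form_def
  proof (intro conjI ballI sm_om)
    fix p assume p: "p \<in> U"
    note d = diff_a[OF p] sm1[THEN smooth_on_differentiable, OF p] sm2[THEN smooth_on_differentiable, OF p]
    note ddx = smx[THEN smooth_on_pd, THEN smooth_on_differentiable, OF p]
    have 1: "dv (du x) p = dv (\<lambda>q. a11 q *\<^sub>R e1 q + a12 q *\<^sub>R e2 q) p"
      by (rule pd_cong[OF open_U p _ ddx]) (simp add: dx)
    have 2: "du (dv x) p = du (\<lambda>q. a21 q *\<^sub>R e1 q + a22 q *\<^sub>R e2 q) p"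
      by (rule pd_cong[OF open_U p _ ddx]) (simp add: dx)
    have 3: "dv (\<lambda>q. a11 q *\<^sub>R e1 q + a12 q *\<^sub>R e2 q) p = du (\<lambda>q. a21 q *\<^sub>R e1 q + a22 q *\<^sub>R e2 q) p"
      using pd_commute[OF open_U smx p] unfolding 1 2 .
    \<comment> \<open>Equal mixed derivatives, to be paired with \<open>e1\<close> and
      \<open>e2\<close>; these components are the torsion equations.\<close>
    have "dv (\<lambda>q. a11 q *\<^sub>R e1 q + a12 q *\<^sub>R e2 q) p \<bullet> z = du (\<lambda>q. a21 q *\<^sub>R e1 q + a22 q *\<^sub>R e2 q) p \<bullet> z" for z
      unfolding 3 ..
    note 4 = this[of "e1 p"] this[of "e2 p"]
    show "dv a11 p - om2 p * a12 p = du a21 p - om1 p * a22 p" "dv a12 p + om2 p * a11 p = du a22 p + om1 p * a21 p"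
      using 4 fr'[OF p] orth[OF p]
      by (simp_all add: pd_add pd_scaleR d differentiable_scaleR inner_add_left inner_diff_left algebra_simps)
  qed
  then show thesis using that fr ori col smx dx by blast
qed

text \<open>Both connection forms agree, so the frames solve one and the same skew system and differ
  by a constant rotation \<open>R\<close>. Since \<open>R\<close> maps the derivatives of
  \<open>x\<close> to those of \<open>x'\<close>, the difference \<open>x' - R x\<close> is
  constant.\<close>

lemma realizes_on_unique:
  assumes "connected U"
    and "realizes_on U E F G e f g \<Lambda> I II x \<Omega>" "realizes_on U E F G e f g \<Lambda> I II x' \<Omega>'"
  shows "\<exists>(a::real^3) (R::real^3^3). rotation_matrix R \<and> (\<forall>p\<in>U. \<Omega>' p = R ** \<Omega> p \<and> x' p = a + R *v x p)"
proof (cases "U = {}")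
  case True
  \<comment> \<open>On an empty domain there is no point from which to read a rotation; the identity
    serves.\<close>
  have "rotation_matrix (mat 1 :: real^3^3)" by (simp add: rotation_matrix_def orthogonal_matrix_def)
  with True show ?thesis by blast
next
  case False
  then obtain q where q: "q \<in> U" by blast
  obtain om1 om2 e1 e2 e3 where conn: "connection_form om1 om2" and fr: "frame_eqs U om1 om2 e1 e2 e3"
    and ori: "\<And>p. p \<in> U \<Longrightarrow> oriented_frame (e1 p) (e2 p) (e3 p)"
    and col: "\<And>p. p \<in> U \<Longrightarrow> column 1 (\<Omega> p) = s p *\<^sub>R e1 p"
    "\<And>p. p \<in> U \<Longrightarrow> column 2 (\<Omega> p) = m p *\<^sub>R e1 p + t p *\<^sub>R e2 p"
    and smx: "smooth_on U x"
    and dx: "\<And>p. p \<in> U \<Longrightarrow> du x p = a11 p *\<^sub>R e1 p + a12 p *\<^sub>R e2 p"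
    "\<And>p. p \<in> U \<Longrightarrow> dv x p = a21 p *\<^sub>R e1 p + a22 p *\<^sub>R e2 p"
    by (rule realizes_on_frame[OF assms(2)]) (rule that)
  obtain om1' om2' e1' e2' e3' where conn': "connection_form om1' om2'" and fr': "frame_eqs U om1' om2' e1' e2' e3'"
    and ori': "\<And>p. p \<in> U \<Longrightarrow> oriented_frame (e1' p) (e2' p) (e3' p)"
    and col': "\<And>p. p \<in> U \<Longrightarrow> column 1 (\<Omega>' p) = s p *\<^sub>R e1' p"
    "\<And>p. p \<in> U \<Longrightarrow> column 2 (\<Omega>' p) = m p *\<^sub>R e1' p + t p *\<^sub>R e2' p"
    and smx': "smooth_on U x'"
    and dx': "\<And>p. p \<in> U \<Longrightarrow> du x' p = a11 p *\<^sub>R e1' p + a12 p *\<^sub>R e2' p"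
    "\<And>p. p \<in> U \<Longrightarrow> dv x' p = a21 p *\<^sub>R e1' p + a22 p *\<^sub>R e2' p"
    by (rule realizes_on_frame[OF assms(3)]) (rule that)
  have fr'': "frame_eqs U om1 om2 e1' e2' e3'"
    using fr' connection_form_unique[OF conn conn'] by (simp add: frame_eqs_def)
  define P where "P p = (vector [e1 p, e2 p, e3 p] :: real^3^3)" for p
  define P' where "P' p = (vector [e1' p, e2' p, e3' p] :: real^3^3)" for p
  define R where "R = transpose (P' q) ** P q"
  have rot: "rotation_matrix (P p)" "rotation_matrix (P' p)" if "p \<in> U" for p
    unfolding P_def P'_def by (intro rotation_matrix_oriented_frame ori ori' that)+
  have R: "rotation_matrix R"
    using rot[OF q] unfolding R_def rotation_matrix_def
    by (simp add: orthogonal_matrix_mul orthogonal_matrix_transpose det_mul)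
  have R_eq: "transpose (P' p) ** P p = R" if "p \<in> U" for p
    using frame_eqs_constant[OF open_U assms(1) fr fr'' that q]
    by (simp add: R_def vec_eq_iff matrix_matrix_mult_def transpose_def sum_3 P_def P'_def)
  have Re: "R *v e1 p = e1' p" "R *v e2 p = e2' p" if p: "p \<in> U" for p
  proof -
    \<comment> \<open>\<open>P p\<close> sends the first frame to the standard basis, and the
      transpose of \<open>P' p\<close> sends that basis to the second frame.\<close>
    have "P p *v e1 p = axis 1 1" "P p *v e2 p = axis 2 1"
      using oriented_frame_inner[OF ori[OF p]]
      by (simp_all add: vec_eq_iff forall_3 matrix_vector_mul_component P_def axis_def)
    moreover have "transpose (P' p) *v axis 1 1 = e1' p" "transpose (P' p) *v axis 2 1 = e2' p"
      by (simp_all add: matrix_vector_mult_basis column_transpose row_def P'_def)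
    ultimately show "R *v e1 p = e1' p" "R *v e2 p = e2' p"
      by (simp_all add: R_eq[OF p, symmetric] matrix_vector_mul_assoc[symmetric])
  qed
  have "\<Omega>' p = R ** \<Omega> p" if "p \<in> U" for p
    by (simp add: matrix_eq_columns2 column_matrix_mult col[OF that] col'[OF that]
        matrix_vector_right_distrib matrix_vector_mult_scaleR Re[OF that])
  moreover define a where "a = x' q - R *v x q"
  have "x' p = a + R *v x p" if p: "p \<in> U" for p
  proof -
    have bl: "bounded_linear ((*v) R)" by (rule matrix_vector_mul_bounded_linear)
    note d = smx[THEN smooth_on_differentiable] smx'[THEN smooth_on_differentiable]
    have dR: "(\<lambda>q. R *v x q) differentiable (at r)" if r: "r \<in> U" for r
    proof -
      obtain D where "(x has_derivative D) (at r)"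
        using d(1)[OF r] unfolding differentiable_def ..
      from bounded_linear.has_derivative[OF bl this] show ?thesis
        by (rule differentiableI)
    qed
    have "x' p - R *v x p = x' q - R *v x q"
    proof (rule constant_of_pd_eq_0[OF open_U assms(1) _ _ _ p q])
      show "(\<lambda>p. x' p - R *v x p) differentiable (at r)" if "r \<in> U" for r
        by (intro differentiable_diff d dR that)
      show "du (\<lambda>p. x' p - R *v x p) r = 0" "dv (\<lambda>p. x' p - R *v x p) r = 0" if "r \<in> U" for r
        by (simp_all add: pd_diff d[OF that] dR[OF that] pd_bounded_linear[OF bl] dx[OF that] dx'[OF that]
            matrix_vector_right_distrib matrix_vector_mult_scaleR Re[OF that])
    qed
    then show ?thesis by (simp add: a_def algebra_simps)
  qed
  ultimately show ?thesis using R by blast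
qed

end

section \<open>The hypotheses of the theorem rewritten in the coframe\<close>

lemma row_mat2: "row 1 (mat2 a b c d) = plane_point a b" "row 2 (mat2 a b c d) = plane_point c d"
  by (simp_all add: vec_eq_iff forall_2 row_def)

lemma mat2_mult:
  "mat2 a b c d ** mat2 a' b' c' d' = mat2 (a * a' + b * c') (a * b' + b * d') (c * a' + d * c') (c * b' + d * d')"
  by (simp add: vec_eq_iff forall_2 matrix_matrix_mult_def sum_2)

lemma transpose_mat2: "transpose (mat2 a b c d) = mat2 a c b d"
  by (simp add: vec_eq_iff forall_2 transpose_def)

lemma pd_plane_point:
  assumes "x differentiable (at p)" "y differentiable (at p)"
  shows "pd i (\<lambda>q. plane_point (x q) (y q)) p = plane_point (pd i x p) (pd i y p)"
  using assms by (simp add: plane_point_def pd_add pd_scaleR differentiable_scaleR)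

lemma plane_point_form:
  "(plane_point a b v* mat2 c d d' e) \<bullet> plane_point x y = (a * c + b * d') * x + (a * d + b * e) * y"
  by (simp add: inner_vec_def sum_2 vector_matrix_mult_def mult.commute)

theorem theorem5p1:
  fixes U :: "(real^2) set"
    and E F G e f g :: "real^2 \<Rightarrow> real"
    and l11 l12 l21 l22 E\<^sub>\<Omega> F\<^sub>\<Omega> G\<^sub>\<Omega> e\<^sub>\<Omega> f1\<^sub>\<Omega> f2\<^sub>\<Omega> g\<^sub>\<Omega> :: "real^2 \<Rightarrow> real"
    and \<Lambda> I\<^sub>\<Omega> II\<^sub>\<Omega> :: "real^2 \<Rightarrow> real^2^2"
  assumes "open U"
    and "smooth_on U E" "smooth_on U F" "smooth_on U G"
    and "smooth_on U e" "smooth_on U f" "smooth_on U g"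
    and "\<forall>p\<in>U. E p \<ge> 0 \<and> G p \<ge> 0 \<and> E p * G p - (F p)\<^sup>2 \<ge> 0"
    and "smooth_on U l11" "smooth_on U l12" "smooth_on U l21" "smooth_on U l22"
    and "smooth_on U E\<^sub>\<Omega>" "smooth_on U F\<^sub>\<Omega>" "smooth_on U G\<^sub>\<Omega>"
    and "smooth_on U e\<^sub>\<Omega>" "smooth_on U f1\<^sub>\<Omega>" "smooth_on U f2\<^sub>\<Omega>" "smooth_on U g\<^sub>\<Omega>"
    and Lambda: "\<Lambda> = (\<lambda>p. mat2 (l11 p) (l12 p) (l21 p) (l22 p))"
    and I: "I\<^sub>\<Omega> = (\<lambda>p. mat2 (E\<^sub>\<Omega> p) (F\<^sub>\<Omega> p) (F\<^sub>\<Omega> p) (G\<^sub>\<Omega> p))"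
    and II: "II\<^sub>\<Omega> = (\<lambda>p. mat2 (e\<^sub>\<Omega> p) (f1\<^sub>\<Omega> p) (f2\<^sub>\<Omega> p) (g\<^sub>\<Omega> p))"
    and "\<forall>p\<in>U. mat2 (E p) (F p) (F p) (G p) = \<Lambda> p ** I\<^sub>\<Omega> p ** transpose (\<Lambda> p)"
    and "\<forall>p\<in>U. mat2 (e p) (f p) (f p) (g p) = \<Lambda> p ** II\<^sub>\<Omega> p"
    and "\<forall>p\<in>U. E\<^sub>\<Omega> p > 0 \<and> G\<^sub>\<Omega> p > 0 \<and> E\<^sub>\<Omega> p * G\<^sub>\<Omega> p - (F\<^sub>\<Omega> p)\<^sup>2 > 0"
    and "interior {p \<in> U. det (\<Lambda> p) = 0} = {}"
    and "(\<lambda>p. (du (\<lambda>q. row 1 (\<Lambda> q)) p v* I\<^sub>\<Omega> p) \<bullet> row 2 (\<Lambda> p)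
             - (row 1 (\<Lambda> p) v* I\<^sub>\<Omega> p) \<bullet> du (\<lambda>q. row 2 (\<Lambda> q)) p
             + dv E p - du F p) \<in> principal_ideal U (\<lambda>p. det (\<Lambda> p))"
    and "(\<lambda>p. (dv (\<lambda>q. row 1 (\<Lambda> q)) p v* I\<^sub>\<Omega> p) \<bullet> row 2 (\<Lambda> p)
             - (row 1 (\<Lambda> p) v* I\<^sub>\<Omega> p) \<bullet> dv (\<lambda>q. row 2 (\<Lambda> q)) p
             + dv F p - du G p) \<in> principal_ideal U (\<lambda>p. det (\<Lambda> p))"
    and "\<forall>p\<in>U. det (\<Lambda> p) \<noteq> 0 \<longrightarrow> gauss_eq_at E F G e f g p \<and> mainardi_codazzi_eqs_at E F G e f g p"
  shows "(\<forall>p0\<in>U. \<exists>V x \<Omega>. open V \<and> p0 \<in> V \<and> V \<subseteq> U \<and>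
            realizes_on V E F G e f g \<Lambda> I\<^sub>\<Omega> II\<^sub>\<Omega> x \<Omega>) \<and>
         (connected U \<longrightarrow>
            (\<forall>x \<Omega> x' \<Omega>'. realizes_on U E F G e f g \<Lambda> I\<^sub>\<Omega> II\<^sub>\<Omega> x \<Omega> \<and>
                          realizes_on U E F G e f g \<Lambda> I\<^sub>\<Omega> II\<^sub>\<Omega> x' \<Omega>' \<longrightarrow>
              (\<exists>(a::real^3) (R::real^3^3). rotation_matrix R \<and>
                 (\<forall>p\<in>U. \<Omega>' p = R ** \<Omega> p \<and> x' p = a + R *v x p))))"
proof -
  note sm_l = \<open>smooth_on U l11\<close> \<open>smooth_on U l12\<close> \<open>smooth_on U l21\<close> \<open>smooth_on U l22\<close>
  note sm_O = \<open>smooth_on U E\<^sub>\<Omega>\<close> \<open>smooth_on U F\<^sub>\<Omega>\<close> \<open>smooth_on U G\<^sub>\<Omega>\<close>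
    \<open>smooth_on U e\<^sub>\<Omega>\<close> \<open>smooth_on U f1\<^sub>\<Omega>\<close> \<open>smooth_on U f2\<^sub>\<Omega>\<close> \<open>smooth_on U g\<^sub>\<Omega>\<close>
  have posO: "E\<^sub>\<Omega> p > 0" "E\<^sub>\<Omega> p * G\<^sub>\<Omega> p - (F\<^sub>\<Omega> p)\<^sup>2 > 0" if "p \<in> U" for p
    using assms(25) that by auto
  note U = \<open>open U\<close>
  \<comment> \<open>The Cholesky factor of the first form; positivity of its leading minors makes
    the roots smooth and the divisions legitimate.\<close>
  define s where "s p = sqrt (E\<^sub>\<Omega> p)" for p
  define m where "m p = F\<^sub>\<Omega> p / s p" for p
  define t where "t p = sqrt (E\<^sub>\<Omega> p * G\<^sub>\<Omega> p - (F\<^sub>\<Omega> p)\<^sup>2) / s p" for p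
  have pos: "s p > 0" "t p > 0" if "p \<in> U" for p
    using posO[OF that] by (simp_all add: s_def t_def)
  have pos0: "s p \<noteq> 0" "t p \<noteq> 0" if "p \<in> U" for p
    using pos[OF that] by simp_all
  have sm_s: "smooth_on U s"
    unfolding s_def by (intro smooth U sm_O posO)
  have sm_m: "smooth_on U m"
    unfolding m_def by (intro smooth U sm_O sm_s) (simp_all add: pos0)
  have sm_t: "smooth_on U t"
    unfolding t_def by (intro smooth U sm_O sm_s posO) (simp_all add: pos0)
  have stm: "E\<^sub>\<Omega> p = s p * s p" "F\<^sub>\<Omega> p = s p * m p" "G\<^sub>\<Omega> p = m p * m p + t p * t p" if p: "p \<in> U" for p
  proof -
    show 1: "E\<^sub>\<Omega> p = s p * s p" using posO[OF p] by (simp add: s_def)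
    show 2: "F\<^sub>\<Omega> p = s p * m p" using pos[OF p] by (simp add: m_def)
    have "(s p * t p) * (s p * t p) = E\<^sub>\<Omega> p * G\<^sub>\<Omega> p - (F\<^sub>\<Omega> p)\<^sup>2"
      using pos[OF p] posO[OF p] by (simp add: t_def)
    then have "(s p * s p) * (G\<^sub>\<Omega> p - (m p * m p + t p * t p)) = 0"
      unfolding 1 2 by (simp add: power2_eq_square algebra_simps)
    then show "G\<^sub>\<Omega> p = m p * m p + t p * t p" using pos[OF p] by simp
  qed
  define a11 where "a11 p = l11 p * s p + l12 p * m p" for p
  define a12 where "a12 p = l12 p * t p" for p
  define a21 where "a21 p = l21 p * s p + l22 p * m p" for p
  define a22 where "a22 p = l22 p * t p" for p
  \<comment> \<open>Forward substitution, column by column, for \<open>L\<close> times the transpose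
    of \<open>k\<close> equal to the second form.\<close>
  define k11 where "k11 p = e\<^sub>\<Omega> p / s p" for p
  define k12 where "k12 p = (f2\<^sub>\<Omega> p - m p * k11 p) / t p" for p
  define k21 where "k21 p = f1\<^sub>\<Omega> p / s p" for p
  define k22 where "k22 p = (g\<^sub>\<Omega> p - m p * k21 p) / t p" for p
  have sm_a: "smooth_on U a11" "smooth_on U a12" "smooth_on U a21" "smooth_on U a22"
    unfolding a11_def a12_def a21_def a22_def by (intro smooth U sm_l sm_s sm_m sm_t)+
  have sm_k1: "smooth_on U k11" "smooth_on U k21"
    unfolding k11_def k21_def by ((intro smooth U sm_O sm_s); simp_all add: pos0)+
  have sm_k2: "smooth_on U k12" "smooth_on U k22"
    unfolding k12_def k22_def by ((intro smooth U sm_O sm_m sm_t sm_k1); simp_all add: pos0)+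
  have k_eq: "e\<^sub>\<Omega> p = s p * k11 p" "f1\<^sub>\<Omega> p = s p * k21 p" "f2\<^sub>\<Omega> p = m p * k11 p + t p * k12 p"
    "g\<^sub>\<Omega> p = m p * k21 p + t p * k22 p" if "p \<in> U" for p
    using pos[OF that] by (simp_all add: k11_def k12_def k21_def k22_def)
  have EFG: "E p = a11 p * a11 p + a12 p * a12 p" "F p = a11 p * a21 p + a12 p * a22 p"
    "G p = a21 p * a21 p + a22 p * a22 p" if p: "p \<in> U" for p
    using assms(23)[rule_format, OF p] unfolding Lambda I transpose_mat2 mat2_mult mat2_eq_iff stm[OF p]
    by (simp_all add: a11_def a12_def a21_def a22_def algebra_simps)
  have efg: "e p = a11 p * k11 p + a12 p * k12 p" "f p = a11 p * k21 p + a12 p * k22 p"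
    "f p = a21 p * k11 p + a22 p * k12 p" "g p = a21 p * k21 p + a22 p * k22 p" if p: "p \<in> U" for p
    using assms(24)[rule_format, OF p] unfolding Lambda II mat2_mult mat2_eq_iff k_eq[OF p]
    by (simp_all add: a11_def a12_def a21_def a22_def algebra_simps)
  define dl where "dl p = l11 p * l22 p - l12 p * l21 p" for p
  have det: "det (\<Lambda> p) = dl p" for p
    by (simp add: Lambda det_2 dl_def)
  have la: "a11 p * a22 p - a12 p * a21 p = dl p * (s p * t p)" for p
    by (simp add: a11_def a12_def a21_def a22_def dl_def algebra_simps)
  have la0: "a11 p * a22 p - a12 p * a21 p = 0 \<longleftrightarrow> det (\<Lambda> p) = 0" if "p \<in> U" for p
    unfolding la det using pos[OF that] by simp
  then have dense: "interior {p \<in> U. a11 p * a22 p - a12 p * a21 p = 0} = {}"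
    using assms(26) by (simp cong: conj_cong)
  interpret frontal_data U a11 a12 a21 a22 k11 k12 k21 k22 E F G s m t l11 l12 l21 l22 e f g \<Lambda> I\<^sub>\<Omega> II\<^sub>\<Omega>
    by unfold_locales
      (use U sm_a sm_k1 sm_k2 EFG dense sm_s sm_m sm_t pos efg in
        \<open>simp_all add: Lambda I II stm k_eq a11_def a12_def a21_def a22_def\<close>)
  \<comment> \<open>Replacing \<open>\<Lambda>\<close> by \<open>\<Lambda> L\<close> creates a term
    in which the rows of \<open>\<Lambda>\<close> are paired by \<open>L_i L^T - L L_i^T\<close>,
    where \<open>L_i\<close> is the derivative. This matrix is skew with upper right entry
    \<open>pd i s * m - s * pd i m\<close>, so the term is that entry times
    \<open>dl\<close>.\<close>
  have form: "(pd i (\<lambda>q. row 1 (\<Lambda> q)) p v* I\<^sub>\<Omega> p) \<bullet> row 2 (\<Lambda> p) - (row 1 (\<Lambda> p) v* I\<^sub>\<Omega> p) \<bullet> pd i (\<lambda>q. row 2 (\<Lambda> q)) p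
      = pd i a11 p * a21 p + pd i a12 p * a22 p - (a11 p * pd i a21 p + a12 p * pd i a22 p)
        - dl p * (pd i s p * m p - s p * pd i m p)"
    if p: "p \<in> U" for i p
  proof -
    note d = sm_l[THEN smooth_on_differentiable, OF p] sm_s[THEN smooth_on_differentiable, OF p]
      sm_m[THEN smooth_on_differentiable, OF p] sm_t[THEN smooth_on_differentiable, OF p]
    have pa: "pd i a11 p = l11 p * pd i s p + pd i l11 p * s p + (l12 p * pd i m p + pd i l12 p * m p)"
      "pd i a12 p = l12 p * pd i t p + pd i l12 p * t p"
      "pd i a21 p = l21 p * pd i s p + pd i l21 p * s p + (l22 p * pd i m p + pd i l22 p * m p)"
      "pd i a22 p = l22 p * pd i t p + pd i l22 p * t p"
      unfolding a11_def[abs_def] a12_def[abs_def] a21_def[abs_def] a22_def[abs_def]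
      by (simp_all add: pd_add pd_mult d differentiable_mult)
    show ?thesis
      unfolding Lambda I row_mat2 pd_plane_point[OF d(1,2)] pd_plane_point[OF d(3,4)] plane_point_form
        stm[OF p] pa
      by (simp add: a11_def a12_def a21_def a22_def dl_def algebra_simps)
  qed
  obtain h1 where h1: "smooth_on U h1" and h1_eq: "\<And>p. p \<in> U \<Longrightarrow>
      (du (\<lambda>q. row 1 (\<Lambda> q)) p v* I\<^sub>\<Omega> p) \<bullet> row 2 (\<Lambda> p) - (row 1 (\<Lambda> p) v* I\<^sub>\<Omega> p) \<bullet> du (\<lambda>q. row 2 (\<Lambda> q)) p
       + dv E p - du F p = h1 p * dl p"
    using assms(27) unfolding principal_ideal_def det by auto
  obtain h2 where h2: "smooth_on U h2" and h2_eq: "\<And>p. p \<in> U \<Longrightarrow>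
      (dv (\<lambda>q. row 1 (\<Lambda> q)) p v* I\<^sub>\<Omega> p) \<bullet> row 2 (\<Lambda> p) - (row 1 (\<Lambda> p) v* I\<^sub>\<Omega> p) \<bullet> dv (\<lambda>q. row 2 (\<Lambda> q)) p
       + dv F p - du G p = h2 p * dl p"
    using assms(28) unfolding principal_ideal_def det by auto
  \<comment> \<open>By \<open>form\<close> and the product rule for \<open>F\<close>, adding
    \<open>h1 * dl\<close> to the skew term leaves \<open>dv E\<close> minus twice the pairing of
    row 1 of \<open>a\<close> with the \<open>u\<close>-derivative of row 2. That is
    \<open>-2\<close> times \<open>om1\<close> times \<open>dl * s * t\<close>, and
    \<open>dl\<close> cancels. The formula for \<open>om2\<close> arises in the same way.\<close>
  define om1 where "om1 p = - (h1 p + (du s p * m p - s p * du m p)) / (2 * (s p * t p))" for p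
  define om2 where "om2 p = - (h2 p + (dv s p * m p - s p * dv m p)) / (2 * (s p * t p))" for p
  have sm_om: "smooth_on U om1" "smooth_on U om2"
    unfolding om1_def om2_def
    by ((intro smooth U h1 h2 sm_s sm_m sm_t smooth_on_pd); simp_all add: pos0)+
  have conn: "connection_form om1 om2"
  proof (rule connection_formI[OF sm_om])
    fix p assume p: "p \<in> U"
    have "om1 p * (dl p * (s p * t p)) = - (h1 p * dl p + dl p * (du s p * m p - s p * du m p)) / 2"
      using pos[OF p] by (simp add: om1_def field_simps)
    then show "om1 p * (a11 p * a22 p - a12 p * a21 p) = a11 p * du a21 p + a12 p * du a22 p - dv E p / 2"
      unfolding la h1_eq[OF p, symmetric] form[OF p] pd_EFG(2)[OF p] by (simp add: field_simps)
    have "om2 p * (dl p * (s p * t p)) = - (h2 p * dl p + dl p * (dv s p * m p - s p * dv m p)) / 2"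
      using pos[OF p] by (simp add: om2_def field_simps)
    then show "om2 p * (a11 p * a22 p - a12 p * a21 p) = du G p / 2 - (a21 p * dv a11 p + a22 p * dv a12 p)"
      unfolding la h2_eq[OF p, symmetric] form[OF p] pd_EFG(2)[OF p] by (simp add: field_simps)
  qed
  have "\<exists>V x \<Omega>. open V \<and> p0 \<in> V \<and> V \<subseteq> U \<and> realizes_on V E F G e f g \<Lambda> I\<^sub>\<Omega> II\<^sub>\<Omega> x \<Omega>"
    if p0: "p0 \<in> U" for p0
  proof -
    have GMC: "gauss_eq_at E F G e f g p" "mainardi_codazzi_eqs_at E F G e f g p"
      if "p \<in> U" "a11 p * a22 p - a12 p * a21 p \<noteq> 0" for p
      using assms(29) that la0 by auto
    have str: "dv om1 p - du om2 p = k11 p * k22 p - k12 p * k21 p"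
      "dv k11 p - om2 p * k12 p = du k21 p - om1 p * k22 p"
      "dv k12 p + om2 p * k11 p = du k22 p + om1 p * k21 p" if p: "p \<in> U" for p
      by (rule structure_equations[OF conn efg GMC p]; assumption)+
    have sym: "a11 p * k21 p + a12 p * k22 p = a21 p * k11 p + a22 p * k12 p" if "p \<in> U" for p
      using efg[OF that] by simp
    show ?thesis
    proof (rule frame_exists[OF conn _ _ _ _ p0])
      fix V x e1 e2 e3
      assume V: "open V" "p0 \<in> V" "V \<subseteq> U"
        and frame: "smooth_on V x" "smooth_on V e1" "smooth_on V e2" "smooth_on V e3"
          "\<And>p. p \<in> V \<Longrightarrow> oriented_frame (e1 p) (e2 p) (e3 p)" "frame_eqs V om1 om2 e1 e2 e3"
          "\<And>p. p \<in> V \<Longrightarrow> du x p = a11 p *\<^sub>R e1 p + a12 p *\<^sub>R e2 p"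
          "\<And>p. p \<in> V \<Longrightarrow> dv x p = a21 p *\<^sub>R e1 p + a22 p *\<^sub>R e2 p"
      have "realizes_on V E F G e f g \<Lambda> I\<^sub>\<Omega> II\<^sub>\<Omega> x
          (\<lambda>p. of_columns2 (s p *\<^sub>R e1 p) (m p *\<^sub>R e1 p + t p *\<^sub>R e2 p))"
        by (rule realizes_onI[OF V(1,3) frame])
      with V show ?thesis by blast
    qed (fact sym str)+
  qed
  then show ?thesis using realizes_on_unique by blast
qed

end
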